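(* Assume: (1) $\mathcal H=\bigoplus_{n\ge0}\mathcal H_n$ is a graded connected Hopf algebra over $\mathbb R$, each $\mathcal H_n$ finite-dimensional with basis $\mathcal B_n$, $\mathcal B=\coprod_n\mathcal B_n$; (2) $\tau:\mathcal B\to\mathcal B$ is a graded involution whose linear extension is a Hopf ambimorphism; (3) $P$ is a probability distribution on signed weak-compositions of a fixed $n$, or on tilde-signed weak-compositions of $n$, and $m\circ\Delta_{P(\tau)}=\sum_D\frac{P(D)}{\binom{n}{D^+}}m\circ\Delta_{D(\tau)}$; (4) for each $D$ with $P(D)>0$, products $z_1\cdots z_{l(D)}$ ($z_i\in\mathcal B_{|d_i|}$) and coproducts $\Delta_{D^+}(x)$ ($x\in\mathcal B_n$) have nonnegative coefficients in the bases $\mathcal B_n$, resp. $\mathcal B_{|d_1|}\otimes\cdots\otimes\mathcal B_{|d_l|}$; (5) $\eta(x)>0$ for all $x\in\mathcal B_n$. Assume additionally that $P(D)>0$ for some $D$ with at least two nonzero parts, and $P(D)>0$ for some $D$ with at least one decorated part. Consider the Markov chain on $\mathcal B_n$ with transition matrix $K(x,y)=\frac{\eta(y)}{\eta(x)}\cdot(\text{coefficient of }y\text{ in }m\circ\Delta_{P(\tau)}(x))$. Then every stationary distribution of this chain (i.e. every $\pi:\mathcal B_n\to\mathbb R$ with $\sum_x\pi(x)K(x,y)=\pi(y)$ for all $y$) is a unique linear combination of the functions $\pi_{c_1,\dots,c_n}$, over all multisets $\{c_1,\dots,c_n\}$ of elements of $\mathcal B_1^{\tau}\cup\mathcal B_1^{-}$.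 Furthermore $\sum_{x\in\mathcal B_n}\pi_{c_1,\dots,c_n}(x)=1$. In particular, if $\mathcal B_1=\{\bullet\}$, then $\pi(x)=\frac{\eta(x)}{n!}\xi^x_{\bullet,\dots,\bullet}$ (where $\xi^x_{\bullet,\dots,\bullet}$ is the coefficient of $x$ in $\bullet^n$) is the unique stationary distribution.
   Context: Graded connected Hopf algebra: $\mathcal H_0=\mathbb R\cdot1$, product $m$ (iterated also $m$), coproduct $\Delta$; for a weak-composition $E=(e_1,\dots,e_l)$ of $n$, $\Delta_E$ is the iterated coproduct $\Delta^{[l]}$ on $\mathcal H_n$ projected to $\mathcal H_{e_1}\otimes\cdots\otimes\mathcal H_{e_l}$. Hopf ambimorphism: algebra morphism or antimorphism and coalgebra morphism or antimorphism. Signed (resp. tilde-signed) weak-compositions have some parts decorated with a bar (resp. tilde-bar); $D^+$ forgets decorations; $\binom{n}{D^+}$ is the multinomial coefficient; $m\circ\Delta_{D(\tau)}$ applies $\Delta_{D^+}$, then $\tau$ on factors for decorated parts, then multiplies. For a basis element $x$ of degree $j$, $\eta(x)$ is the sum of coefficients of $\Delta_{1,\dots,1}(x)$ in the basis $\mathcal B_1^{\otimes j}$. $\mathcal B_1^{\tau}$ is the set of elements of $\mathcal B_1$ fixed by $\tau$, and $\mathcal B_1^-$ is the set of averages $\frac12(b+\tau(b))$ over the $\tau$-orbits $\{b,\tau(b)\}$ of size $2$ in $\mathcal B_1$. For a multiset $\{c_1,\dots,c_n\}$ in $\mathcal B_1^{\tau}\cup\mathcal B_1^-$, $\pi_{c_1,\dots,c_n}(x):=\frac{\eta(x)}{n!^2}\sum_{\sigma\in\mathfrak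 S_n}(\text{coefficient of }x\text{ in }c_{\sigma(1)}\cdots c_{\sigma(n)})$ for $x\in\mathcal B_n$.
   Formalization: The claim on unique linear combinations is false as stated (R[a,b], τ swaps a,b, P at (1̄,1̄)); it is proved if τ fixes B_1 pointwise, or if some D with P(D)>0 has odd total decorated size and some such D has total decorated size strictly between 0 and n. The other claims are unchanged. *)

theory Defs
  imports
    "HOL-Probability.Probability_Mass_Function"
    "HOL-Combinatorics.Permutations"
    "HOL-Library.Multiset"
begin

section \<open>Graded connected Hopf algebras with a homogeneous basis\<close>

text \<open>
  The underlying real algebra is the whole type \<open>'h\<close>; its degree \<open>n\<close> part is
  \<open>span (B n)\<close>, where \<open>B n\<close> is the given basis in degree \<open>n\<close>.  Elements of the tensor powers
  of the algebra are written in coordinates with respect to the tensor powers of the basis: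
  \<open>\<Delta> h (u, v)\<close> is the coefficient of \<open>u \<otimes> v\<close> in the coproduct of \<open>h\<close>.
\<close>

definition coef :: "(nat \<Rightarrow> 'h::real_algebra_1 set) \<Rightarrow> 'h \<Rightarrow> 'h \<Rightarrow> real" where
  "coef B h b = representation (\<Union>k. B k) h b"

text \<open>
  The linear map determined by \<open>f\<close> on basis tensors, applied to the tensor with
  (finitely supported) coordinates \<open>t\<close>.
\<close>

definition lin_ext :: "('b \<Rightarrow> 'v::real_vector) \<Rightarrow> ('b \<Rightarrow> real) \<Rightarrow> 'v" where
  "lin_ext f t = (\<Sum>p | t p \<noteq> 0. t p *\<^sub>R f p)"

locale graded_connected_hopf_algebra =
  fixes B :: "nat \<Rightarrow> 'h::real_algebra_1 set"
    and \<Delta> :: "'h \<Rightarrow> 'h \<times> 'h \<Rightarrow> real"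
    and \<epsilon> :: "'h \<Rightarrow> real"
  assumes finite_basis: "finite (B k)"
    and disjoint_basis: "i \<noteq> j \<Longrightarrow> B i \<inter> B j = {}"
    and independent_basis: "independent (\<Union>k. B k)"
    and span_basis: "span (\<Union>k. B k) = UNIV"
    and connected: "span (B 0) = span {1}"
    and graded_mult: "\<lbrakk>g \<in> span (B i); h \<in> span (B j)\<rbrakk> \<Longrightarrow> g * h \<in> span (B (i + j))"
    and linear_coproduct: "linear (\<lambda>h. \<Delta> h p)"
    and finite_coproduct: "finite {p. \<Delta> h p \<noteq> 0}"
    and basis_coproduct: "\<Delta> h (u, v) \<noteq> 0 \<Longrightarrow> u \<in> (\<Union>k. B k) \<and> v \<in> (\<Union>k. B k)"
    and graded_coproduct:
      "\<lbrakk>h \<in> span (B k); \<Delta> h (u, v) \<noteq> 0; u \<in> B i; v \<in> B j\<rbrakk> \<Longrightarrow> i + j = k"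
    and linear_counit: "linear \<epsilon>"
    and graded_counit: "\<lbrakk>h \<in> span (B k); k > 0\<rbrakk> \<Longrightarrow> \<epsilon> h = 0"
    and coassociative:
      "lin_ext (\<lambda>(x, y). \<Delta> x (u, v) * coef B y w) (\<Delta> h)
       = lin_ext (\<lambda>(x, y). coef B x u * \<Delta> y (v, w)) (\<Delta> h)"
    and counit_left: "lin_ext (\<lambda>(x, y). \<epsilon> x *\<^sub>R y) (\<Delta> h) = h"
    and counit_right: "lin_ext (\<lambda>(x, y). \<epsilon> y *\<^sub>R x) (\<Delta> h) = h"
    and coproduct_one: "\<Delta> 1 (u, v) = coef B 1 u * coef B 1 v"
    and coproduct_mult:
      "\<Delta> (g * h) (u, v)
       = lin_ext (\<lambda>(x, y). lin_ext (\<lambda>(x', y'). coef B (x * x') u * coef B (y * y') v) (\<Delta> h)) (\<Delta> g)"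
    and counit_one: "\<epsilon> 1 = 1"
    and counit_mult: "\<epsilon> (g * h) = \<epsilon> g * \<epsilon> h"
    and antipode:
      "\<exists>S. linear S \<and>
         (\<forall>h. lin_ext (\<lambda>(x, y). S x * y) (\<Delta> h) = \<epsilon> h *\<^sub>R 1 \<and>
              lin_ext (\<lambda>(x, y). x * S y) (\<Delta> h) = \<epsilon> h *\<^sub>R 1)"

definition algebra_morphism :: "('h::real_algebra_1 \<Rightarrow> 'h) \<Rightarrow> bool" where
  "algebra_morphism \<tau> \<longleftrightarrow> linear \<tau> \<and> \<tau> 1 = 1 \<and> (\<forall>g h. \<tau> (g * h) = \<tau> g * \<tau> h)"

definition algebra_antimorphism :: "('h::real_algebra_1 \<Rightarrow> 'h) \<Rightarrow> bool" where
  "algebra_antimorphism \<tau> \<longleftrightarrow> linear \<tau> \<and> \<tau> 1 = 1 \<and> (\<forall>g h. \<tau> (g * h) = \<tau> h * \<tau> g)"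

definition coalgebra_morphism ::
  "(nat \<Rightarrow> 'h::real_algebra_1 set) \<Rightarrow> ('h \<Rightarrow> 'h \<times> 'h \<Rightarrow> real) \<Rightarrow> ('h \<Rightarrow> real) \<Rightarrow> ('h \<Rightarrow> 'h) \<Rightarrow> bool"
where
  "coalgebra_morphism B \<Delta> \<epsilon> \<tau> \<longleftrightarrow> linear \<tau> \<and> (\<forall>h. \<epsilon> (\<tau> h) = \<epsilon> h) \<and>
     (\<forall>h u v. \<Delta> (\<tau> h) (u, v) = lin_ext (\<lambda>(x, y). coef B (\<tau> x) u * coef B (\<tau> y) v) (\<Delta> h))"

definition coalgebra_antimorphism ::
  "(nat \<Rightarrow> 'h::real_algebra_1 set) \<Rightarrow> ('h \<Rightarrow> 'h \<times> 'h \<Rightarrow> real) \<Rightarrow> ('h \<Rightarrow> real) \<Rightarrow> ('h \<Rightarrow> 'h) \<Rightarrow> bool"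
where
  "coalgebra_antimorphism B \<Delta> \<epsilon> \<tau> \<longleftrightarrow> linear \<tau> \<and> (\<forall>h. \<epsilon> (\<tau> h) = \<epsilon> h) \<and>
     (\<forall>h u v. \<Delta> (\<tau> h) (u, v) = lin_ext (\<lambda>(x, y). coef B (\<tau> y) u * coef B (\<tau> x) v) (\<Delta> h))"

definition hopf_ambimorphism ::
  "(nat \<Rightarrow> 'h::real_algebra_1 set) \<Rightarrow> ('h \<Rightarrow> 'h \<times> 'h \<Rightarrow> real) \<Rightarrow> ('h \<Rightarrow> real) \<Rightarrow> ('h \<Rightarrow> 'h) \<Rightarrow> bool"
where
  "hopf_ambimorphism B \<Delta> \<epsilon> \<tau> \<longleftrightarrow>
     (algebra_morphism \<tau> \<or> algebra_antimorphism \<tau>) \<and>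
     (coalgebra_morphism B \<Delta> \<epsilon> \<tau> \<or> coalgebra_antimorphism B \<Delta> \<epsilon> \<tau>)"

text \<open>
  \<open>\<tau>\<close> is the linear extension of an involution of \<open>\<Union>k. B k\<close> that preserves degrees.
\<close>

definition graded_basis_involution ::
  "(nat \<Rightarrow> 'h::real_algebra_1 set) \<Rightarrow> ('h \<Rightarrow> 'h) \<Rightarrow> bool" where
  "graded_basis_involution B \<tau> \<longleftrightarrow> linear \<tau> \<and> (\<forall>k. \<forall>b\<in>B k. \<tau> b \<in> B k \<and> \<tau> (\<tau> b) = b)"


section \<open>Refined coproducts and decorated weak-compositions\<close>

text \<open>
  \<open>iter_coproduct B \<Delta> \<epsilon> w h\<close> is the coefficient of \<open>w\<^sub>1 \<otimes> \<dots> \<otimes> w\<^sub>l\<close> in the \<open>l\<close>-fold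
  iterated coproduct of \<open>h\<close>, where \<open>l = length w\<close>.
\<close>

fun iter_coproduct ::
  "(nat \<Rightarrow> 'h::real_algebra_1 set) \<Rightarrow> ('h \<Rightarrow> 'h \<times> 'h \<Rightarrow> real) \<Rightarrow> ('h \<Rightarrow> real) \<Rightarrow> 'h list \<Rightarrow> 'h \<Rightarrow> real"
where
  "iter_coproduct B \<Delta> \<epsilon> [] h = \<epsilon> h"
| "iter_coproduct B \<Delta> \<epsilon> [u] h = coef B h u"
| "iter_coproduct B \<Delta> \<epsilon> (u # v # w) h =
     lin_ext (\<lambda>(x, y). coef B x u * iter_coproduct B \<Delta> \<epsilon> (v # w) y) (\<Delta> h)"

definition refined_coproduct ::
  "(nat \<Rightarrow> 'h::real_algebra_1 set) \<Rightarrow> ('h \<Rightarrow> 'h \<times> 'h \<Rightarrow> real) \<Rightarrow> ('h \<Rightarrow> real) \<Rightarrow> nat list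
     \<Rightarrow> 'h \<Rightarrow> 'h list \<Rightarrow> real"
where
  "refined_coproduct B \<Delta> \<epsilon> E h w =
     (if list_all2 (\<lambda>u e. u \<in> B e) w E then iter_coproduct B \<Delta> \<epsilon> w h else 0)"

datatype decoration = Plain | Bar | TildeBar

type_synonym decorated_composition = "(nat \<times> decoration) list"

definition forget_decorations :: "decorated_composition \<Rightarrow> nat list" where
  "forget_decorations D = map fst D"

definition signed_weak_compositions :: "nat \<Rightarrow> decorated_composition set" where
  "signed_weak_compositions n =
     {D. sum_list (forget_decorations D) = n \<and> (\<forall>d\<in>set D. snd d \<in> {Plain, Bar})}"

definition tilde_signed_weak_compositions :: "nat \<Rightarrow> decorated_composition set" where
  "tilde_signed_weak_compositions n =
     {D. sum_list (forget_decorations D) = n \<and> (\<forall>d\<in>set D. snd d \<in> {Plain, TildeBar})}"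

definition decorated :: "nat \<times> decoration \<Rightarrow> bool" where
  "decorated d \<longleftrightarrow> snd d \<noteq> Plain"

definition decorated_size :: "decorated_composition \<Rightarrow> nat" where
  "decorated_size D = sum_list (forget_decorations (filter decorated D))"

definition multinomial :: "nat list \<Rightarrow> real" where
  "multinomial E = fact (sum_list E) / (\<Prod>e\<leftarrow>E. fact e)"

definition signed_descent_op ::
  "(nat \<Rightarrow> 'h::real_algebra_1 set) \<Rightarrow> ('h \<Rightarrow> 'h \<times> 'h \<Rightarrow> real) \<Rightarrow> ('h \<Rightarrow> real) \<Rightarrow> ('h \<Rightarrow> 'h)
     \<Rightarrow> decorated_composition \<Rightarrow> 'h \<Rightarrow> 'h"
where
  "signed_descent_op B \<Delta> \<epsilon> \<tau> D h =
     lin_ext (\<lambda>w. prod_list (map2 (\<lambda>d u. if decorated d then \<tau> u else u) D w))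
       (refined_coproduct B \<Delta> \<epsilon> (forget_decorations D) h)"

text \<open>
  Zero parts make the set of decorated weak-compositions of \<open>n\<close> infinite, so the weighted sum
  over \<open>D\<close> is formed as an expectation, coefficient by coefficient.
\<close>

definition averaged_descent_op ::
  "(nat \<Rightarrow> 'h::real_algebra_1 set) \<Rightarrow> ('h \<Rightarrow> 'h \<times> 'h \<Rightarrow> real) \<Rightarrow> ('h \<Rightarrow> real) \<Rightarrow> ('h \<Rightarrow> 'h)
     \<Rightarrow> nat \<Rightarrow> decorated_composition pmf \<Rightarrow> 'h \<Rightarrow> 'h"
where
  "averaged_descent_op B \<Delta> \<epsilon> \<tau> n P h =
     (\<Sum>y\<in>B n. measure_pmf.expectation P
        (\<lambda>D. coef B (signed_descent_op B \<Delta> \<epsilon> \<tau> D h) y / multinomial (forget_decorations D)) *\<^sub>R y)"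


section \<open>The Markov chain and the functions \<open>\<pi>\<close>\<close>

definition eta ::
  "(nat \<Rightarrow> 'h::real_algebra_1 set) \<Rightarrow> ('h \<Rightarrow> 'h \<times> 'h \<Rightarrow> real) \<Rightarrow> ('h \<Rightarrow> real) \<Rightarrow> nat \<Rightarrow> 'h \<Rightarrow> real"
where
  "eta B \<Delta> \<epsilon> j x =
     (\<Sum>w | length w = j \<and> set w \<subseteq> B 1. refined_coproduct B \<Delta> \<epsilon> (replicate j 1) x w)"

definition transition ::
  "(nat \<Rightarrow> 'h::real_algebra_1 set) \<Rightarrow> ('h \<Rightarrow> 'h \<times> 'h \<Rightarrow> real) \<Rightarrow> ('h \<Rightarrow> real) \<Rightarrow> ('h \<Rightarrow> 'h)
     \<Rightarrow> nat \<Rightarrow> decorated_composition pmf \<Rightarrow> 'h \<Rightarrow> 'h \<Rightarrow> real"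
where
  "transition B \<Delta> \<epsilon> \<tau> n P x y =
     eta B \<Delta> \<epsilon> n y / eta B \<Delta> \<epsilon> n x * coef B (averaged_descent_op B \<Delta> \<epsilon> \<tau> n P x) y"

definition stationary :: "'s set \<Rightarrow> ('s \<Rightarrow> 's \<Rightarrow> real) \<Rightarrow> ('s \<Rightarrow> real) \<Rightarrow> bool" where
  "stationary S K \<pi> \<longleftrightarrow> (\<forall>y\<in>S. (\<Sum>x\<in>S. \<pi> x * K x y) = \<pi> y)"

definition fixed_elements ::
  "(nat \<Rightarrow> 'h::real_algebra_1 set) \<Rightarrow> ('h \<Rightarrow> 'h) \<Rightarrow> 'h set" where
  "fixed_elements B \<tau> = {b \<in> B 1. \<tau> b = b}"

definition orbit_averages ::
  "(nat \<Rightarrow> 'h::real_algebra_1 set) \<Rightarrow> ('h \<Rightarrow> 'h) \<Rightarrow> 'h set" where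
  "orbit_averages B \<tau> = {(1 / 2) *\<^sub>R (b + \<tau> b) | b. b \<in> B 1 \<and> \<tau> b \<noteq> b}"

definition index_multisets ::
  "(nat \<Rightarrow> 'h::real_algebra_1 set) \<Rightarrow> ('h \<Rightarrow> 'h) \<Rightarrow> nat \<Rightarrow> 'h multiset set" where
  "index_multisets B \<tau> n =
     {C. size C = n \<and> set_mset C \<subseteq> fixed_elements B \<tau> \<union> orbit_averages B \<tau>}"

definition pi_list ::
  "(nat \<Rightarrow> 'h::real_algebra_1 set) \<Rightarrow> ('h \<Rightarrow> 'h \<times> 'h \<Rightarrow> real) \<Rightarrow> ('h \<Rightarrow> real)
     \<Rightarrow> 'h list \<Rightarrow> 'h \<Rightarrow> real"
where
  "pi_list B \<Delta> \<epsilon> cs x =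
     eta B \<Delta> \<epsilon> (length cs) x / (fact (length cs))\<^sup>2 *
     (\<Sum>\<sigma> | \<sigma> permutes {..<length cs}. coef B (prod_list (permute_list \<sigma> cs)) x)"

lemma pi_list_mset_cong:
  assumes "mset cs = mset ds"
  shows "pi_list B \<Delta> \<epsilon> cs x = pi_list B \<Delta> \<epsilon> ds x"
proof -
  obtain p where p: "p permutes {..<length ds}" "permute_list p ds = cs"
    using mset_eq_permutation[OF assms] .
  have len: "length cs = length ds"
    using assms by (metis size_mset)
  have "(\<Sum>\<sigma> | \<sigma> permutes {..<length ds}. coef B (prod_list (permute_list \<sigma> ds)) x) =
        (\<Sum>\<sigma> | \<sigma> permutes {..<length ds}. coef B (prod_list (permute_list (p \<circ> \<sigma>) ds)) x)"
    by (rule setum_permutations_compose_left[OF p(1)])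
  also have "\<dots> = (\<Sum>\<sigma> | \<sigma> permutes {..<length ds}. coef B (prod_list (permute_list \<sigma> cs)) x)"
    using p(2) by (intro sum.cong) (auto simp: permute_list_compose)
  finally show ?thesis
    by (simp add: pi_list_def len)
qed

definition pi_fun ::
  "(nat \<Rightarrow> 'h::real_algebra_1 set) \<Rightarrow> ('h \<Rightarrow> 'h \<times> 'h \<Rightarrow> real) \<Rightarrow> ('h \<Rightarrow> real)
     \<Rightarrow> 'h multiset \<Rightarrow> 'h \<Rightarrow> real"
where
  "pi_fun B \<Delta> \<epsilon> C = pi_list B \<Delta> \<epsilon> (SOME cs. mset cs = C)"

lemma pi_fun_mset: "pi_fun B \<Delta> \<epsilon> (mset cs) = pi_list B \<Delta> \<epsilon> cs"
  unfolding pi_fun_def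
  by (rule ext, rule pi_list_mset_cong, rule someI[of _ cs]) simp

text \<open>
  When \<open>\<tau>\<close> moves some \<open>b \<in> B 1\<close>, put \<open>p = b - \<tau> b\<close> and \<open>q = b + \<tau> b\<close>.  If the decorated
  size of every \<open>D\<close> in the support is even, then \<open>p ^ n\<close> is fixed by the averaged operator; if
  it is always \<open>0\<close> or \<open>n\<close>, the symmetrization of \<open>p ^ 2 * q ^ (n - 2)\<close> is.  Neither lies in the
  span of the symmetrized products of \<open>\<tau>\<close>-invariant elements of degree 1.  This condition rules
  out exactly these two obstructions.
\<close>

definition decorations_mix ::
  "(nat \<Rightarrow> 'h::real_algebra_1 set) \<Rightarrow> ('h \<Rightarrow> 'h) \<Rightarrow> nat \<Rightarrow> decorated_composition pmf \<Rightarrow> bool"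
where
  "decorations_mix B \<tau> n P \<longleftrightarrow>
     (\<forall>b\<in>B 1. \<tau> b = b) \<or>
     (\<exists>D\<in>set_pmf P. odd (decorated_size D)) \<and>
     (\<exists>D\<in>set_pmf P. 0 < decorated_size D \<and> decorated_size D < n)"

end

theory Submission
  imports Defs
begin

text \<open>
  Dividing by \<open>\<eta>\<close> turns stationary distributions into vectors of degree \<open>n\<close> fixed by the averaged
  operator.  Such a vector \<open>h\<close> is studied through the coefficients of its iterated coproducts, indexed
  by words \<open>w\<close> in basis elements of positive degree.  On the longest words on which these coefficients
  do not vanish, multiplicativity of the coproduct and coassociativity show that the operator of \<open>D\<close>
  merely distributes the letters of \<open>w\<close> over the parts of \<open>D\<close>, applies \<open>\<tau>\<close> to the decorated parts
  and concatenates.  The number of such distributions is at most the multinomial coefficient, and it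
  is strictly smaller if \<open>D\<close> has two nonzero parts and some letter has degree at least 2.  So the
  operator contracts the coefficients on such words strictly, and a fixed vector whose coefficients
  on words of degree 1 letters vanish is zero.

  On words of degree 1 letters the operator is an average of bijections, hence the coefficients of
  a fixed vector are invariant under each of them; these bijections generate all permutations and
  (by the mixing condition) all letterwise applications of \<open>\<tau>\<close>.  The symmetrized products of
  \<open>\<tau>\<close>-invariant elements of degree 1 realise every invariant function, and they are fixed vectors:
  by polarization this reduces to powers \<open>c ^ n\<close>, for which it is the binomial theorem.
\<close>

section \<open>Iterated coproducts\<close>

text \<open>Letters have positive degree because degree zero letters could prolong a word without
  bound. Without them a word of weight \<open>n\<close> has length at most \<open>n\<close>, so
  longest words exist and a downward induction on length can start. Looking only at longest words
  amounts to passing to the associated graded object of a filtration by word length; there the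
  product becomes the shuffle product, which is commutative even if the given product is not.

  The gap in the count has a simple picture. A word of weight \<open>n\<close> cuts \<open>n\<close>
  positions into blocks, one for each letter. The multinomial coefficient counts all distributions
  of the positions over the parts, while the operator distributes whole blocks; something is lost as
  soon as a block of size at least two could have been cut. The contraction concerns the maximum of
  absolute values, so the signs of the coefficients of the fixed vector do not matter.

  On blocks of size one nothing is lost, so invariance there needs a convexity argument, and the
  support of \<open>P\<close> decides which rearrangements are available.\<close>

context graded_connected_hopf_algebra
begin

section \<open>Coordinates with respect to the homogeneous basis\<close>

abbreviation basis :: "'h set" where
  "basis \<equiv> \<Union>k. B k"

lemma linear_coef: "linear (\<lambda>h. coef B h b)"
  unfolding coef_def
  using representation_add[OF independent_basis] representation_scale[OF independent_basis]
  by (intro linearI) (simp_all add: span_basis)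

lemma coef_basis: "x \<in> basis \<Longrightarrow> coef B x b = (if x = b then 1 else 0)"
  unfolding coef_def by (simp add: representation_basis independent_basis)

lemma coef_outside: "b \<notin> basis \<Longrightarrow> coef B h b = 0"
  unfolding coef_def using representation_ne_zero by blast

lemma finite_coef: "finite {b. coef B h b \<noteq> 0}"
  unfolding coef_def by (rule finite_representation)

lemma coef_expansion:
  assumes "finite X" "{b. coef B h b \<noteq> 0} \<subseteq> X"
  shows "(\<Sum>b\<in>X. coef B h b *\<^sub>R b) = h"
proof -
  have "(\<Sum>b\<in>X. coef B h b *\<^sub>R b) = (\<Sum>b | coef B h b \<noteq> 0. coef B h b *\<^sub>R b)"
    by (rule sum.mono_neutral_right) (use assms in auto)
  also have "\<dots> = h"
    unfolding coef_def
    by (rule sum_nonzero_representation_eq[OF independent_basis]) (simp add: span_basis)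
  finally show ?thesis .
qed

lemma coef_eqI:
  assumes "\<And>b. coef B g b = coef B h b"
  shows "g = h"
proof -
  have "coef B g = coef B h" using assms by blast
  then show ?thesis
    using coef_expansion[OF finite_coef order_refl, of g]
          coef_expansion[OF finite_coef order_refl, of h] by metis
qed

lemmas coef_add = linear_add[OF linear_coef]
lemmas coef_scale = linear_scale[OF linear_coef]
lemmas coef_sum = linear_sum[OF linear_coef]
lemmas coef_zero = linear_0[OF linear_coef]
lemmas coproduct_add = linear_add[OF linear_coproduct]
lemmas coproduct_scale = linear_scale[OF linear_coproduct]
lemmas coproduct_sum = linear_sum[OF linear_coproduct]

lemma coef_combination:
  assumes "finite X" "X \<subseteq> basis"
  shows "coef B (\<Sum>x\<in>X. f x *\<^sub>R x) b = (if b \<in> X then f b else 0)"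
proof -
  have "coef B (\<Sum>x\<in>X. f x *\<^sub>R x) b = (\<Sum>x\<in>X. if x = b then f x else 0)"
    unfolding coef_sum using assms(2) coef_basis
    by (intro sum.cong refl) (simp add: coef_scale subset_eq)
  then show ?thesis using assms(1) by (simp add: sum.delta)
qed

lemma coef_graded:
  assumes "h \<in> span (B k)" "b \<notin> B k"
  shows "coef B h b = 0"
  using assms(1)
proof (induction rule: span_induct_alt)
  case base
  then show ?case by (simp add: coef_zero)
next
  case (step c x y)
  then have "x \<in> basis" "x \<noteq> b" using assms(2) by auto
  then show ?case by (simp add: coef_add coef_scale coef_basis step)
qed

lemma graded_expansion:
  assumes "h \<in> span (B k)"
  shows "(\<Sum>b\<in>B k. coef B h b *\<^sub>R b) = h"
  using coef_graded[OF assms] by (intro coef_expansion finite_basis) blast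

lemma gradedI:
  assumes "\<And>b. b \<notin> B k \<Longrightarrow> coef B h b = 0"
  shows "h \<in> span (B k)"
proof -
  have "(\<Sum>b\<in>B k. coef B h b *\<^sub>R b) = h"
    using assms by (intro coef_expansion finite_basis) blast
  then show ?thesis by (metis (no_types, lifting) span_base span_scale span_sum)
qed

text \<open>\<open>contract u\<close> and \<open>contract_right u\<close> pair one tensor factor of the coproduct with the basis
  functional dual to \<open>u\<close>.\<close>

definition contract :: "'h \<Rightarrow> 'h \<Rightarrow> 'h" where
  "contract u h = (\<Sum>v\<in>{v. \<Delta> h (u, v) \<noteq> 0}. \<Delta> h (u, v) *\<^sub>R v)"

definition contract_right :: "'h \<Rightarrow> 'h \<Rightarrow> 'h" where
  "contract_right u h = (\<Sum>v\<in>{v. \<Delta> h (v, u) \<noteq> 0}. \<Delta> h (v, u) *\<^sub>R v)"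

lemma finite_coproduct_slices:
  "finite {v. \<Delta> h (u, v) \<noteq> 0}" "finite {v. \<Delta> h (v, u) \<noteq> 0}"
proof -
  have "{v. \<Delta> h (u, v) \<noteq> 0} \<subseteq> snd ` {p. \<Delta> h p \<noteq> 0}"
       "{v. \<Delta> h (v, u) \<noteq> 0} \<subseteq> fst ` {p. \<Delta> h p \<noteq> 0}"
    by (auto simp: image_iff)
  then show "finite {v. \<Delta> h (u, v) \<noteq> 0}" "finite {v. \<Delta> h (v, u) \<noteq> 0}"
    using finite_coproduct by (meson finite_imageI finite_subset)+
qed

lemma coef_contract: "coef B (contract u h) v = \<Delta> h (u, v)"
  unfolding contract_def using basis_coproduct[of h u]
  by (subst coef_combination[OF finite_coproduct_slices(1)]) auto

lemma coef_contract_right: "coef B (contract_right u h) v = \<Delta> h (v, u)"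
  unfolding contract_right_def using basis_coproduct[of h _ u]
  by (subst coef_combination[OF finite_coproduct_slices(2)]) auto

lemma linear_contract: "linear (contract u)"
  by (intro linearI coef_eqI)
     (simp_all add: coef_contract coef_add coef_scale coproduct_add coproduct_scale)

lemma contract_outside: "u \<notin> basis \<Longrightarrow> contract u h = 0"
  by (rule coef_eqI) (metis basis_coproduct coef_contract coef_zero)

lemma linear_contract_list: "linear (fold contract w)"
proof (induction w)
  case Nil
  then show ?case using linear_id by (simp add: id_def)
next
  case (Cons a w)
  then show ?case using linear_compose[OF linear_contract[of a] Cons] by (simp add: comp_def)
qed

text \<open>Contracting the letters from the left and closing with the counit turns concatenation of
  words into composition of linear maps; \<open>iter_coproduct_eq\<close> identifies the result with
  the coefficient of the iterated coproduct.\<close>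

definition word_coef :: "'h list \<Rightarrow> 'h \<Rightarrow> real" where
  "word_coef w h = \<epsilon> (fold contract w h)"

lemma word_coef_Nil: "word_coef [] h = \<epsilon> h"
  and word_coef_Cons: "word_coef (a # w) h = word_coef w (contract a h)"
  and word_coef_append: "word_coef (v @ w) h = word_coef w (fold contract v h)"
  by (simp_all add: word_coef_def)

lemma linear_word_coef: "linear (word_coef w)"
  using linear_compose[OF linear_contract_list linear_counit]
  by (simp add: word_coef_def[abs_def] comp_def)

lemmas word_coef_add = linear_add[OF linear_word_coef]
lemmas word_coef_diff = linear_diff[OF linear_word_coef]
lemmas word_coef_scale = linear_scale[OF linear_word_coef]
lemmas word_coef_sum = linear_sum[OF linear_word_coef]
lemmas word_coef_zero = linear_0[OF linear_word_coef]

text \<open>A basis element has coordinate 1 at itself and 0 elsewhere, so only the tensors with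
  first factor \<open>u\<close> survive. This is the bridge from axioms phrased with
  \<open>lin_ext\<close> to contractions.\<close>

lemma lin_ext_coproduct_fst:
  fixes f :: "'h \<Rightarrow> 'v::real_vector"
  assumes "linear f"
  shows "lin_ext (\<lambda>(x, y). coef B x u *\<^sub>R f y) (\<Delta> h) = f (contract u h)"
proof -
  let ?X = "{p. \<Delta> h p \<noteq> 0}"
  have "lin_ext (\<lambda>(x, y). coef B x u *\<^sub>R f y) (\<Delta> h)
      = (\<Sum>p\<in>?X. \<Delta> h p *\<^sub>R (if fst p = u then f (snd p) else 0))"
    unfolding lin_ext_def
    by (intro sum.cong) (auto simp: coef_basis[OF UN_I] dest!: basis_coproduct)
  also have "\<dots> = (\<Sum>p\<in>Pair u ` {v. \<Delta> h (u, v) \<noteq> 0}. \<Delta> h p *\<^sub>R f (snd p))"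
    using finite_coproduct by (intro sum.mono_neutral_cong_right) auto
  also have "\<dots> = (\<Sum>v\<in>{v. \<Delta> h (u, v) \<noteq> 0}. \<Delta> h (u, v) *\<^sub>R f v)"
    by (subst sum.reindex) (auto simp: inj_on_def)
  also have "\<dots> = f (contract u h)"
    unfolding contract_def linear_sum[OF assms] linear_scale[OF assms] ..
  finally show ?thesis .
qed

lemma lin_ext_coproduct_snd:
  fixes f :: "'h \<Rightarrow> 'v::real_vector"
  assumes "linear f"
  shows "lin_ext (\<lambda>(x, y). coef B y u *\<^sub>R f x) (\<Delta> h) = f (contract_right u h)"
proof -
  let ?X = "{p. \<Delta> h p \<noteq> 0}"
  have "lin_ext (\<lambda>(x, y). coef B y u *\<^sub>R f x) (\<Delta> h)
      = (\<Sum>p\<in>?X. \<Delta> h p *\<^sub>R (if snd p = u then f (fst p) else 0))"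
    unfolding lin_ext_def
    by (intro sum.cong) (auto simp: coef_basis[OF UN_I] dest!: basis_coproduct)
  also have "\<dots> = (\<Sum>p\<in>(\<lambda>v. (v, u)) ` {v. \<Delta> h (v, u) \<noteq> 0}. \<Delta> h p *\<^sub>R f (fst p))"
    using finite_coproduct by (intro sum.mono_neutral_cong_right) auto
  also have "\<dots> = (\<Sum>v\<in>{v. \<Delta> h (v, u) \<noteq> 0}. \<Delta> h (v, u) *\<^sub>R f v)"
    by (subst sum.reindex) (auto simp: inj_on_def)
  also have "\<dots> = f (contract_right u h)"
    unfolding contract_right_def linear_sum[OF assms] linear_scale[OF assms] ..
  finally show ?thesis .
qed

lemma coef_lin_ext: "coef B (lin_ext f t) b = lin_ext (\<lambda>p. coef B (f p) b) t"
  unfolding lin_ext_def by (simp add: coef_sum coef_scale)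

lemma counit_contract: "\<epsilon> (contract u h) = coef B h u"
proof -
  have "coef B h u = coef B (lin_ext (\<lambda>(x, y). \<epsilon> y *\<^sub>R x) (\<Delta> h)) u"
    by (simp only: counit_right)
  also have "\<dots> = lin_ext (\<lambda>(x, y). coef B x u *\<^sub>R \<epsilon> y) (\<Delta> h)"
    unfolding coef_lin_ext by (simp add: case_prod_unfold coef_scale mult.commute)
  finally show ?thesis using lin_ext_coproduct_fst[OF linear_counit, of u h] by metis
qed

lemma counit_contract_right: "\<epsilon> (contract_right u h) = coef B h u"
proof -
  have "coef B h u = coef B (lin_ext (\<lambda>(x, y). \<epsilon> x *\<^sub>R y) (\<Delta> h)) u"
    by (simp only: counit_left)
  also have "\<dots> = lin_ext (\<lambda>(x, y). coef B y u *\<^sub>R \<epsilon> x) (\<Delta> h)"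
    unfolding coef_lin_ext by (simp add: case_prod_unfold coef_scale mult.commute)
  finally show ?thesis using lin_ext_coproduct_snd[OF linear_counit, of u h] by metis
qed

lemma word_coef_singleton: "word_coef [u] h = coef B h u"
  by (simp add: word_coef_def counit_contract)

lemma iter_coproduct_eq: "iter_coproduct B \<Delta> \<epsilon> w h = word_coef w h"
proof (induction w arbitrary: h rule: induct_list012)
  case 1
  then show ?case by (simp add: word_coef_def)
next
  case (2 u)
  then show ?case by (simp add: word_coef_singleton)
next
  case (3 u v w)
  then show ?case
    using lin_ext_coproduct_fst[OF linear_word_coef, of u "v # w" h] by (simp add: word_coef_Cons)
qed

lemma coassociative_contract:
  "\<Delta> (contract_right w h) (u, v) = \<Delta> (contract u h) (v, w)"
  using coassociative[of u v w h]
    lin_ext_coproduct_fst[OF linear_coproduct[of "(v, w)"], of u h]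
    lin_ext_coproduct_snd[OF linear_coproduct[of "(u, v)"], of w h]
  by (simp add: case_prod_beta mult.commute)

text \<open>Coassociativity in operator form. It allows a word to be consumed from its right end, as
  \<open>word_coef_snoc\<close> does, which is what a coalgebra antimorphism calls for.\<close>

lemma contract_contract_right: "contract u (contract_right v h) = contract_right v (contract u h)"
  by (rule coef_eqI) (simp add: coef_contract coef_contract_right coassociative_contract)

lemma fold_contract_contract_right:
  "fold contract w (contract_right v h) = contract_right v (fold contract w h)"
  by (induction w arbitrary: h) (simp_all add: contract_contract_right)

lemma word_coef_snoc: "word_coef (w @ [v]) h = word_coef w (contract_right v h)"
proof -
  have "word_coef (w @ [v]) h = coef B (fold contract w h) v"
    by (simp add: word_coef_append word_coef_singleton)
  also have "\<dots> = word_coef w (contract_right v h)"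
    by (simp add: word_coef_def fold_contract_contract_right counit_contract_right)
  finally show ?thesis .
qed

subsection \<open>Grading\<close>

lemma basis_degree_unique: "\<lbrakk>b \<in> B i; b \<in> B j\<rbrakk> \<Longrightarrow> i = j"
  using disjoint_basis by blast

lemma contract_graded:
  assumes "h \<in> span (B k)" "u \<in> B i"
  shows "i \<le> k \<Longrightarrow> contract u h \<in> span (B (k - i))" and "k < i \<Longrightarrow> contract u h = 0"
proof -
  have *: "\<Delta> h (u, v) = 0 \<or> (\<exists>j. v \<in> B j \<and> i + j = k)" for v
    using basis_coproduct[of h u v] graded_coproduct[OF assms(1) _ assms(2), of v] by blast
  show "contract u h \<in> span (B (k - i))" if "i \<le> k"
    using * by (intro gradedI) (force simp: coef_contract)
  show "contract u h = 0" if "k < i"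
    using * that by (intro coef_eqI) (force simp: coef_contract coef_zero)
qed

text \<open>Unspecified outside the basis, so statements about weights carry a hypothesis that the
  letters are basis elements.\<close>

definition deg :: "'h \<Rightarrow> nat" where
  "deg b = (SOME k. b \<in> B k)"

lemma deg_eq: "b \<in> B k \<Longrightarrow> deg b = k"
  unfolding deg_def by (rule some_equality) (auto dest: basis_degree_unique)

definition positive_basis :: "'h set" where
  "positive_basis = (\<Union>k\<in>{0<..}. B k)"

lemma positive_basis_iff: "b \<in> positive_basis \<longleftrightarrow> b \<in> B (deg b) \<and> deg b > 0"
  unfolding positive_basis_def using deg_eq by blast

lemma positive_basisI: "b \<in> B k \<Longrightarrow> k > 0 \<Longrightarrow> b \<in> positive_basis"
  unfolding positive_basis_def by blast

definition weight :: "'h list \<Rightarrow> nat" where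
  "weight w = sum_list (map deg w)"

lemma weight_simps [simp]:
  "weight [] = 0" "weight (a # w) = deg a + weight w" "weight (v @ w) = weight v + weight w"
  by (simp_all add: weight_def)

lemma word_coef_graded:
  assumes "h \<in> span (B k)" "set w \<subseteq> basis" "weight w \<noteq> k"
  shows "word_coef w h = 0"
  using assms
proof (induction w arbitrary: h k)
  case Nil
  then show ?case by (simp add: word_coef_Nil graded_counit)
next
  case (Cons a w)
  then obtain i where i: "a \<in> B i" by auto
  show ?case
  proof (cases "i \<le> k")
    case True
    then have "word_coef w (contract a h) = 0"
      using Cons.prems contract_graded(1)[OF Cons.prems(1) i] deg_eq[OF i]
      by (intro Cons.IH[of _ "k - i"]) auto
    then show ?thesis by (simp add: word_coef_Cons)
  next
    case False
    then show ?thesis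
      using contract_graded(2)[OF Cons.prems(1) i] by (simp add: word_coef_Cons word_coef_zero)
  qed
qed

subsection \<open>Degree zero\<close>

text \<open>Connectedness makes degree zero a line, but its basis element need not be
  \<open>1\<close>. The factor \<open>\<beta>\<close> between the two has to be carried through
  every computation with degree zero.\<close>

lemma basis_zero:
  obtains b \<beta> where "B 0 = {b}" "b = \<beta> *\<^sub>R 1" "\<beta> \<noteq> 0" "\<epsilon> b = \<beta>"
proof -
  have ind: "independent (B 0)"
    using independent_basis by (rule independent_mono) auto
  have "card (B 0) = dim (span (B 0))"
    using dim_span_eq_card_independent[OF ind] by simp
  also have "\<dots> = 1"
    using dim_span_eq_card_independent[of "{1 :: 'h}"] by (simp add: connected)
  finally obtain b where b: "B 0 = {b}" by (auto simp: card_1_singleton_iff)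
  then have "b \<in> span {1}" using connected by (metis insertI1 span_base)
  then obtain \<beta> where \<beta>: "b = \<beta> *\<^sub>R 1" by (auto simp: span_singleton)
  moreover have "\<beta> \<noteq> 0" using ind b \<beta> by (auto simp: dependent_single)
  moreover have "\<epsilon> b = \<beta>" by (simp add: \<beta> linear_scale[OF linear_counit] counit_one)
  ultimately show ?thesis using that b by blast
qed

lemma one_graded: "1 \<in> span (B 0)"
  by (simp add: connected span_base)

text \<open>In the left counit axiom the counit kills every first tensor factor of positive degree;
  the only other possible factor is \<open>b\<close> itself, which enters with weight
  \<open>\<epsilon> b\<close>.\<close>

lemma contract_unit:
  assumes "b \<in> B 0"
  shows "\<epsilon> b *\<^sub>R contract b h = h"
proof (rule coef_eqI)
  fix v
  obtain b' \<beta> where b': "B 0 = {b'}" "b' = \<beta> *\<^sub>R 1" "\<beta> \<noteq> 0" "\<epsilon> b' = \<beta>"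
    by (rule basis_zero)
  then have bb: "b' = b" using assms by simp
  have "coef B h v = coef B (lin_ext (\<lambda>(x, y). \<epsilon> x *\<^sub>R y) (\<Delta> h)) v"
    by (simp only: counit_left)
  also have "\<dots> = lin_ext (\<lambda>(x, y). coef B x b *\<^sub>R (\<epsilon> b * coef B y v)) (\<Delta> h)"
    unfolding lin_ext_def coef_sum coef_scale[of "\<Delta> h _"]
  proof (rule sum.cong)
    fix p assume p: "p \<in> {p. \<Delta> h p \<noteq> 0}"
    obtain x y where xy: "p = (x, y)" by fastforce
    with p obtain k where x: "x \<in> B k" using basis_coproduct by blast
    show "\<Delta> h p *\<^sub>R coef B (case p of (x, y) \<Rightarrow> \<epsilon> x *\<^sub>R y) v
        = \<Delta> h p *\<^sub>R (case p of (x, y) \<Rightarrow> coef B x b *\<^sub>R (\<epsilon> b * coef B y v))"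
    proof (cases "k = 0")
      case True
      then show ?thesis using x b' bb xy coef_basis[of x b] by (auto simp: coef_scale)
    next
      case False
      then have "\<epsilon> x = 0" "x \<noteq> b"
        using x assms graded_counit[OF span_base[OF x]] basis_degree_unique[of b k 0] by auto
      moreover have "coef B x b = 0" using coef_basis[of x b] x \<open>x \<noteq> b\<close> by auto
      ultimately show ?thesis using xy by (simp add: coef_zero)
    qed
  qed simp
  also have "\<dots> = \<epsilon> b * coef B (contract b h) v"
    by (rule lin_ext_coproduct_fst) (intro linearI, simp_all add: coef_add coef_scale algebra_simps)
  finally show "coef B (\<epsilon> b *\<^sub>R contract b h) v = coef B h v"
    by (simp add: coef_scale)
qed

subsection \<open>Coproducts of products\<close>

text \<open>The compatibility of product and coproduct, read in the first tensor factor.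
  \<open>X\<close> and \<open>Y\<close> serve to make the sum finite: any finite sets containing all
  letters with nonzero contraction will do.\<close>

lemma contract_mult:
  assumes "finite X" "\<And>x. x \<notin> X \<Longrightarrow> contract x g = 0"
    and "finite Y" "\<And>y. y \<notin> Y \<Longrightarrow> contract y h = 0"
  shows "contract a (g * h) = (\<Sum>x\<in>X. \<Sum>y\<in>Y. coef B (x * y) a *\<^sub>R (contract x g * contract y h))"
proof (rule coef_eqI)
  fix v
  \<comment> \<open>Inserts the expansion of the first tensor factor in the basis, so that
    \<open>lin_ext_coproduct_fst\<close> becomes applicable to each summand.\<close>
  have *: "lin_ext (\<lambda>(x, y). f x y) (\<Delta> k)
      = (\<Sum>x\<in>X. lin_ext (\<lambda>(x', y). coef B x' x * f x y) (\<Delta> k))"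
    if "finite X" "\<And>x. x \<notin> X \<Longrightarrow> contract x k = 0" for f :: "'h \<Rightarrow> 'h \<Rightarrow> real" and k X
  proof -
    have "fst p \<in> X" if "\<Delta> k p \<noteq> 0" for p
      using \<open>\<And>x. x \<notin> X \<Longrightarrow> contract x k = 0\<close> that coef_contract[of "fst p" k "snd p"]
      by (metis coef_zero prod.collapse)
    then have "(\<Sum>x\<in>X. coef B (fst p) x * f x (snd p)) = f (fst p) (snd p)" if "\<Delta> k p \<noteq> 0" for p
    proof -
      have "fst p \<in> basis" using that basis_coproduct[of k "fst p" "snd p"] by simp
      then have "(\<Sum>x\<in>X. coef B (fst p) x * f x (snd p)) = (\<Sum>x\<in>X. if fst p = x then f x (snd p) else 0)"
        by (intro sum.cong refl) (simp only: coef_basis, simp)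
      then show ?thesis
        using \<open>finite X\<close> \<open>\<And>p. \<Delta> k p \<noteq> 0 \<Longrightarrow> fst p \<in> X\<close>[OF that] by simp
    qed
    then have "lin_ext (\<lambda>(x, y). f x y) (\<Delta> k)
        = lin_ext (\<lambda>p. \<Sum>x\<in>X. coef B (fst p) x * f x (snd p)) (\<Delta> k)"
      unfolding lin_ext_def by (intro sum.cong) auto
    also have "\<dots> = (\<Sum>x\<in>X. lin_ext (\<lambda>(x', y). coef B x' x * f x y) (\<Delta> k))"
      unfolding lin_ext_def by (subst sum.swap) (simp add: sum_distrib_left case_prod_unfold)
    finally show ?thesis .
  qed
  have inner: "lin_ext (\<lambda>(x', y'). coef B (x * x') a * coef B (y * y') v) (\<Delta> h)
      = (\<Sum>z\<in>Y. coef B (x * z) a * coef B (y * contract z h) v)" for x y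
  proof -
    have "lin_ext (\<lambda>(x', y'). coef B (x * x') a * coef B (y * y') v) (\<Delta> h)
      = (\<Sum>z\<in>Y. lin_ext (\<lambda>(x', y'). coef B x' z * (coef B (x * z) a * coef B (y * y') v)) (\<Delta> h))"
      by (rule *[OF assms(3,4)])
    also have "\<dots> = (\<Sum>z\<in>Y. coef B (x * z) a * coef B (y * contract z h) v)"
    proof (rule sum.cong[OF refl])
      fix z
      have "linear (\<lambda>y'. coef B (x * z) a * coef B (y * y') v)"
        by (intro linearI) (simp_all add: distrib_left coef_add coef_scale algebra_simps)
      from lin_ext_coproduct_fst[OF this, of z h]
      show "lin_ext (\<lambda>(x', y'). coef B x' z * (coef B (x * z) a * coef B (y * y') v)) (\<Delta> h)
          = coef B (x * z) a * coef B (y * contract z h) v" by simp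
    qed
    finally show ?thesis .
  qed
  have "coef B (contract a (g * h)) v
      = lin_ext (\<lambda>(x, y). \<Sum>z\<in>Y. coef B (x * z) a * coef B (y * contract z h) v) (\<Delta> g)"
    unfolding coef_contract coproduct_mult inner ..
  also have "\<dots> = (\<Sum>x\<in>X. lin_ext (\<lambda>(x', y). coef B x' x *
      (\<Sum>z\<in>Y. coef B (x * z) a * coef B (y * contract z h) v)) (\<Delta> g))"
    by (rule *[OF assms(1,2)])
  also have "\<dots> = (\<Sum>x\<in>X. \<Sum>z\<in>Y. coef B (x * z) a * coef B (contract x g * contract z h) v)"
  proof (rule sum.cong[OF refl])
    fix x
    have "linear (\<lambda>y. \<Sum>z\<in>Y. coef B (x * z) a * coef B (y * contract z h) v)"
      by (intro linear_compose_sum ballI linearI)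
         (simp_all add: distrib_right coef_add coef_scale algebra_simps)
    from lin_ext_coproduct_fst[OF this, of x g]
    show "lin_ext (\<lambda>(x', y). coef B x' x *
        (\<Sum>z\<in>Y. coef B (x * z) a * coef B (y * contract z h) v)) (\<Delta> g)
        = (\<Sum>z\<in>Y. coef B (x * z) a * coef B (contract x g * contract z h) v)" by simp
  qed
  finally show "coef B (contract a (g * h)) v
      = coef B (\<Sum>x\<in>X. \<Sum>y\<in>Y. coef B (x * y) a *\<^sub>R (contract x g * contract y h)) v"
    by (simp add: coef_sum coef_scale)
qed

lemma finite_contract: "finite {x. contract x h \<noteq> 0}"
proof -
  have "{x. contract x h \<noteq> 0} \<subseteq> fst ` {p. \<Delta> h p \<noteq> 0}"
  proof
    fix x assume "x \<in> {x. contract x h \<noteq> 0}"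
    then obtain v where "\<Delta> h (x, v) \<noteq> 0"
      using coef_eqI[of "contract x h" 0] by (auto simp: coef_contract coef_zero)
    then show "x \<in> fst ` {p. \<Delta> h p \<noteq> 0}" by force
  qed
  then show ?thesis using finite_coproduct by (meson finite_imageI finite_subset)
qed

lemma basis_cases: "x \<in> basis \<longleftrightarrow> x \<in> B 0 \<or> x \<in> positive_basis"
  unfolding positive_basis_def by (auto intro: gr0I)

lemma zero_not_positive: "x \<in> B 0 \<Longrightarrow> x \<notin> positive_basis"
  using positive_basis_iff deg_eq by fastforce

text \<open>Terms in which one of the two letters is the degree zero element give the Leibniz rule;
  the double sum measures how far \<open>contract a\<close> is from a derivation. The term with both
  letters of degree zero vanishes because \<open>a\<close> has positive degree.\<close>

lemma contract_mult_positive: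
  assumes "finite X" "X \<subseteq> positive_basis" "\<And>x. x \<in> positive_basis - X \<Longrightarrow> contract x g = 0"
    and "finite Y" "Y \<subseteq> positive_basis" "\<And>y. y \<in> positive_basis - Y \<Longrightarrow> contract y h = 0"
    and a: "a \<in> positive_basis"
  shows "contract a (g * h) = contract a g * h + g * contract a h
      + (\<Sum>x\<in>X. \<Sum>y\<in>Y. coef B (x * y) a *\<^sub>R (contract x g * contract y h))"
proof -
  obtain b \<beta> where b: "B 0 = {b}" "b = \<beta> *\<^sub>R 1" "\<beta> \<noteq> 0" "\<epsilon> b = \<beta>"
    by (rule basis_zero)
  have unit: "\<beta> *\<^sub>R contract b k = k" for k
    using contract_unit[of b k] b by simp
  have bX: "b \<notin> X" "b \<notin> Y" "b \<noteq> a"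
    using assms(2,5) a zero_not_positive[of b] b(1) by auto
  have b_mult: "coef B (b * x) a = \<beta> * coef B x a" "coef B (x * b) a = \<beta> * coef B x a" for x
    by (simp_all add: b(2) coef_scale)
  have supp: "contract x g = 0" if "x \<notin> insert b X" for x
    using that assms(3)[of x] b(1) basis_cases[of x] contract_outside[of x g] by (cases "x \<in> basis") auto
  have supp': "contract x h = 0" if "x \<notin> insert b Y" for x
    using that assms(6)[of x] b(1) basis_cases[of x] contract_outside[of x h] by (cases "x \<in> basis") auto
  have single: "(\<Sum>x\<in>Z. coef B x a *\<^sub>R f x) = f a"
    if "finite Z" "Z \<subseteq> positive_basis" "a \<notin> Z \<Longrightarrow> f a = 0" for Z and f :: "'h \<Rightarrow> 'h"
  proof -
    have "(\<Sum>x\<in>Z. coef B x a *\<^sub>R f x) = (\<Sum>x\<in>Z. if x = a then f x else 0)"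
      using that(2) basis_cases coef_basis by (intro sum.cong refl) (auto simp del: UN_iff)
    then show ?thesis using that by (simp add: sum.delta)
  qed
  have left: "(\<Sum>x\<in>X. coef B (x * b) a *\<^sub>R (contract x g * contract b h)) = contract a g * h"
  proof -
    have "(\<Sum>x\<in>X. coef B (x * b) a *\<^sub>R (contract x g * contract b h))
        = (\<Sum>x\<in>X. coef B x a *\<^sub>R (contract x g * (\<beta> *\<^sub>R contract b h)))"
      by (simp add: b_mult mult.commute)
    also have "\<dots> = contract a g * h"
      unfolding unit using assms(3) a by (intro single assms(1,2)) auto
    finally show ?thesis .
  qed
  have right: "(\<Sum>y\<in>Y. coef B (b * y) a *\<^sub>R (contract b g * contract y h)) = g * contract a h"
  proof -
    have "(\<Sum>y\<in>Y. coef B (b * y) a *\<^sub>R (contract b g * contract y h))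
        = (\<Sum>y\<in>Y. coef B y a *\<^sub>R ((\<beta> *\<^sub>R contract b g) * contract y h))"
      by (simp add: b_mult mult.commute)
    also have "\<dots> = g * contract a h"
      unfolding unit using assms(6) a by (intro single assms(4,5)) auto
    finally show ?thesis .
  qed
  have bb: "coef B (b * b) a = 0"
    using b(1) bX(3) coef_basis[of b a] by (auto simp: b_mult)
  have "contract a (g * h) = (\<Sum>x\<in>insert b X. \<Sum>y\<in>insert b Y.
      coef B (x * y) a *\<^sub>R (contract x g * contract y h))"
    by (rule contract_mult) (use assms(1,4) supp supp' in auto)
  also have "\<dots> = contract a g * h + g * contract a h
      + (\<Sum>x\<in>X. \<Sum>y\<in>Y. coef B (x * y) a *\<^sub>R (contract x g * contract y h))"
    using bX assms(1,4) left right by (simp add: bb sum.distrib)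
  finally show ?thesis .
qed

lemma contract_one: "a \<in> positive_basis \<Longrightarrow> contract a 1 = 0"
  by (rule contract_graded(2)[OF one_graded, of _ "deg a"]) (auto simp: positive_basis_iff)

lemma word_coef_one: "set w \<subseteq> positive_basis \<Longrightarrow> word_coef w 1 = (if w = [] then 1 else 0)"
  by (cases w) (auto simp: word_coef_Nil word_coef_Cons counit_one contract_one word_coef_zero)

text \<open>Letters of positive degree give length at most weight, and only words of weight
  \<open>n\<close> have nonzero coefficients in degree \<open>n\<close>.\<close>

lemma word_coef_long:
  assumes "h \<in> span (B n)" "set w \<subseteq> positive_basis" "length w > n"
  shows "word_coef w h = 0"
proof (rule word_coef_graded[OF assms(1)])
  show "set w \<subseteq> basis" using assms(2) basis_cases by blast
  have "length w \<le> weight w" using assms(2)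
    by (induction w) (auto simp: positive_basis_iff)
  then show "weight w \<noteq> n" using assms(3) by simp
qed

end

text \<open>The unshuffles of a word. They form a list because repeated letters produce the same
  pair several times and the multiplicities count.\<close>

fun splits :: "'a list \<Rightarrow> ('a list \<times> 'a list) list" where
  "splits [] = [([], [])]"
| "splits (a # w) = map (\<lambda>(u, v). (a # u, v)) (splits w) @ map (\<lambda>(u, v). (u, a # v)) (splits w)"

lemma mset_splits: "(u, v) \<in> set (splits w) \<Longrightarrow> mset w = mset u + mset v"
  by (induction w arbitrary: u v) auto

lemma length_splits: "(u, v) \<in> set (splits w) \<Longrightarrow> length w = length u + length v"
  using mset_splits by (metis size_mset size_union)

lemma set_splits: "(u, v) \<in> set (splits w) \<Longrightarrow> set w = set u \<union> set v"
  using mset_splits by (metis set_mset_mset set_mset_union)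

lemma splits_append: "\<lbrakk>(u, v) \<in> set (splits w); (u', v') \<in> set (splits w')\<rbrakk>
    \<Longrightarrow> (u @ u', v @ v') \<in> set (splits (w @ w'))"
proof (induction w arbitrary: u v)
  case (Cons a w)
  from Cons.prems(1) consider u0 where "u = a # u0" "(u0, v) \<in> set (splits w)"
    | v0 where "v = a # v0" "(u, v0) \<in> set (splits w)" by auto
  then show ?case
    using Cons.IH[OF _ Cons.prems(2)] by cases (force simp: image_iff)+
qed simp

lemma splits_left: "(w, []) \<in> set (splits w)"
  and splits_right: "([], w) \<in> set (splits w)"
  by (induction w) (force simp: image_iff)+

lemma splits_take_drop: "(take k w, drop k w) \<in> set (splits w)"
  using splits_append[OF splits_left splits_right] by (metis append_Nil append_Nil2 append_take_drop_id)

context graded_connected_hopf_algebra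
begin

text \<open>A letter of \<open>w\<close> to which both factors of a product contribute uses two letters of the
  factors, so under the vanishing hypothesis every letter comes from exactly one factor.\<close>

lemma word_coef_mult_top:
  fixes g h :: "'i \<Rightarrow> 'h"
  assumes "finite I" "set w \<subseteq> positive_basis"
    and "\<And>u v. \<lbrakk>set u \<subseteq> positive_basis; set v \<subseteq> positive_basis; length u + length v > length w\<rbrakk>
      \<Longrightarrow> (\<Sum>i\<in>I. word_coef u (g i) * word_coef v (h i)) = 0"
  shows "word_coef w (\<Sum>i\<in>I. g i * h i)
    = (\<Sum>(u, v)\<leftarrow>splits w. \<Sum>i\<in>I. word_coef u (g i) * word_coef v (h i))"
  using assms(2,3)
\<comment> \<open>The families \<open>g\<close> and \<open>h\<close> vary in the induction because
  the hypothesis annihilates only sums over \<open>I\<close>, not the individual products.\<close>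
proof (induction w arbitrary: g h)
  case Nil
  then show ?case by (simp add: word_coef_Nil linear_sum[OF linear_counit] counit_mult)
next
  case (Cons a w)
  define X where "X = (\<Union>i\<in>I. {x. contract x (g i) \<noteq> 0}) \<inter> positive_basis"
  define Y where "Y = (\<Union>i\<in>I. {x. contract x (h i) \<noteq> 0}) \<inter> positive_basis"
  have fin: "finite X" "finite Y"
    unfolding X_def Y_def using assms(1) finite_contract by auto
  have sub: "X \<subseteq> positive_basis" "Y \<subseteq> positive_basis"
    unfolding X_def Y_def by auto
  have vanish: "(\<Sum>i\<in>I. word_coef u (contract x (g i)) * word_coef v (contract y (h i))) = 0"
    if "x \<in> X" "y \<in> Y" "set u \<subseteq> positive_basis" "set v \<subseteq> positive_basis"
       "length u + length v \<ge> length w" for x y u v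
    using Cons.prems(2)[of "x # u" "y # v"] that sub by (auto simp: word_coef_Cons)
  \<comment> \<open>Two letters \<open>x\<close> and \<open>y\<close> have been spent on the single
    letter \<open>a\<close>, so the remaining words complete to a total length above that of
    \<open>a # w\<close> and every term of the induction hypothesis vanishes.\<close>
  have mixed: "word_coef w (\<Sum>i\<in>I. contract x (g i) * contract y (h i)) = 0"
    if "x \<in> X" "y \<in> Y" for x y
  proof -
    have "word_coef w (\<Sum>i\<in>I. contract x (g i) * contract y (h i))
      = (\<Sum>(u, v)\<leftarrow>splits w. \<Sum>i\<in>I. word_coef u (contract x (g i)) * word_coef v (contract y (h i)))"
      using Cons.prems(1) vanish[OF that] by (intro Cons.IH) auto
    also have "\<dots> = (\<Sum>(u, v)\<leftarrow>splits w. 0)"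
    proof (intro arg_cong[of _ _ sum_list] map_cong refl)
      fix p assume p: "p \<in> set (splits w)"
      obtain u v where uv: "p = (u, v)" by fastforce
      then show "(case p of (u, v) \<Rightarrow>
            \<Sum>i\<in>I. word_coef u (contract x (g i)) * word_coef v (contract y (h i)))
          = (case p of (u, v) \<Rightarrow> 0)"
        using vanish[OF that, of u v] p set_splits[of u v w] length_splits[of u v w] Cons.prems(1)
        by simp
    qed
    finally show ?thesis by (simp add: case_prod_unfold)
  qed
  have "contract a (\<Sum>i\<in>I. g i * h i) = (\<Sum>i\<in>I. contract a (g i) * h i) + (\<Sum>i\<in>I. g i * contract a (h i))
      + (\<Sum>i\<in>I. \<Sum>x\<in>X. \<Sum>y\<in>Y. coef B (x * y) a *\<^sub>R (contract x (g i) * contract y (h i)))"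
    unfolding linear_sum[OF linear_contract] sum.distrib[symmetric]
    using Cons.prems(1) fin sub
    by (intro sum.cong[OF refl] contract_mult_positive) (auto simp: X_def Y_def)
  also have "(\<Sum>i\<in>I. \<Sum>x\<in>X. \<Sum>y\<in>Y. coef B (x * y) a *\<^sub>R (contract x (g i) * contract y (h i)))
      = (\<Sum>x\<in>X. \<Sum>y\<in>Y. coef B (x * y) a *\<^sub>R (\<Sum>i\<in>I. contract x (g i) * contract y (h i)))"
    by (subst sum.swap, subst sum.swap[of _ Y I]) (simp add: scaleR_sum_right)
  finally have "word_coef (a # w) (\<Sum>i\<in>I. g i * h i)
      = word_coef w (\<Sum>i\<in>I. contract a (g i) * h i) + word_coef w (\<Sum>i\<in>I. g i * contract a (h i))"
    by (simp add: word_coef_Cons word_coef_add word_coef_sum[of _ _ X] word_coef_sum[of _ _ Y]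
        word_coef_scale mixed)
  also have "word_coef w (\<Sum>i\<in>I. contract a (g i) * h i)
      = (\<Sum>(u, v)\<leftarrow>splits w. \<Sum>i\<in>I. word_coef (a # u) (g i) * word_coef v (h i))"
    unfolding word_coef_Cons using Cons.prems
    by (intro Cons.IH) (auto simp: word_coef_Cons[symmetric])
  also have "word_coef w (\<Sum>i\<in>I. g i * contract a (h i))
      = (\<Sum>(u, v)\<leftarrow>splits w. \<Sum>i\<in>I. word_coef u (g i) * word_coef (a # v) (h i))"
    unfolding word_coef_Cons using Cons.prems
    by (intro Cons.IH) (auto simp: word_coef_Cons[symmetric])
  finally show ?case by (simp add: case_prod_unfold comp_def)
qed

text \<open>Coassociativity for an iterated coproduct in the first tensor factor.\<close>

lemma contract_word:
  assumes "set u \<subseteq> basis"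
  shows "(\<Sum>x\<in>B (weight u). word_coef u x *\<^sub>R contract x h) = fold contract u h"
  using assms
proof (induction u arbitrary: h)
  case Nil
  obtain b \<beta> where b: "B 0 = {b}" "b = \<beta> *\<^sub>R 1" "\<beta> \<noteq> 0" "\<epsilon> b = \<beta>"
    by (rule basis_zero)
  then show ?case using contract_unit[of b h] by (simp add: word_coef_Nil)
next
  case (Cons a u)
  then obtain e where e: "a \<in> B e" "deg a = e" using deg_eq by auto
  let ?d = "weight u"
  \<comment> \<open>The sum may be confined to one degree because the grading forces
    \<open>\<Delta> x (a, y)\<close> to vanish for \<open>x\<close> in any other degree.\<close>
  have coassoc: "(\<Sum>x\<in>B (e + ?d). \<Delta> x (a, y) *\<^sub>R contract x h) = contract y (contract a h)"
    if y: "y \<in> B ?d" for y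
  proof (rule coef_eqI)
    fix v
    have *: "{x. coef B (contract_right v h) x \<noteq> 0 \<and> \<Delta> x (a, y) \<noteq> 0} \<subseteq> B (e + ?d)"
    proof safe
      fix x assume x: "coef B (contract_right v h) x \<noteq> 0" "\<Delta> x (a, y) \<noteq> 0"
      then obtain k where "x \<in> B k" using coef_outside by blast
      with x(2) e(1) y have "e + ?d = k"
        using graded_coproduct[OF span_base[OF \<open>x \<in> B k\<close>] _ e(1) y] by blast
      then show "x \<in> B (e + ?d)" using \<open>x \<in> B k\<close> by simp
    qed
    have "coef B (contract y (contract a h)) v = \<Delta> (contract_right v h) (a, y)"
      by (simp add: coef_contract coassociative_contract)
    also have "contract_right v h = (\<Sum>x\<in>{x. coef B (contract_right v h) x \<noteq> 0} \<union> B (e + ?d).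
        coef B (contract_right v h) x *\<^sub>R x)"
      by (rule coef_expansion[symmetric]) (auto simp: finite_coef finite_basis)
    also have "\<Delta> \<dots> (a, y) = (\<Sum>x\<in>{x. coef B (contract_right v h) x \<noteq> 0} \<union> B (e + ?d).
        coef B (contract_right v h) x * \<Delta> x (a, y))"
      by (simp add: coproduct_sum coproduct_scale)
    also have "\<dots> = (\<Sum>x\<in>B (e + ?d). coef B (contract_right v h) x * \<Delta> x (a, y))"
      using * by (intro sum.mono_neutral_right) (auto simp: finite_coef finite_basis)
    also have "\<dots> = coef B (\<Sum>x\<in>B (e + ?d). \<Delta> x (a, y) *\<^sub>R contract x h) v"
      by (simp add: coef_sum coef_scale coef_contract coef_contract_right mult.commute)
    finally show "coef B (\<Sum>x\<in>B (e + ?d). \<Delta> x (a, y) *\<^sub>R contract x h) v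
        = coef B (contract y (contract a h)) v" ..
  qed
  have "(\<Sum>x\<in>B (e + ?d). word_coef (a # u) x *\<^sub>R contract x h)
      = (\<Sum>x\<in>B (e + ?d). \<Sum>y\<in>B ?d. word_coef u y *\<^sub>R \<Delta> x (a, y) *\<^sub>R contract x h)"
  proof (rule sum.cong[OF refl])
    fix x assume x: "x \<in> B (e + ?d)"
    have "contract a x \<in> span (B ?d)"
      using contract_graded(1)[OF span_base[OF x] e(1)] by simp
    then have "contract a x = (\<Sum>y\<in>B ?d. \<Delta> x (a, y) *\<^sub>R y)"
      using graded_expansion[of "contract a x" ?d] by (simp add: coef_contract)
    then have "word_coef (a # u) x = (\<Sum>y\<in>B ?d. word_coef u y * \<Delta> x (a, y))"
      by (simp add: word_coef_Cons word_coef_sum word_coef_scale mult.commute)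
    then show "word_coef (a # u) x *\<^sub>R contract x h
        = (\<Sum>y\<in>B ?d. word_coef u y *\<^sub>R \<Delta> x (a, y) *\<^sub>R contract x h)"
      by (simp add: scaleR_sum_left)
  qed
  also have "\<dots> = (\<Sum>y\<in>B ?d. word_coef u y *\<^sub>R (\<Sum>x\<in>B (e + ?d). \<Delta> x (a, y) *\<^sub>R contract x h))"
    by (subst sum.swap) (simp only: scaleR_sum_right)
  also have "\<dots> = (\<Sum>y\<in>B ?d. word_coef u y *\<^sub>R contract y (contract a h))"
    by (intro sum.cong refl) (simp add: coassoc)
  also have "\<dots> = fold contract u (contract a h)"
    using Cons by simp
  finally show ?case by (simp add: e(2))
qed

lemma contract_word_degree:
  assumes "set u \<subseteq> basis"
  shows "(\<Sum>x\<in>B d. word_coef u x *\<^sub>R contract x h) = (if weight u = d then fold contract u h else 0)"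
  using contract_word[OF assms, of h] word_coef_graded[OF span_base assms, of _ d]
  by (auto intro!: sum.neutral)

end

section \<open>The operators\<close>

locale hopf_involution = graded_connected_hopf_algebra B \<Delta> \<epsilon>
  for B :: "nat \<Rightarrow> 'h::real_algebra_1 set" and \<Delta> \<epsilon> +
  fixes \<tau> :: "'h \<Rightarrow> 'h"
  assumes involution: "graded_basis_involution B \<tau>"
    and ambimorphism: "hopf_ambimorphism B \<Delta> \<epsilon> \<tau>"
begin

section \<open>The involution and its transpose on words\<close>

lemma linear_tau: "linear \<tau>"
  using involution by (simp add: graded_basis_involution_def)

lemma tau_basis: "b \<in> B k \<Longrightarrow> \<tau> b \<in> B k" "b \<in> B k \<Longrightarrow> \<tau> (\<tau> b) = b"
  using involution by (auto simp: graded_basis_involution_def)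

lemma tau_one: "\<tau> 1 = 1"
  using ambimorphism
  by (auto simp: hopf_ambimorphism_def algebra_morphism_def algebra_antimorphism_def)

lemma counit_tau: "\<epsilon> (\<tau> h) = \<epsilon> h"
  using ambimorphism
  by (auto simp: hopf_ambimorphism_def coalgebra_morphism_def coalgebra_antimorphism_def)

text \<open>\<open>\<tau>\<close> permutes the basis and is its own inverse, so it is self-adjoint
  for the coordinate pairing.\<close>

lemma coef_tau:
  assumes "u \<in> basis"
  shows "coef B (\<tau> h) u = coef B h (\<tau> u)"
proof -
  have "h \<in> span basis" by (simp add: span_basis)
  then show ?thesis
  proof (induction rule: span_induct_alt)
    case base
    then show ?case by (simp add: linear_0[OF linear_tau] coef_zero)
  next
    case (step c x y)
    then obtain k where x: "x \<in> B k" by blast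
    then have "x \<in> basis" "\<tau> x \<in> basis" using tau_basis(1)[OF x] by auto
    then have "coef B (\<tau> x) u = (if \<tau> x = u then 1 else 0)" "coef B x (\<tau> u) = (if x = \<tau> u then 1 else 0)"
      using coef_basis by blast+
    moreover have "\<tau> x = u \<longleftrightarrow> x = \<tau> u" using tau_basis(2) x assms by auto
    ultimately show ?case
      by (simp add: linear_add[OF linear_tau] linear_scale[OF linear_tau] coef_add coef_scale step)
  qed
qed

lemma contract_tau:
  assumes "coalgebra_morphism B \<Delta> \<epsilon> \<tau>" "u \<in> basis"
  shows "contract u (\<tau> h) = \<tau> (contract (\<tau> u) h)"
proof (rule coef_eqI)
  fix v
  show "coef B (contract u (\<tau> h)) v = coef B (\<tau> (contract (\<tau> u) h)) v"
  proof (cases "v \<in> basis")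
    case True
    have "coef B (contract u (\<tau> h)) v = lin_ext (\<lambda>(x, y). coef B (\<tau> x) u * coef B (\<tau> y) v) (\<Delta> h)"
      using assms(1) by (simp add: coef_contract coalgebra_morphism_def)
    also have "\<dots> = lin_ext (\<lambda>(x, y). coef B x (\<tau> u) *\<^sub>R coef B y (\<tau> v)) (\<Delta> h)"
      by (simp only: coef_tau[OF assms(2)] coef_tau[OF True] real_scaleR_def)
    also have "\<dots> = coef B (\<tau> (contract (\<tau> u) h)) v"
      by (simp only: lin_ext_coproduct_fst[OF linear_coef] coef_tau[OF True])
    finally show ?thesis .
  next
    case False
    then show ?thesis using coef_outside by simp
  qed
qed

lemma contract_tau_anti:
  assumes "coalgebra_antimorphism B \<Delta> \<epsilon> \<tau>" "u \<in> basis"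
  shows "contract u (\<tau> h) = \<tau> (contract_right (\<tau> u) h)"
proof (rule coef_eqI)
  fix v
  show "coef B (contract u (\<tau> h)) v = coef B (\<tau> (contract_right (\<tau> u) h)) v"
  proof (cases "v \<in> basis")
    case True
    have "coef B (contract u (\<tau> h)) v = lin_ext (\<lambda>(x, y). coef B (\<tau> y) u * coef B (\<tau> x) v) (\<Delta> h)"
      using assms(1) by (simp add: coef_contract coalgebra_antimorphism_def)
    also have "\<dots> = lin_ext (\<lambda>(x, y). coef B y (\<tau> u) *\<^sub>R coef B x (\<tau> v)) (\<Delta> h)"
      by (simp only: coef_tau[OF assms(2)] coef_tau[OF True] real_scaleR_def)
    also have "\<dots> = coef B (\<tau> (contract_right (\<tau> u) h)) v"
      by (simp only: lin_ext_coproduct_snd[OF linear_coef] coef_tau[OF True])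
    finally show ?thesis .
  next
    case False
    then show ?thesis using coef_outside by simp
  qed
qed

text \<open>The transpose of \<open>\<tau>\<close> on words: an antimorphism of coalgebras also
  reverses the order of the tensor factors. If \<open>\<tau>\<close> is both a morphism and an
  antimorphism, the unreversed form is taken.\<close>

definition flip :: "'h list \<Rightarrow> 'h list" where
  "flip u = (if coalgebra_morphism B \<Delta> \<epsilon> \<tau> then map \<tau> u else rev (map \<tau> u))"

lemma mset_flip: "mset (flip u) = mset (map \<tau> u)"
  by (simp add: flip_def)

lemma length_flip [simp]: "length (flip u) = length u"
  by (simp add: flip_def)

lemma set_flip: "set u \<subseteq> X \<Longrightarrow> (\<And>x. x \<in> X \<Longrightarrow> \<tau> x \<in> X) \<Longrightarrow> set (flip u) \<subseteq> X"
  by (auto simp: flip_def)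

lemma tau_in_positive_basis: "x \<in> positive_basis \<Longrightarrow> \<tau> x \<in> positive_basis"
  unfolding positive_basis_def using tau_basis(1) by auto

lemma deg_tau: "x \<in> basis \<Longrightarrow> deg (\<tau> x) = deg x"
  using tau_basis(1) deg_eq by auto

lemma weight_flip: "set u \<subseteq> basis \<Longrightarrow> weight (flip u) = weight u"
proof -
  assume "set u \<subseteq> basis"
  then have "map (\<lambda>x. deg (\<tau> x)) u = map deg u"
    using deg_tau by (intro map_cong refl) (auto simp del: UN_iff)
  then show ?thesis
    unfolding flip_def weight_def by (simp add: rev_map[symmetric] comp_def del: map_eq_conv)
qed

lemma flip_flip:
  assumes "set u \<subseteq> basis"
  shows "flip (flip u) = u"
proof -
  have "map (\<lambda>x. \<tau> (\<tau> x)) u = u"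
    using assms tau_basis(2) by (intro map_idI) auto
  then show ?thesis by (simp add: flip_def rev_map comp_def)
qed

lemma word_coef_tau:
  assumes "set u \<subseteq> basis"
  shows "word_coef u (\<tau> h) = word_coef (flip u) h"
proof (cases "coalgebra_morphism B \<Delta> \<epsilon> \<tau>")
  case True
  have "word_coef u (\<tau> h) = word_coef (map \<tau> u) h"
    using assms
  proof (induction u arbitrary: h)
    case Nil
    then show ?case by (simp add: word_coef_Nil counit_tau)
  next
    case (Cons a u)
    then show ?case using contract_tau[OF True, of a h] by (simp add: word_coef_Cons)
  qed
  then show ?thesis using True by (simp add: flip_def)
next
  case False
  then have anti: "coalgebra_antimorphism B \<Delta> \<epsilon> \<tau>"
    using ambimorphism by (simp add: hopf_ambimorphism_def)
  have "word_coef u (\<tau> h) = word_coef (rev (map \<tau> u)) h"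
    using assms
  proof (induction u arbitrary: h)
    case Nil
    then show ?case by (simp add: word_coef_Nil counit_tau)
  next
    case (Cons a u)
    then show ?case
      using contract_tau_anti[OF anti, of a h] word_coef_snoc[of "rev (map \<tau> u)" "\<tau> a" h]
      by (simp add: word_coef_Cons)
  qed
  then show ?thesis using False by (simp add: flip_def)
qed

definition act :: "nat \<times> decoration \<Rightarrow> 'h list \<Rightarrow> 'h list" where
  "act d u = (if decorated d then flip u else u)"

lemma length_act [simp]: "length (act d u) = length u"
  by (simp add: act_def)

lemma word_coef_act:
  "set u \<subseteq> basis \<Longrightarrow> word_coef u (if decorated d then \<tau> x else x) = word_coef (act d u) x"
  by (simp add: act_def word_coef_tau)

lemma set_act: "set u \<subseteq> positive_basis \<Longrightarrow> set (act d u) \<subseteq> positive_basis"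
  using set_flip[of u positive_basis] tau_in_positive_basis by (auto simp: act_def)

lemma weight_act: "set u \<subseteq> basis \<Longrightarrow> weight (act d u) = weight u"
  by (simp add: act_def weight_flip)

text \<open>Splits off one part at a time, which suits induction on \<open>D\<close>;
  \<open>signed_descent_op_eq\<close> shows that it is the operator of the definitions. No degree is
  prescribed for the argument.\<close>

fun descent_op :: "decorated_composition \<Rightarrow> 'h \<Rightarrow> 'h" where
  "descent_op [] h = \<epsilon> h *\<^sub>R 1"
| "descent_op (d # D) h =
     (\<Sum>u\<in>B (fst d). (if decorated d then \<tau> u else u) * descent_op D (contract u h))"

lemma linear_descent_op: "linear (descent_op D)"
proof (induction D)
  case Nil
  have "descent_op [] = (\<lambda>h. \<epsilon> h *\<^sub>R 1)" by auto
  then show ?case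
    by (simp only:) (intro linearI, simp_all add: linear_add[OF linear_counit]
      linear_scale[OF linear_counit] scaleR_left_distrib)
next
  case (Cons d D)
  have "descent_op (d # D) =
      (\<lambda>h. \<Sum>u\<in>B (fst d). (if decorated d then \<tau> u else u) * descent_op D (contract u h))" by auto
  moreover have "linear (\<lambda>h. x * descent_op D (contract u h))" for x u
    by (intro linearI) (simp_all add: linear_add[OF linear_contract] linear_scale[OF linear_contract]
      linear_add[OF Cons] linear_scale[OF Cons] distrib_left)
  ultimately show ?case
    by (simp only:) (intro linear_compose_sum ballI, simp)
qed

definition words :: "nat list \<Rightarrow> 'h list set" where
  "words E = {w. list_all2 (\<lambda>u e. u \<in> B e) w E}"

lemma words_Nil: "words [] = {[]}"
  by (auto simp: words_def)

lemma words_Cons: "words (e # E) = (\<lambda>(u, w). u # w) ` (B e \<times> words E)"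
  by (auto simp: words_def list_all2_Cons2 image_iff)

lemma finite_words: "finite (words E)"
  by (induction E) (auto simp: words_Nil words_Cons finite_basis)

lemma signed_descent_op_eq_sum:
  "signed_descent_op B \<Delta> \<epsilon> \<tau> D h = (\<Sum>w\<in>words (forget_decorations D).
     word_coef w h *\<^sub>R prod_list (map2 (\<lambda>d u. if decorated d then \<tau> u else u) D w))"
proof -
  let ?t = "refined_coproduct B \<Delta> \<epsilon> (forget_decorations D) h"
  let ?f = "\<lambda>w. prod_list (map2 (\<lambda>d u. if decorated d then \<tau> u else u) D w)"
  have "signed_descent_op B \<Delta> \<epsilon> \<tau> D h = (\<Sum>w | ?t w \<noteq> 0. ?t w *\<^sub>R ?f w)"
    by (simp add: signed_descent_op_def lin_ext_def)
  also have "\<dots> = (\<Sum>w\<in>words (forget_decorations D). ?t w *\<^sub>R ?f w)"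
    by (rule sum.mono_neutral_left[OF finite_words]) (auto simp: words_def refined_coproduct_def)
  also have "\<dots> = (\<Sum>w\<in>words (forget_decorations D). word_coef w h *\<^sub>R ?f w)"
    by (intro sum.cong) (auto simp: refined_coproduct_def words_def iter_coproduct_eq)
  finally show ?thesis .
qed

lemma signed_descent_op_eq: "signed_descent_op B \<Delta> \<epsilon> \<tau> D h = descent_op D h"
  unfolding signed_descent_op_eq_sum
proof (induction D arbitrary: h)
  case Nil
  then show ?case by (simp add: forget_decorations_def words_Nil word_coef_Nil)
next
  case (Cons d D)
  let ?f = "\<lambda>D w. prod_list (map2 (\<lambda>d u. if decorated d then \<tau> u else u) D w)"
  let ?x = "\<lambda>u. if decorated d then \<tau> u else u"
  have inj: "inj_on (\<lambda>(u, w). u # w) (X \<times> Y)" for X :: "'h set" and Y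
    by (auto simp: inj_on_def)
  have "(\<Sum>w\<in>words (forget_decorations (d # D)). word_coef w h *\<^sub>R ?f (d # D) w)
      = (\<Sum>u\<in>B (fst d). \<Sum>w\<in>words (forget_decorations D).
          word_coef w (contract u h) *\<^sub>R (?x u * ?f D w))"
    unfolding forget_decorations_def list.map words_Cons sum.reindex[OF inj] sum.cartesian_product
    by (intro sum.cong) (auto simp: word_coef_Cons)
  also have "\<dots> = (\<Sum>u\<in>B (fst d). ?x u * descent_op D (contract u h))"
    unfolding Cons.IH[symmetric] by (simp add: sum_distrib_left)
  finally show ?case by simp
qed

text \<open>An inverse riffle shuffle with flipped piles: letters are dealt to the parts so that
  each part receives its size in total degree, the decorated piles are flipped and all piles are
  concatenated. Multiplicities are kept.\<close>

fun outcomes :: "decorated_composition \<Rightarrow> 'h list \<Rightarrow> 'h list list" where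
  "outcomes [] w = (if w = [] then [[]] else [])"
| "outcomes (d # D) w = concat (map (\<lambda>(u, v).
     if weight u = fst d then map (\<lambda>v'. act d u @ v') (outcomes D v) else []) (splits w))"

lemma sum_list_outcomes_Cons:
  "(\<Sum>w'\<leftarrow>outcomes (d # D) w. f w') = (\<Sum>(u, v)\<leftarrow>splits w.
     if weight u = fst d then (\<Sum>v'\<leftarrow>outcomes D v. f (act d u @ v')) else (0::real))"
proof -
  have "sum_list (map f (concat xss)) = (\<Sum>xs\<leftarrow>xss. sum_list (map f xs))" for xss
    by (induction xss) auto
  then show ?thesis
    by (simp add: comp_def case_prod_unfold if_distrib[of "map f"] if_distrib[of sum_list] cong: if_cong)
qed

lemma outcomes_length: "w' \<in> set (outcomes D w) \<Longrightarrow> length w' = length w"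
  by (induction D arbitrary: w w') (auto split: if_splits dest!: length_splits)

lemma outcomes_positive:
  "\<lbrakk>set w \<subseteq> positive_basis; w' \<in> set (outcomes D w)\<rbrakk> \<Longrightarrow> set w' \<subseteq> positive_basis"
proof (induction D arbitrary: w w')
  case (Cons d D)
  from Cons.prems(2) obtain u v v' where
    uv: "(u, v) \<in> set (splits w)" "v' \<in> set (outcomes D v)" "w' = act d u @ v'"
    by (auto split: if_splits)
  then have "set u \<subseteq> positive_basis" "set v \<subseteq> positive_basis"
    using set_splits[OF uv(1)] Cons.prems(1) by auto
  then show ?case using uv Cons.IH[of v v'] set_act[of u d] by auto
qed (auto split: if_splits)

text \<open>On words of maximal length the operator acts by deconcatenating and shuffling letters.\<close>

lemma word_coef_descent_op:
  assumes "set w \<subseteq> positive_basis"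
    and "\<And>w'. \<lbrakk>set w' \<subseteq> positive_basis; length w' > length w\<rbrakk> \<Longrightarrow> word_coef w' h = 0"
  shows "word_coef w (descent_op D h) = (\<Sum>w'\<leftarrow>outcomes D w. word_coef w' h)"
  using assms
proof (induction D arbitrary: w h)
  case Nil
  then show ?case by (simp add: word_coef_scale word_coef_one word_coef_Nil)
next
  case (Cons d D)
  let ?x = "\<lambda>u. if decorated d then \<tau> u else u"
  have pos_basis: "set u \<subseteq> basis" if "set u \<subseteq> positive_basis" for u
    using that basis_cases by (meson subset_iff)
  \<comment> \<open>First \<open>\<tau>\<close> is moved onto the word \<open>u\<close>; then
    \<open>contract_word_degree\<close> collapses the sum over the basis into contraction by that
    word.\<close>
  have split: "(\<Sum>x\<in>B (fst d). word_coef u (?x x) * word_coef v (descent_op D (contract x h)))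
      = (if weight u = fst d then word_coef v (descent_op D (fold contract (act d u) h)) else 0)"
    if u: "set u \<subseteq> positive_basis" for u v
  proof -
    have au: "set (act d u) \<subseteq> basis" by (rule pos_basis[OF set_act[OF u]])
    have "(\<Sum>x\<in>B (fst d). word_coef u (?x x) * word_coef v (descent_op D (contract x h)))
        = word_coef v (descent_op D (\<Sum>x\<in>B (fst d). word_coef (act d u) x *\<^sub>R contract x h))"
      unfolding word_coef_act[OF pos_basis[OF u]]
      by (simp add: linear_sum[OF linear_descent_op] linear_scale[OF linear_descent_op]
          word_coef_sum word_coef_scale)
    then show ?thesis
      unfolding contract_word_degree[OF au] weight_act[OF pos_basis[OF u]]
      by (simp add: linear_0[OF linear_descent_op] word_coef_zero)
  qed
  have IH: "word_coef v (descent_op D (fold contract (act d u) h))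
      = (\<Sum>v'\<leftarrow>outcomes D v. word_coef (act d u @ v') h)"
    if u: "set u \<subseteq> positive_basis" and v: "set v \<subseteq> positive_basis"
      and len: "length u + length v \<ge> length w" for u v
  proof -
    have "word_coef v' (fold contract (act d u) h) = 0"
      if "set v' \<subseteq> positive_basis" "length v' > length v" for v'
      using Cons.prems(2)[of "act d u @ v'"] that set_act[OF u] len by (simp add: word_coef_append)
    from Cons.IH[OF v this] show ?thesis by (simp add: word_coef_append)
  qed
  have "word_coef w (descent_op (d # D) h) = (\<Sum>(u, v)\<leftarrow>splits w.
      \<Sum>x\<in>B (fst d). word_coef u (?x x) * word_coef v (descent_op D (contract x h)))"
    unfolding descent_op.simps
  proof (rule word_coef_mult_top[OF finite_basis Cons.prems(1)])
    fix u v assume uv: "set u \<subseteq> positive_basis" "set v \<subseteq> positive_basis" "length w < length u + length v"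
    \<comment> \<open>Outcomes preserve length, so these concatenations are still longer than
      \<open>w\<close>.\<close>
    have "word_coef (act d u @ v') h = 0" if "v' \<in> set (outcomes D v)" for v'
      using Cons.prems(2)[of "act d u @ v'"] set_act[OF uv(1)] outcomes_positive[OF uv(2) that]
        outcomes_length[OF that] uv(3) by simp
    then have "(\<Sum>v'\<leftarrow>outcomes D v. word_coef (act d u @ v') h) = (\<Sum>v'\<leftarrow>outcomes D v. 0)"
      by (intro arg_cong[of _ _ sum_list] map_cong refl)
    then show "(\<Sum>x\<in>B (fst d). word_coef u (?x x) * word_coef v (descent_op D (contract x h))) = 0"
      unfolding split[OF uv(1)] using IH[OF uv(1,2)] uv(3) by simp
  qed
  also have "\<dots> = (\<Sum>(u, v)\<leftarrow>splits w.
      if weight u = fst d then (\<Sum>v'\<leftarrow>outcomes D v. word_coef (act d u @ v') h) else 0)"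
  proof (intro arg_cong[of _ _ sum_list] map_cong refl)
    fix p assume p: "p \<in> set (splits w)"
    obtain u v where uv: "p = (u, v)" by fastforce
    with p have *: "set u \<subseteq> positive_basis" "set v \<subseteq> positive_basis" "length u + length v = length w"
      using set_splits[of u v w] length_splits[of u v w] Cons.prems(1) by auto
    show "(case p of (u, v) \<Rightarrow> \<Sum>x\<in>B (fst d). word_coef u (?x x) * word_coef v (descent_op D (contract x h)))
        = (case p of (u, v) \<Rightarrow>
           if weight u = fst d then (\<Sum>v'\<leftarrow>outcomes D v. word_coef (act d u @ v') h) else 0)"
      unfolding uv prod.case split[OF *(1)] using IH[OF *(1,2)] *(3) by simp
  qed
  finally show ?case unfolding sum_list_outcomes_Cons .
qed

end

section \<open>Counting outcomes\<close>

text \<open>The left side counts the \<open>d\<close>-subsets of \<open>e + m\<close> positions that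
  contain all or nothing of a block of \<open>e\<close> positions: these are the terms
  \<open>k = 0\<close> and \<open>k = e\<close> of the Vandermonde sum. It is strict once some
  \<open>d\<close>-subset cuts the block.\<close>

lemma choose_gap:
  fixes m e d :: nat
  assumes "e \<ge> 1"
  shows "(if e \<le> d then m choose (d - e) else 0) + (m choose d) \<le> (e + m) choose d"
    and "\<lbrakk>e \<ge> 2; 0 < d; d < e + m\<rbrakk>
      \<Longrightarrow> (if e \<le> d then m choose (d - e) else 0) + (m choose d) < (e + m) choose d"
proof -
  let ?f = "\<lambda>k. (e choose k) * (m choose (d - k))"
  have vd: "(e + m) choose d = (\<Sum>k\<le>d. ?f k)"
    using vandermonde[of e m d] by simp
  have lhs: "(if e \<le> d then m choose (d - e) else 0) + (m choose d) = (\<Sum>k\<in>{0, e} \<inter> {..d}. ?f k)"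
  proof (cases "e \<le> d")
    case True
    then have "{0, e} \<inter> {..d} = {0, e}" by auto
    then show ?thesis using assms True by simp
  next
    case False
    then have "{0, e} \<inter> {..d} = {0}" by auto
    then show ?thesis using False by simp
  qed
  show "(if e \<le> d then m choose (d - e) else 0) + (m choose d) \<le> (e + m) choose d"
    unfolding lhs vd by (rule sum_mono2) auto
  assume e: "e \<ge> 2" and d: "0 < d" "d < e + m"
  \<comment> \<open>The smallest number of positions in the block that cuts it while the other
    \<open>d - k\<close> still fit among the \<open>m\<close> positions outside.\<close>
  define k where "k = max 1 (d - m)"
  have k: "k \<le> d" "0 < k" "k < e" "d - k \<le> m" using e d by (auto simp: k_def)
  then have "k \<notin> {0, e} \<inter> {..d}" "?f k > 0" by auto
  then have "(\<Sum>k\<in>{0, e} \<inter> {..d}. ?f k) < (\<Sum>k\<in>insert k ({0, e} \<inter> {..d}). ?f k)"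
    by (subst sum.insert) auto
  also have "\<dots> \<le> (\<Sum>k\<le>d. ?f k)"
    using k by (intro sum_mono2) auto
  finally show "(if e \<le> d then m choose (d - e) else 0) + (m choose d) < (e + m) choose d"
    unfolding lhs vd .
qed

lemma multinomial_Nil: "multinomial [] = 1"
  by (simp add: multinomial_def)

lemma multinomial_Cons: "multinomial (e # E) = real ((e + sum_list E) choose e) * multinomial E"
  by (simp add: multinomial_def binomial_fact)

lemma multinomial_pos: "multinomial E > 0"
proof (induction E)
  case (Cons e E)
  have "(e + sum_list E) choose e > 0" by simp
  then show ?case using Cons by (simp add: multinomial_Cons)
qed (simp add: multinomial_Nil)

section \<open>Counting unshuffles by weight\<close>

context graded_connected_hopf_algebra
begin

definition split_count :: "'h list \<Rightarrow> nat \<Rightarrow> nat" where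
  "split_count w d = length (filter (\<lambda>(u, v). weight u = d) (splits w))"

lemma split_count_Nil: "split_count [] d = (if d = 0 then 1 else 0)"
  by (simp add: split_count_def)

lemma split_count_Cons:
  "split_count (a # w) d = (if deg a \<le> d then split_count w (d - deg a) else 0) + split_count w d"
proof -
  have *: "weight (a # u) = d \<longleftrightarrow> deg a \<le> d \<and> weight u = d - deg a" for u
    by auto
  show ?thesis
    unfolding split_count_def splits.simps filter_append length_append filter_map length_map
    by (simp add: comp_def case_prod_unfold * del: weight_simps)
qed

text \<open>If each letter is a block of as many positions as its degree, the splits counted are the
  \<open>d\<close>-subsets of positions that are unions of blocks.\<close>

lemma split_count_le: "set w \<subseteq> positive_basis \<Longrightarrow> split_count w d \<le> weight w choose d"
proof (induction w arbitrary: d)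
  case (Cons a w)
  then have a: "deg a \<ge> 1" by (simp add: positive_basis_iff Suc_leI)
  have "split_count (a # w) d
      \<le> (if deg a \<le> d then weight w choose (d - deg a) else 0) + (weight w choose d)"
    unfolding split_count_Cons using Cons by (intro add_mono) auto
  also have "\<dots> \<le> (deg a + weight w) choose d" by (rule choose_gap(1)[OF a])
  finally show ?case by simp
qed (simp add: split_count_Nil)

text \<open>Some \<open>d\<close>-subset cuts the block of size at least two. When that block comes
  first the gap is immediate; a first block of size one leads to Pascal's rule, where one strict
  summand is enough.\<close>

lemma split_count_less:
  "\<lbrakk>set w \<subseteq> positive_basis; \<exists>a\<in>set w. deg a \<ge> 2; 0 < d; d < weight w\<rbrakk>
    \<Longrightarrow> split_count w d < weight w choose d"
proof (induction w arbitrary: d)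
  case (Cons a w)
  then have a: "deg a \<ge> 1" and w: "set w \<subseteq> positive_basis" by (simp_all add: positive_basis_iff Suc_leI)
  show ?case
  proof (cases "deg a \<ge> 2")
    case True
    have "split_count (a # w) d
        \<le> (if deg a \<le> d then weight w choose (d - deg a) else 0) + (weight w choose d)"
      unfolding split_count_Cons using w by (intro add_mono) (auto simp: split_count_le)
    also have "\<dots> < (deg a + weight w) choose d"
      using Cons.prems by (intro choose_gap(2)[OF a True]) auto
    finally show ?thesis by simp
  next
    case False
    with a have a1: "deg a = 1" by simp
    obtain c where c: "c \<in> set w" "deg c \<ge> 2" using Cons.prems(2) False by auto
    then have wt: "weight w \<ge> 2"
      using member_le_sum_list[of "deg c" "map deg w"] by (simp add: weight_def)
    obtain k where k: "d = Suc k" using Cons.prems(3) gr0_implies_Suc by blast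
    have IH: "split_count w j < weight w choose j" if "0 < j" "j < weight w" for j
      using Cons.IH[OF w _ that] c by blast
    have "split_count w k + split_count w d < (weight w choose k) + (weight w choose d)"
    \<comment> \<open>At the boundary \<open>d = weight w\<close> the second summand cannot be
      strict, but then \<open>k = weight w - 1\<close> is positive because \<open>weight w\<close>
      is at least 2, and the first summand is.\<close>
    proof (cases "d < weight w")
      case True
      then show ?thesis using IH[of d] split_count_le[OF w, of k] Cons.prems(3) by simp
    next
      case False
      then have "0 < k" "k < weight w" using Cons.prems(4) a1 k wt by auto
      then show ?thesis using IH[of k] split_count_le[OF w, of d] by simp
    qed
    then show ?thesis unfolding split_count_Cons by (simp add: a1 k)
  qed
qed simp

end

context hopf_involution
begin

lemma outcomes_count_Cons:
  assumes "set w \<subseteq> positive_basis"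
    and "\<And>u v. \<lbrakk>(u, v) \<in> set (splits w); weight u = fst d\<rbrakk> \<Longrightarrow> real (length (outcomes D v)) \<le> M"
  shows "real (length (outcomes (d # D) w)) \<le> real (split_count w (fst d)) * M"
proof -
  have "real (length (outcomes (d # D) w)) = (\<Sum>w'\<leftarrow>outcomes (d # D) w. 1)"
    by (simp add: sum_list_triv)
  also have "\<dots> \<le> (\<Sum>(u, v)\<leftarrow>splits w. if weight u = fst d then M else 0)"
    unfolding sum_list_outcomes_Cons using assms(2)
    by (intro sum_list_mono) (auto simp: sum_list_triv)
  also have "\<dots> = real (split_count w (fst d)) * M"
  proof -
    have "(\<Sum>(u, v)\<leftarrow>ps. if weight u = fst d then M else 0)
        = real (length (filter (\<lambda>(u, v). weight u = fst d) ps)) * M" for ps :: "('h list \<times> 'h list) list"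
      by (induction ps) (auto simp: algebra_simps)
    then show ?thesis by (simp add: split_count_def)
  qed
  finally show ?thesis .
qed

lemma weight_splits: "(u, v) \<in> set (splits w) \<Longrightarrow> weight w = weight u + weight v"
  unfolding weight_def using mset_splits[of u v w]
  by (metis map_append mset_append mset_map sum_list_append sum_mset_sum_list)

lemma length_outcomes_le:
  assumes "set w \<subseteq> positive_basis" "weight w = sum_list (forget_decorations D)"
  shows "real (length (outcomes D w)) \<le> multinomial (forget_decorations D)"
  using assms
proof (induction D arbitrary: w)
  case Nil
  then show ?case by (simp add: forget_decorations_def multinomial_Nil)
next
  case (Cons d D)
  let ?E = "forget_decorations D"
  have "real (length (outcomes (d # D) w)) \<le> real (split_count w (fst d)) * multinomial ?E"
  proof (rule outcomes_count_Cons[OF Cons.prems(1)])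
    fix u v assume uv: "(u, v) \<in> set (splits w)" "weight u = fst d"
    show "real (length (outcomes D v)) \<le> multinomial ?E"
      using uv weight_splits[OF uv(1)] set_splits[OF uv(1)] Cons.prems
      by (intro Cons.IH) (auto simp: forget_decorations_def)
  qed
  also have "\<dots> \<le> real (weight w choose fst d) * multinomial ?E"
    using split_count_le[OF Cons.prems(1)] multinomial_pos[of ?E] by (intro mult_right_mono) auto
  also have "\<dots> = multinomial (forget_decorations (d # D))"
    using Cons.prems(2) by (simp add: forget_decorations_def multinomial_Cons)
  finally show ?case .
qed

text \<open>Zero parts receive no letters and are skipped. The first nonzero part is a proper part
  because another one follows, so \<open>split_count_less\<close> applies to it; the later parts
  need only the weak bound.\<close>

lemma length_outcomes_less:
  assumes "set w \<subseteq> positive_basis" "weight w = sum_list (forget_decorations D)"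
    and "\<exists>a\<in>set w. deg a \<ge> 2"
    and "length (filter (\<lambda>e. e \<noteq> 0) (forget_decorations D)) \<ge> 2"
  shows "real (length (outcomes D w)) < multinomial (forget_decorations D)"
  using assms
proof (induction D arbitrary: w)
  case Nil
  then show ?case by (simp add: forget_decorations_def)
next
  case (Cons d D)
  let ?E = "forget_decorations D"
  have wt: "weight w = fst d + sum_list ?E"
    using Cons.prems(2) by (simp add: forget_decorations_def)
  have mult: "multinomial (forget_decorations (d # D)) = real (weight w choose fst d) * multinomial ?E"
    by (simp add: forget_decorations_def multinomial_Cons wt[unfolded forget_decorations_def])
  have uv: "set u \<subseteq> positive_basis" "set v \<subseteq> positive_basis" "weight v = sum_list ?E"
    if "(u, v) \<in> set (splits w)" "weight u = fst d" for u v
    using that weight_splits[OF that(1)] set_splits[OF that(1)] Cons.prems(1) wt by auto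
  show ?case
  proof (cases "fst d = 0")
    case True
    have E2: "length (filter (\<lambda>e. e \<noteq> 0) ?E) \<ge> 2"
      using Cons.prems(4) True by (simp add: forget_decorations_def)
    have "real (length (outcomes (d # D) w)) \<le> real (split_count w (fst d)) * real (length (outcomes D w))"
    proof (rule outcomes_count_Cons[OF Cons.prems(1)])
      fix u v assume *: "(u, v) \<in> set (splits w)" "weight u = fst d"
      have "u = []" using uv(1)[OF *] *(2) True by (cases u) (auto simp: positive_basis_iff)
      have "v = w" if "([], v) \<in> set (splits w)" for v w :: "'h list"
        using that by (induction w arbitrary: v) auto
      then show "real (length (outcomes D v)) \<le> real (length (outcomes D w))"
        using * \<open>u = []\<close> by blast
    qed
    also have "\<dots> \<le> 1 * real (length (outcomes D w))"
      using split_count_le[OF Cons.prems(1), of 0] True by (intro mult_right_mono) auto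
    also have "\<dots> < multinomial ?E"
      using Cons.IH[OF Cons.prems(1) _ Cons.prems(3) E2] wt True by simp
    finally show ?thesis by (simp add: mult True)
  next
    case False
    have "sum_list ?E \<noteq> 0"
    proof
      assume "sum_list ?E = 0"
      then have "filter (\<lambda>e. e \<noteq> 0) ?E = []" by (simp add: filter_empty_conv)
      then show False using Cons.prems(4) False by (simp add: forget_decorations_def)
    qed
    then have d: "0 < fst d" "fst d < weight w" using False wt by linarith+
    have "real (length (outcomes (d # D) w)) \<le> real (split_count w (fst d)) * multinomial ?E"
      using uv by (intro outcomes_count_Cons[OF Cons.prems(1)] length_outcomes_le)
    also have "\<dots> < real (weight w choose fst d) * multinomial ?E"
      using split_count_less[OF Cons.prems(1,3) d] multinomial_pos[of ?E]
      by (intro mult_strict_right_mono) auto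
    finally show ?thesis by (simp add: mult)
  qed
qed

section \<open>Words of degree one letters\<close>

definition level_words :: "nat \<Rightarrow> 'h list set" where
  "level_words k = {w. length w = k \<and> set w \<subseteq> B 1}"

lemma level_words_0: "level_words 0 = {[]}"
  by (auto simp: level_words_def)

lemma level_words_Suc: "level_words (Suc k) = (\<lambda>(a, w). a # w) ` (B 1 \<times> level_words k)"
  by (auto simp: level_words_def image_iff length_Suc_conv)

lemma finite_level_words: "finite (level_words k)"
  by (induction k) (auto simp: level_words_0 level_words_Suc finite_basis)

lemma sum_level_words_Suc:
  "(\<Sum>w\<in>level_words (Suc k). f w) = (\<Sum>a\<in>B 1. \<Sum>w\<in>level_words k. f (a # w) :: real)"
proof -
  have "inj_on (\<lambda>(a, w). a # w) (B 1 \<times> level_words k)" by (auto simp: inj_on_def)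
  then show ?thesis
    unfolding level_words_Suc by (simp add: sum.reindex sum.cartesian_product case_prod_unfold)
qed

lemma sum_level_words_append:
  "(\<Sum>u\<in>level_words j. \<Sum>v\<in>level_words k. f (u @ v)) = (\<Sum>w\<in>level_words (j + k). f w :: real)"
proof (induction j arbitrary: f)
  case (Suc j)
  then show ?case by (simp add: sum_level_words_Suc Suc[of "\<lambda>w. f (_ # w)"])
qed (simp add: level_words_0)

lemma weight_level: "set w \<subseteq> B 1 \<Longrightarrow> weight w = length w"
  using deg_eq by (induction w) auto

lemma level_positive: "B 1 \<subseteq> positive_basis"
  by (auto intro: positive_basisI)

text \<open>A word with \<open>d\<close> marked positions amounts to a set of positions together
  with the two subwords, so each pair of subwords arises \<open>k choose d\<close> times. The
  induction is Pascal's rule.\<close>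

lemma sum_splits_level_words:
  "(\<Sum>w\<in>level_words k. \<Sum>(u, v)\<leftarrow>splits w. if length u = d then f u v else 0)
    = real (k choose d) * (\<Sum>u\<in>level_words d. \<Sum>v\<in>level_words (k - d). f u v :: real)"
proof (induction k arbitrary: d f)
  case 0
  then show ?case by (cases d) (auto simp: level_words_0)
next
  case (Suc k)
  have "(\<Sum>w\<in>level_words (Suc k). \<Sum>(u, v)\<leftarrow>splits w. if length u = d then f u v else 0)
      = (\<Sum>a\<in>B 1. \<Sum>w\<in>level_words k. \<Sum>(u, v)\<leftarrow>splits w. if Suc (length u) = d then f (a # u) v else 0)
      + (\<Sum>a\<in>B 1. \<Sum>w\<in>level_words k. \<Sum>(u, v)\<leftarrow>splits w. if length u = d then f u (a # v) else 0)"
    by (simp only: sum_level_words_Suc splits.simps map_append sum_list_append sum.distrib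
        case_prod_unfold comp_def map_map fst_conv snd_conv length_Cons)
  also have "(\<Sum>a\<in>B 1. \<Sum>w\<in>level_words k. \<Sum>(u, v)\<leftarrow>splits w. if length u = d then f u (a # v) else 0)
      = real (k choose d) * (\<Sum>u\<in>level_words d. \<Sum>v\<in>level_words (Suc k - d). f u v)"
  proof (cases "d \<le> k")
    case True
    have "(\<Sum>a\<in>B 1. \<Sum>w\<in>level_words k. \<Sum>(u, v)\<leftarrow>splits w. if length u = d then f u (a # v) else 0)
        = real (k choose d) * (\<Sum>a\<in>B 1. \<Sum>u\<in>level_words d. \<Sum>v\<in>level_words (k - d). f u (a # v))"
      unfolding Suc.IH sum_distrib_left ..
    also have "(\<Sum>a\<in>B 1. \<Sum>u\<in>level_words d. \<Sum>v\<in>level_words (k - d). f u (a # v))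
        = (\<Sum>u\<in>level_words d. \<Sum>v\<in>level_words (Suc k - d). f u v)"
      by (subst sum.swap) (simp add: Suc_diff_le[OF True] sum_level_words_Suc)
    finally show ?thesis .
  qed (simp add: Suc.IH binomial_eq_0)
  also have "(\<Sum>a\<in>B 1. \<Sum>w\<in>level_words k. \<Sum>(u, v)\<leftarrow>splits w. if Suc (length u) = d then f (a # u) v else 0)
      = (if d = 0 then 0 else real (k choose (d - 1))) *
        (\<Sum>u\<in>level_words d. \<Sum>v\<in>level_words (Suc k - d). f u v)"
  proof (cases d)
    case (Suc j)
    have "(\<Sum>a\<in>B 1. \<Sum>w\<in>level_words k. \<Sum>(u, v)\<leftarrow>splits w. if Suc (length u) = d then f (a # u) v else 0)
        = real (k choose j) * (\<Sum>a\<in>B 1. \<Sum>u\<in>level_words j. \<Sum>v\<in>level_words (k - j). f (a # u) v)"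
      unfolding Suc nat.inject Suc.IH sum_distrib_left ..
    then show ?thesis by (simp add: Suc sum_level_words_Suc)
  qed (simp add: case_prod_unfold)
  finally show ?case
    by (cases d) (simp_all add: algebra_simps)
qed

lemma act_level_words: "u \<in> level_words k \<Longrightarrow> act d u \<in> level_words k"
  using set_flip[of u "B 1"] tau_basis(1) by (auto simp: level_words_def act_def)

lemma act_act: "set u \<subseteq> basis \<Longrightarrow> act d (act d u) = u"
  by (simp add: act_def flip_flip)

text \<open>Every word of degree one letters is an outcome equally often: the operators act on these
  words as averages of bijections.\<close>

lemma sum_outcomes_level_words:
  assumes "sum_list (forget_decorations D) = k"
  shows "(\<Sum>w\<in>level_words k. \<Sum>w'\<leftarrow>outcomes D w. f w')
    = multinomial (forget_decorations D) * (\<Sum>w\<in>level_words k. f w)"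
  using assms
proof (induction D arbitrary: k f)
  case Nil
  then show ?case by (simp add: forget_decorations_def level_words_0 multinomial_Nil)
next
  case (Cons d D)
  let ?E = "forget_decorations D"
  have k: "k = fst d + sum_list ?E" using Cons.prems by (simp add: forget_decorations_def)
  have "(\<Sum>w\<in>level_words k. \<Sum>w'\<leftarrow>outcomes (d # D) w. f w')
      = (\<Sum>w\<in>level_words k. \<Sum>(u, v)\<leftarrow>splits w.
          if length u = fst d then (\<Sum>v'\<leftarrow>outcomes D v. f (act d u @ v')) else 0)"
    unfolding sum_list_outcomes_Cons
  proof (intro sum.cong[OF refl] arg_cong[of _ _ sum_list] map_cong refl)
    fix w p assume w: "w \<in> level_words k" and p: "p \<in> set (splits w)"
    obtain u v where uv: "p = (u, v)" by fastforce
    then have "set u \<subseteq> B 1" using set_splits[of u v w] p w by (auto simp: level_words_def)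
    then show "(case p of (u, v) \<Rightarrow>
          if weight u = fst d then (\<Sum>v'\<leftarrow>outcomes D v. f (act d u @ v')) else 0)
        = (case p of (u, v) \<Rightarrow>
          if length u = fst d then (\<Sum>v'\<leftarrow>outcomes D v. f (act d u @ v')) else 0)"
      by (simp add: uv weight_level)
  qed
  also have "\<dots> = real (k choose fst d) * (\<Sum>u\<in>level_words (fst d). \<Sum>v\<in>level_words (k - fst d).
      \<Sum>v'\<leftarrow>outcomes D v. f (act d u @ v'))"
    by (rule sum_splits_level_words)
  also have "(\<Sum>u\<in>level_words (fst d). \<Sum>v\<in>level_words (k - fst d).
      \<Sum>v'\<leftarrow>outcomes D v. f (act d u @ v'))
      = multinomial ?E * (\<Sum>u\<in>level_words (fst d). \<Sum>v\<in>level_words (k - fst d). f (act d u @ v))"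
    unfolding sum_distrib_left[of "multinomial ?E"] by (intro sum.cong refl Cons.IH[unfolded sum_distrib_left]) (simp add: k)
  also have "(\<Sum>u\<in>level_words (fst d). \<Sum>v\<in>level_words (k - fst d). f (act d u @ v))
      = (\<Sum>u\<in>level_words (fst d). \<Sum>v\<in>level_words (k - fst d). f (u @ v))"
  proof (rule sum.reindex_bij_witness[of _ "act d" "act d"])
    fix u assume "u \<in> level_words (fst d)"
    then have "set u \<subseteq> basis" by (auto simp: level_words_def)
    then show "act d (act d u) = u" by (rule act_act)
    then show "act d (act d u) = u" .
  qed (use act_level_words in auto)
  also have "\<dots> = (\<Sum>w\<in>level_words k. f w)"
    unfolding sum_level_words_append by (simp add: k)
  finally show ?case
    by (simp add: forget_decorations_def multinomial_Cons k[unfolded forget_decorations_def])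
qed

subsection \<open>Outcomes of words of degree one letters\<close>

lemma outcomes_ConsI:
  "\<lbrakk>(u, v) \<in> set (splits w); weight u = fst d; v' \<in> set (outcomes D v)\<rbrakk>
    \<Longrightarrow> act d u @ v' \<in> set (outcomes (d # D) w)"
  by force

lemma outcomes_nonempty:
  "\<lbrakk>set w \<subseteq> B 1; length w = sum_list (forget_decorations D)\<rbrakk> \<Longrightarrow> \<exists>w'. w' \<in> set (outcomes D w)"
proof (induction D arbitrary: w)
  case Nil
  then show ?case by (simp add: forget_decorations_def)
next
  case (Cons d D)
  let ?u = "take (fst d) w" and ?v = "drop (fst d) w"
  have uv: "set ?u \<subseteq> B 1" "set ?v \<subseteq> B 1"
    using Cons.prems(1) set_take_subset set_drop_subset by fast+
  obtain v' where "v' \<in> set (outcomes D ?v)"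
    using Cons.IH[OF uv(2)] Cons.prems(2) by (auto simp: forget_decorations_def)
  moreover have "weight ?u = fst d"
    using weight_level[OF uv(1)] Cons.prems(2) by (simp add: forget_decorations_def)
  ultimately show ?case
    using outcomes_ConsI[OF splits_take_drop] by blast
qed

text \<open>Two adjacent letters that are sent to different parts can be exchanged.\<close>

lemma common_outcome:
  assumes "set (x @ a # b # y) \<subseteq> B 1"
    and "length (x @ a # b # y) = sum_list (forget_decorations D)"
    and "length (filter (\<lambda>e. e \<noteq> 0) (forget_decorations D)) \<ge> 2"
  shows "\<exists>w'. w' \<in> set (outcomes D (x @ a # b # y)) \<and> w' \<in> set (outcomes D (x @ b # a # y))"
  using assms(2,3)
proof (induction D)
  case Nil
  then show ?case by (simp add: forget_decorations_def)
next
  case (Cons d D)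
  let ?E = "forget_decorations D"
  have len: "Suc (Suc (length x + length y)) = fst d + sum_list ?E"
    using Cons.prems(1) by (simp add: forget_decorations_def)
  show ?case
  proof (cases "fst d = 0")
    case True
    then obtain w' where "w' \<in> set (outcomes D (x @ a # b # y))" "w' \<in> set (outcomes D (x @ b # a # y))"
      using Cons by (auto simp: forget_decorations_def)
    then show ?thesis
      using outcomes_ConsI[OF splits_right, of d w' D] True by (metis weight_simps(1))
  next
    case False
    have "sum_list ?E \<noteq> 0"
    proof
      assume "sum_list ?E = 0"
      then have "filter (\<lambda>e. e \<noteq> 0) ?E = []" by (simp add: filter_empty_conv)
      then show False using Cons.prems(2) False by (simp add: forget_decorations_def)
    qed
    \<comment> \<open>Besides \<open>a\<close>, the first nonzero part takes \<open>k\<close>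
      further letters, from \<open>x\<close> as long as they last and then from \<open>y\<close>;
      \<open>b\<close> is left to the later parts. The order of \<open>a\<close> and
      \<open>b\<close> is thereby forgotten.\<close>
    define k where "k = fst d - 1"
    have k: "fst d = Suc k" "k \<le> length x + length y" "sum_list ?E = Suc (length x + length y - k)"
      unfolding k_def using False \<open>sum_list ?E \<noteq> 0\<close> len by linarith+
    define x1 x2 y1 y2 where "x1 = take k x" "x2 = drop k x"
      "y1 = take (k - length x) y" "y2 = drop (k - length x) y"
    have sx: "(x1, x2) \<in> set (splits x)" "(y1, y2) \<in> set (splits y)"
      unfolding x1_x2_y1_y2_def by (rule splits_take_drop)+
    have "([a], [b]) \<in> set (splits [a, b])" "([a], [b]) \<in> set (splits [b, a])" by auto
    then have sp: "(x1 @ a # y1, x2 @ b # y2) \<in> set (splits (x @ a # b # y))"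
        "(x1 @ a # y1, x2 @ b # y2) \<in> set (splits (x @ b # a # y))"
      using splits_append[OF sx(1) splits_append[OF _ sx(2)], of "[a]" "[b]" "[a, b]"]
        splits_append[OF sx(1) splits_append[OF _ sx(2)], of "[a]" "[b]" "[b, a]"] by simp_all
    have sets: "set (x1 @ a # y1) \<subseteq> B 1" "set (x2 @ b # y2) \<subseteq> B 1"
      using set_splits[OF sp(1)] assms(1) by auto
    have "length (x1 @ a # y1) = fst d"
      using k by (auto simp: x1_x2_y1_y2_def)
    then have wt: "weight (x1 @ a # y1) = fst d" using weight_level[OF sets(1)] by simp
    have "length (x2 @ b # y2) = sum_list ?E"
      using k by (auto simp: x1_x2_y1_y2_def)
    then obtain v' where "v' \<in> set (outcomes D (x2 @ b # y2))"
      using outcomes_nonempty[OF sets(2)] by blast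
    then show ?thesis
      using outcomes_ConsI[OF sp(1) wt] outcomes_ConsI[OF sp(2) wt] by blast
  qed
qed

text \<open>The letters can be arranged so that the decorated parts receive exactly those of
  \<open>u\<close>. Multisets suffice because the coefficients of a fixed vector turn out to be
  symmetric.\<close>

lemma flipping_outcome:
  assumes "set u \<subseteq> B 1" "set v \<subseteq> B 1" "length u = decorated_size D"
    and "length u + length v = sum_list (forget_decorations D)"
  shows "\<exists>w w'. mset w = mset (u @ v) \<and> w' \<in> set (outcomes D w) \<and> mset w' = mset (map \<tau> u @ v)"
  using assms
proof (induction D arbitrary: u v)
  case Nil
  then show ?case by (intro exI[of _ "[]"]) (simp add: forget_decorations_def)
next
  case (Cons d D)
  let ?E = "forget_decorations D"
  show ?case
  proof (cases "decorated d")
    case True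
    let ?u = "take (fst d) u" and ?u' = "drop (fst d) u"
    have lenu: "length u = fst d + decorated_size D"
      using Cons.prems(3) True by (simp add: decorated_size_def forget_decorations_def)
    have sets: "set ?u \<subseteq> B 1" "set ?u' \<subseteq> B 1"
      using Cons.prems(1) set_take_subset set_drop_subset by fast+
    have "\<exists>w w'. mset w = mset (?u' @ v) \<and> w' \<in> set (outcomes D w) \<and> mset w' = mset (map \<tau> ?u' @ v)"
      using Cons.prems(4) lenu by (intro Cons.IH sets Cons.prems) (auto simp: forget_decorations_def)
    then obtain w w' where w: "mset w = mset (?u' @ v)" "w' \<in> set (outcomes D w)"
      "mset w' = mset (map \<tau> ?u' @ v)" by blast
    have "weight ?u = fst d" using weight_level[OF sets(1)] lenu by simp
    moreover have "(?u, w) \<in> set (splits (?u @ w))"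
      using splits_append[OF splits_left splits_right] by simp
    ultimately have "act d ?u @ w' \<in> set (outcomes (d # D) (?u @ w))"
      using outcomes_ConsI w(2) by blast
    moreover have "mset u = mset ?u + mset ?u'"
      by (metis append_take_drop_id mset_append)
    moreover have "mset (act d ?u) = mset (map \<tau> ?u)" using True by (simp add: act_def mset_flip)
    ultimately show ?thesis using w(1,3)
      by (intro exI[of _ "?u @ w"] exI[of _ "act d ?u @ w'"]) (simp add: mset_map)
  next
    case False
    let ?v = "take (fst d) v" and ?v' = "drop (fst d) v"
    have lenu: "length u = decorated_size D"
      using Cons.prems(3) False by (simp add: decorated_size_def forget_decorations_def)
    have "decorated_size D \<le> sum_list ?E"
      unfolding decorated_size_def forget_decorations_def by (induction D) auto
    then have lenv: "length v = fst d + (sum_list ?E - length u)" "length u \<le> sum_list ?E"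
      using Cons.prems(4) lenu by (auto simp: forget_decorations_def)
    have sets: "set ?v \<subseteq> B 1" "set ?v' \<subseteq> B 1"
      using Cons.prems(2) set_take_subset set_drop_subset by fast+
    have "\<exists>w w'. mset w = mset (u @ ?v') \<and> w' \<in> set (outcomes D w) \<and> mset w' = mset (map \<tau> u @ ?v')"
      using lenv lenu by (intro Cons.IH sets Cons.prems) auto
    then obtain w w' where w: "mset w = mset (u @ ?v')" "w' \<in> set (outcomes D w)"
      "mset w' = mset (map \<tau> u @ ?v')" by blast
    have "weight ?v = fst d" using weight_level[OF sets(1)] lenv by simp
    moreover have "(?v, w) \<in> set (splits (?v @ w))"
      using splits_append[OF splits_left splits_right] by simp
    ultimately have "act d ?v @ w' \<in> set (outcomes (d # D) (?v @ w))"
      using outcomes_ConsI w(2) by blast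
    moreover have "mset v = mset ?v + mset ?v'"
      by (metis append_take_drop_id mset_append)
    ultimately show ?thesis using w(1,3) False
      by (intro exI[of _ "?v @ w"] exI[of _ "act d ?v @ w'"]) (simp add: act_def)
  qed
qed

subsection \<open>Zero parts\<close>

lemma descent_op_graded: "descent_op D h \<in> span (B (sum_list (forget_decorations D)))"
proof (induction D arbitrary: h)
  case Nil
  then show ?case by (simp add: forget_decorations_def span_scale one_graded)
next
  case (Cons d D)
  have "(if decorated d then \<tau> u else u) \<in> span (B (fst d))" if "u \<in> B (fst d)" for u
    using that tau_basis(1) by (auto intro: span_base)
  then show ?case
    using graded_mult[OF _ Cons] by (auto intro!: span_sum simp: forget_decorations_def)
qed

text \<open>A zero part contributes the scalar \<open>\<beta>\<close> from multiplication by
  \<open>b\<close> and its inverse from the contraction, and \<open>\<tau>\<close> fixes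
  \<open>b\<close>. So the infinitely many compositions of \<open>n\<close> yield only finitely many
  operators.\<close>

lemma descent_op_filter: "descent_op (filter (\<lambda>d. fst d > 0) D) h = descent_op D h"
proof (induction D arbitrary: h)
  case (Cons d D)
  show ?case
  proof (cases "fst d = 0")
    case True
    obtain b \<beta> where b: "B 0 = {b}" "b = \<beta> *\<^sub>R 1" "\<beta> \<noteq> 0" "\<epsilon> b = \<beta>"
      by (rule basis_zero)
    have "\<tau> b = b" using tau_basis(1)[of b 0] b(1) by simp
    then have "descent_op (d # D) h = b * descent_op D (contract b h)"
      unfolding descent_op.simps True b(1) by simp
    also have "\<dots> = descent_op D (\<beta> *\<^sub>R contract b h)"
      by (simp add: b(2) linear_scale[OF linear_descent_op])
    also have "\<beta> *\<^sub>R contract b h = h"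
      using contract_unit[of b h] b by simp
    finally show ?thesis using Cons True by simp
  qed (simp add: Cons)
qed simp

lemma multinomial_filter:
  "multinomial (forget_decorations (filter (\<lambda>d. fst d > 0) D)) = multinomial (forget_decorations D)"
  and sum_list_filter:
  "sum_list (forget_decorations (filter (\<lambda>d. fst d > 0) D)) = sum_list (forget_decorations D)"
proof -
  show *: "sum_list (forget_decorations (filter (\<lambda>d. fst d > 0) D)) = sum_list (forget_decorations D)" for D
    by (induction D) (auto simp: forget_decorations_def)
  show "multinomial (forget_decorations (filter (\<lambda>d. fst d > 0) D)) = multinomial (forget_decorations D)"
    by (induction D) (auto simp: forget_decorations_def multinomial_Cons *[unfolded forget_decorations_def])
qed

lemma finite_positive_compositions:
  "finite {D :: decorated_composition. sum_list (forget_decorations D) = n \<and> (\<forall>d\<in>set D. fst d > 0)}"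
proof (rule finite_subset)
  have "(UNIV :: decoration set) = {Plain, Bar, TildeBar}"
    using decoration.exhaust by auto
  then have "finite (UNIV :: decoration set)" by (metis finite.simps)
  then show "finite {D. set D \<subseteq> {..n} \<times> (UNIV :: decoration set) \<and> length D \<le> n}"
    by (intro finite_lists_length_le finite_cartesian_product) auto
  have "fst d \<le> sum_list (map fst D)" if "d \<in> set D" for d :: "nat \<times> decoration" and D
    using that member_le_sum_list[of "fst d" "map fst D"] by simp
  moreover have "length D \<le> sum_list (map fst D)" if "\<forall>d\<in>set D. fst d > 0" for D :: decorated_composition
    using that by (induction D) auto
  ultimately show "{D. sum_list (forget_decorations D) = n \<and> (\<forall>d\<in>set D. fst d > 0)}
      \<subseteq> {D. set D \<subseteq> {..n} \<times> (UNIV :: decoration set) \<and> length D \<le> n}"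
    unfolding forget_decorations_def by fastforce
qed

end

section \<open>The averaged operator\<close>

locale hopf_chain = hopf_involution B \<Delta> \<epsilon> \<tau>
  for B :: "nat \<Rightarrow> 'h::real_algebra_1 set" and \<Delta> \<epsilon> \<tau> +
  fixes n :: nat and P :: "decorated_composition pmf"
  assumes support: "D \<in> set_pmf P \<Longrightarrow> sum_list (forget_decorations D) = n"
    and two_parts: "\<exists>D\<in>set_pmf P. length (filter (\<lambda>e. e \<noteq> 0) (forget_decorations D)) \<ge> 2"
begin

abbreviation averaged :: "'h \<Rightarrow> 'h" where
  "averaged \<equiv> averaged_descent_op B \<Delta> \<epsilon> \<tau> n P"

text \<open>Only finitely many pairs of operator and multinomial coefficient occur on the support of
  \<open>P\<close>, so the integrand is bounded for an arbitrary function \<open>f\<close>.\<close>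

lemma integrable_descent_op:
  "integrable (measure_pmf P) (\<lambda>D. f (descent_op D h) / multinomial (forget_decorations D) :: real)"
proof -
  let ?g = "\<lambda>D. f (descent_op D h) / multinomial (forget_decorations D)"
  let ?X = "{D :: decorated_composition. sum_list (forget_decorations D) = n \<and> (\<forall>d\<in>set D. fst d > 0)}"
  have "finite ((\<lambda>D. norm (?g D)) ` ?X)" using finite_positive_compositions by blast
  then obtain M where M: "\<And>D. D \<in> ?X \<Longrightarrow> norm (?g D) \<le> M"
    by (meson bdd_above.unfold bdd_above_finite imageI)
  have "norm (?g D) \<le> M" if "D \<in> set_pmf P" for D
    using M[of "filter (\<lambda>d. fst d > 0) D"] support[OF that]
    by (simp add: sum_list_filter descent_op_filter multinomial_filter)
  then show ?thesis
    by (intro measure_pmf.integrable_const_bound[where B = M]) (auto simp: AE_measure_pmf_iff)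
qed

lemma averaged_graded: "averaged h \<in> span (B n)"
  unfolding averaged_descent_op_def by (intro span_sum span_scale span_base)

text \<open>The expectation in the definition is taken coordinate by coordinate. Since only the
  finitely many coordinates in \<open>B n\<close> matter, every linear functional can be moved
  inside it.\<close>

lemma linear_averaged_functional:
  fixes f :: "'h \<Rightarrow> real"
  assumes "linear f"
  shows "f (averaged h) = measure_pmf.expectation P
    (\<lambda>D. f (descent_op D h) / multinomial (forget_decorations D))"
proof -
  let ?m = "\<lambda>D. multinomial (forget_decorations D)"
  have "f (averaged h) = (\<Sum>y\<in>B n.
      measure_pmf.expectation P (\<lambda>D. coef B (descent_op D h) y / ?m D) * f y)"
    unfolding averaged_descent_op_def linear_sum[OF assms] linear_scale[OF assms] signed_descent_op_eq
    by simp
  also have "\<dots> = measure_pmf.expectation P (\<lambda>D. \<Sum>y\<in>B n. coef B (descent_op D h) y / ?m D * f y)"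
    using integrable_mult_left[OF integrable_descent_op[of "\<lambda>k. coef B k _" h]]
    by (subst Bochner_Integration.integral_sum) (simp_all del: times_divide_eq_left)
  also have "\<dots> = measure_pmf.expectation P (\<lambda>D. f (descent_op D h) / ?m D)"
  proof (rule integral_cong_AE)
    have "(\<Sum>y\<in>B n. coef B (descent_op D h) y / ?m D * f y) = f (descent_op D h) / ?m D"
      if "D \<in> set_pmf P" for D
    proof -
      have "f (descent_op D h) = f (\<Sum>y\<in>B n. coef B (descent_op D h) y *\<^sub>R y)"
        using graded_expansion[OF descent_op_graded[of D h]] support[OF that] by simp
      then show ?thesis
        by (simp add: linear_sum[OF assms] linear_scale[OF assms] sum_divide_distrib)
    qed
    then show "AE D in measure_pmf P.
        (\<Sum>y\<in>B n. coef B (descent_op D h) y / ?m D * f y) = f (descent_op D h) / ?m D"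
      by (simp add: AE_measure_pmf_iff)
  qed auto
  finally show ?thesis .
qed

lemma linear_averaged: "linear averaged"
proof (intro linearI coef_eqI)
  fix g h b
  show "coef B (averaged (g + h)) b = coef B (averaged g + averaged h) b"
    using integrable_descent_op[of "\<lambda>k. coef B k b"]
    unfolding coef_add linear_averaged_functional[OF linear_coef]
    by (simp add: linear_add[OF linear_descent_op] coef_add add_divide_distrib)
next
  fix c h b
  show "coef B (averaged (c *\<^sub>R h)) b = coef B (c *\<^sub>R averaged h) b"
    unfolding coef_scale linear_averaged_functional[OF linear_coef]
    by (simp add: linear_scale[OF linear_descent_op] coef_scale times_divide_eq_right[symmetric]
        del: times_divide_eq_right)
qed

subsection \<open>Fixed vectors are determined by their degree one letters\<close>

text \<open>A maximum principle: the value at \<open>w\<close> is at most \<open>M\<close> times the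
  mean of \<open>r\<close>, the number of outcomes divided by the multinomial coefficient, and
  \<open>r\<close> is below 1 for a composition of positive probability.\<close>

lemma fixed_bound:
  assumes h: "averaged h = h" and w: "set w \<subseteq> positive_basis" "weight w = n" "\<exists>a\<in>set w. deg a \<ge> 2"
    and long: "\<And>w'. \<lbrakk>set w' \<subseteq> positive_basis; length w' > length w\<rbrakk> \<Longrightarrow> word_coef w' h = 0"
    and M: "\<And>w'. \<lbrakk>set w' \<subseteq> positive_basis; length w' = length w\<rbrakk> \<Longrightarrow> \<bar>word_coef w' h\<bar> \<le> M"
    and eq: "\<bar>word_coef w h\<bar> = M"
  shows "M = 0"
proof (rule ccontr)
  assume "M \<noteq> 0"
  then have M0: "M > 0" using eq by auto
  define r where "r D = real (length (outcomes D w)) / multinomial (forget_decorations D)" for D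
  have r: "0 \<le> r D" "r D \<le> 1" if "D \<in> set_pmf P" for D
    using length_outcomes_le[OF w(1), of D] w(2) support[OF that] multinomial_pos[of "forget_decorations D"]
    by (auto simp: r_def)
  have int_r: "integrable (measure_pmf P) r"
    using r by (intro measure_pmf.integrable_const_bound[where B = 1]) (auto simp: AE_measure_pmf_iff)
  have bound: "\<bar>word_coef w (descent_op D h) / multinomial (forget_decorations D)\<bar> \<le> M * r D" for D
  proof -
    have "\<bar>word_coef w (descent_op D h)\<bar> \<le> (\<Sum>w'\<leftarrow>outcomes D w. \<bar>word_coef w' h\<bar>)"
      using word_coef_descent_op[OF w(1) long, of D]
        sum_list_abs[of "map (\<lambda>w'. word_coef w' h) (outcomes D w)"]
      by (simp add: comp_def)
    also have "\<dots> \<le> (\<Sum>w'\<leftarrow>outcomes D w. M)"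
      using M outcomes_positive[OF w(1)] outcomes_length by (intro sum_list_mono) blast
    also have "\<dots> = M * real (length (outcomes D w))" by (simp add: sum_list_triv)
    finally show ?thesis
      using multinomial_pos[of "forget_decorations D"] by (simp add: r_def divide_right_mono)
  qed
  have "M = \<bar>measure_pmf.expectation P (\<lambda>D. word_coef w (descent_op D h) / multinomial (forget_decorations D))\<bar>"
    using linear_averaged_functional[OF linear_word_coef, of w h] eq h by simp
  also have "\<dots> \<le> measure_pmf.expectation P (\<lambda>D. \<bar>word_coef w (descent_op D h) / multinomial (forget_decorations D)\<bar>)"
    by (rule integral_abs_bound)
  also have "\<dots> \<le> measure_pmf.expectation P (\<lambda>D. M * r D)"
    by (rule integral_mono[OF integrable_abs[OF integrable_descent_op] _ bound]) (use int_r in auto)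
  also have "\<dots> = M * measure_pmf.expectation P r" by simp
  \<comment> \<open>As \<open>r\<close> is at most 1 on the support, this forces
    \<open>r = 1\<close> almost surely, contrary to \<open>length_outcomes_less\<close> at a
    composition with two nonzero parts.\<close>
  finally have "measure_pmf.expectation P r \<ge> 1" using M0 by simp
  moreover have "measure_pmf.expectation P (\<lambda>D. 1 - r D) = 1 - measure_pmf.expectation P r"
    using int_r by (subst Bochner_Integration.integral_diff) auto
  moreover have nonneg: "AE D in measure_pmf P. 0 \<le> 1 - r D"
    using r by (auto simp: AE_measure_pmf_iff)
  moreover have "measure_pmf.expectation P (\<lambda>D. 1 - r D) \<ge> 0"
    by (rule integral_nonneg_AE[OF nonneg])
  ultimately have "measure_pmf.expectation P (\<lambda>D. 1 - r D) = 0" by linarith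
  then have "AE D in measure_pmf P. 1 - r D = 0"
    using integral_nonneg_eq_0_iff_AE[OF _ nonneg] int_r by simp
  moreover obtain D where D: "D \<in> set_pmf P" "length (filter (\<lambda>e. e \<noteq> 0) (forget_decorations D)) \<ge> 2"
    using two_parts by blast
  ultimately have "r D = 1" by (simp add: AE_measure_pmf_iff)
  then show False
    using length_outcomes_less[OF w(1) _ w(3) D(2)] w(2) support[OF D(1)]
      multinomial_pos[of "forget_decorations D"] by (simp add: r_def)
qed

lemma n_ge_2: "n \<ge> 2"
proof -
  obtain D where D: "D \<in> set_pmf P" "length (filter (\<lambda>e. e \<noteq> 0) (forget_decorations D)) \<ge> 2"
    using two_parts by blast
  have "length (filter (\<lambda>e. e \<noteq> 0) E) \<le> sum_list E" for E :: "nat list"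
    by (induction E) auto
  from this[of "forget_decorations D"] show ?thesis using D support[OF D(1)] by simp
qed

lemma fixed_eq_zero:
  assumes h: "h \<in> span (B n)" "averaged h = h"
    and zero: "\<And>w. w \<in> level_words n \<Longrightarrow> word_coef w h = 0"
  shows "h = 0"
proof -
  \<comment> \<open>Downward induction on word length: at \<open>j = 0\<close> the words of length
    \<open>n\<close> and weight \<open>n\<close> have only degree one letters, and
    \<open>j = n\<close> covers every word.\<close>
  have "word_coef w h = 0" if "set w \<subseteq> positive_basis" "length w \<ge> n - j" for w j
    using that
  proof (induction j arbitrary: w)
    case 0
    show ?case
    proof (cases "length w > n")
      case True
      then show ?thesis using word_coef_long[OF h(1) 0(1)] by simp
    next
      case False
      then have len: "length w = n" using 0(2) by simp
      have sub: "set w \<subseteq> basis" using 0(1) basis_cases by (meson subset_iff)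
      show ?thesis
      proof (cases "weight w = n")
        case True
        have "\<forall>a\<in>set w. deg a = 1"
          using 0(1) True[folded len]
        proof (induction w)
          case (Cons a w)
          have "length w \<le> weight w" using Cons.prems(1)
            by (induction w) (auto simp: positive_basis_iff)
          then have "weight w = length w" "deg a = 1"
            using Cons.prems by (auto simp: positive_basis_iff)
          then show ?case using Cons by auto
        qed simp
        then have "set w \<subseteq> B 1" using 0(1) by (auto simp: positive_basis_iff)
        then show ?thesis using zero len by (simp add: level_words_def)
      next
        case False
        then show ?thesis using word_coef_graded[OF h(1) sub] by simp
      qed
    qed
  next
    case (Suc j)
    show ?case
    proof (cases "length w \<ge> n - j")
      case True
      then show ?thesis using Suc by blast
    next
      case False
      define k where "k = length w"
      have k: "k < n" "\<And>w'. \<lbrakk>set w' \<subseteq> positive_basis; length w' > k\<rbrakk> \<Longrightarrow> word_coef w' h = 0"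
        using False Suc.prems(2) Suc.IH by (auto simp: k_def)
      define X where "X = {w. set w \<subseteq> (\<Union>i\<le>n. B i) \<and> length w = k}"
      have finX: "finite X" unfolding X_def by (intro finite_lists_length_eq) (auto simp: finite_basis)
      \<comment> \<open>A finite set containing every word of length \<open>k\<close> with nonzero
        coefficient, so that a maximal coefficient exists.\<close>
      define Y where "Y = {w \<in> X. set w \<subseteq> positive_basis \<and> weight w = n}"
      have finY: "finite Y" using finX by (simp add: Y_def)
      have inY: "w' \<in> Y" if "set w' \<subseteq> positive_basis" "length w' = k" "word_coef w' h \<noteq> 0" for w'
      proof -
        have sub: "set w' \<subseteq> basis" using that(1) basis_cases by (meson subset_iff)
        have wt: "weight w' = n" using word_coef_graded[OF h(1) sub] that(3) by blast
        have "a \<in> (\<Union>i\<le>n. B i)" if "a \<in> set w'" for a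
        proof -
          have "deg a \<le> n" using member_le_sum_list[of "deg a" "map deg w'"] that wt
            by (simp add: weight_def)
          moreover have "a \<in> B (deg a)"
            using \<open>set w' \<subseteq> positive_basis\<close> that positive_basis_iff by (metis subset_iff)
          ultimately show ?thesis by blast
        qed
        then show ?thesis using that wt by (auto simp: Y_def X_def)
      qed
      show ?thesis
      proof (rule ccontr)
        assume ne: "word_coef w h \<noteq> 0"
        then have "w \<in> Y" using inY Suc.prems(1) by (simp add: k_def)
        define M where "M = Max ((\<lambda>w. \<bar>word_coef w h\<bar>) ` Y)"
        have "M \<in> (\<lambda>w. \<bar>word_coef w h\<bar>) ` Y"
          unfolding M_def using finY \<open>w \<in> Y\<close> by (intro Max_in) auto
        then obtain v where v: "v \<in> Y" "\<bar>word_coef v h\<bar> = M" by auto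
        have le: "\<bar>word_coef w' h\<bar> \<le> M" if "w' \<in> Y" for w'
          unfolding M_def using finY that by (intro Max_ge) auto
        have M0: "M > 0" using le[OF \<open>w \<in> Y\<close>] ne by linarith
        have vp: "set v \<subseteq> positive_basis" "weight v = n" "length v = k"
          using v(1) by (auto simp: Y_def X_def)
        \<comment> \<open>Fewer than \<open>n\<close> letters share the weight
          \<open>n\<close>.\<close>
        have "\<exists>a\<in>set v. deg a \<ge> 2"
        proof (rule ccontr)
          assume "\<not> (\<exists>a\<in>set v. deg a \<ge> 2)"
          then have "\<forall>a\<in>set v. deg a \<le> 1" by auto
          then have "weight v \<le> length v" by (induction v) auto
          then show False using vp k(1) by simp
        qed
        then have "M = 0"
        proof (rule fixed_bound[OF h(2) vp(1,2)])
          fix w' assume "set w' \<subseteq> positive_basis" "length w' = length v"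
          then show "\<bar>word_coef w' h\<bar> \<le> M"
            using inY[of w'] le[of w'] M0 vp(3) by (cases "word_coef w' h = 0") auto
        qed (use k(2) vp(3) v(2) in auto)
        then show False using M0 by simp
      qed
    qed
  qed
  from this[of _ n] have *: "word_coef w h = 0" if "set w \<subseteq> positive_basis" for w
    using that by simp
  have "coef B h b = 0" for b
  proof (cases "b \<in> B n")
    case True
    then have "b \<in> positive_basis" using n_ge_2 by (intro positive_basisI) auto
    then show ?thesis using *[of "[b]"] by (simp add: word_coef_singleton)
  next
    case False
    then show ?thesis by (rule coef_graded[OF h(1)])
  qed
  then show ?thesis by (intro coef_eqI) (simp add: coef_zero)
qed

end

lemma sum_list_square_diff:
  fixes a :: real
  shows "(\<Sum>x\<leftarrow>xs. (a - f x)\<^sup>2)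
    = real (length xs) * a\<^sup>2 - 2 * a * (\<Sum>x\<leftarrow>xs. f x) + (\<Sum>x\<leftarrow>xs. (f x)\<^sup>2)"
  by (induction xs) (simp_all add: power2_eq_square algebra_simps)

section \<open>Orbit averages of degree one elements\<close>

context hopf_involution
begin

definition orbit_average :: "'h \<Rightarrow> 'h" where
  "orbit_average b = (1 / 2) *\<^sub>R (b + \<tau> b)"

lemma orbit_average_tau: "b \<in> B k \<Longrightarrow> orbit_average (\<tau> b) = orbit_average b"
  by (simp add: orbit_average_def tau_basis add.commute)

lemma tau_orbit_average: "b \<in> B k \<Longrightarrow> \<tau> (orbit_average b) = orbit_average b"
  by (simp add: orbit_average_def tau_basis linear_add[OF linear_tau] linear_scale[OF linear_tau]
      add.commute)

lemma orbit_average_graded: "b \<in> B k \<Longrightarrow> orbit_average b \<in> span (B k)"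
  unfolding orbit_average_def by (intro span_scale span_add span_base tau_basis)

lemma coef_orbit_average:
  assumes "a \<in> B k" "b \<in> B k"
  shows "coef B (orbit_average b) a = ((if a = b then 1 else 0) + (if \<tau> a = b then 1 else 0)) / 2"
proof -
  have "a \<in> basis" "b \<in> basis" using assms by auto
  then have "coef B (orbit_average b) a = (coef B b a + coef B b (\<tau> a)) / 2"
    by (simp only: orbit_average_def coef_scale coef_add coef_tau) simp
  then show ?thesis using coef_basis[OF \<open>b \<in> basis\<close>] by auto
qed

lemma coef_orbit_average_nonneg:
  "\<lbrakk>a \<in> B k; b \<in> B k\<rbrakk> \<Longrightarrow> coef B (orbit_average b) a \<ge> 0"
  by (simp add: coef_orbit_average)

lemma coef_orbit_average_pos_iff:
  assumes "a \<in> B k" "b \<in> B k"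
  shows "coef B (orbit_average b) a > 0 \<longleftrightarrow> orbit_average a = orbit_average b"
proof
  assume "coef B (orbit_average b) a > 0"
  then have "a = b \<or> \<tau> a = b" using assms by (auto simp: coef_orbit_average split: if_splits)
  then show "orbit_average a = orbit_average b" using orbit_average_tau[OF assms(1)] by auto
next
  assume "orbit_average a = orbit_average b"
  then have "coef B (orbit_average b) a = coef B (orbit_average a) a" by simp
  also have "\<dots> > 0" using assms by (simp add: coef_orbit_average)
  finally show "coef B (orbit_average b) a > 0" .
qed

lemma orbit_average_eqD:
  assumes "a \<in> B k" "b \<in> B k" "orbit_average a = orbit_average b"
  shows "b = a \<or> b = \<tau> a"
  using coef_orbit_average_pos_iff[OF assms(1,2)] assms
  by (auto simp: coef_orbit_average split: if_splits)

lemma sum_coef_orbit_average: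
  assumes "b \<in> B k"
  shows "(\<Sum>a\<in>B k. coef B (orbit_average b) a) = 1"
proof -
  have "(\<Sum>a\<in>B k. coef B (orbit_average b) a)
      = (\<Sum>a\<in>B k. (if a = b then 1 else 0) / 2 + (if a = \<tau> b then 1 else 0) / 2)"
    using assms tau_basis(2)
    by (intro sum.cong refl) (auto simp: coef_orbit_average)
  then show ?thesis
    using assms tau_basis(1)[OF assms] finite_basis
    by (simp add: sum.distrib sum_divide_distrib[symmetric])
qed

lemma index_set_eq: "fixed_elements B \<tau> \<union> orbit_averages B \<tau> = orbit_average ` B 1"
proof -
  have "orbit_average b = b" if "\<tau> b = b" for b
    using that by (simp add: orbit_average_def scaleR_2[symmetric])
  then have "fixed_elements B \<tau> = orbit_average ` {b \<in> B 1. \<tau> b = b}"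
    unfolding fixed_elements_def by force
  moreover have "orbit_averages B \<tau> = orbit_average ` {b \<in> B 1. \<tau> b \<noteq> b}"
    unfolding orbit_averages_def orbit_average_def by blast
  ultimately show ?thesis by (simp add: image_Un[symmetric] Collect_disj_eq[symmetric] set_eq_iff image_iff) blast
qed

end

section \<open>Invariance of fixed vectors under permutations and the involution\<close>

context hopf_chain
begin

text \<open>An average of bijections fixes only functions invariant under each of them: the mean square of
  \<open>s w - s w'\<close> vanishes.\<close>

lemma fixed_outcome:
  assumes h: "h \<in> span (B n)" "averaged h = h"
    and D: "D \<in> set_pmf P" and w: "w \<in> level_words n" "w' \<in> set (outcomes D w)"
  shows "word_coef w' h = word_coef w h"
proof -
  let ?m = "\<lambda>D. multinomial (forget_decorations D)"
  let ?s = "\<lambda>w. word_coef w h"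
  let ?W = "level_words n"
  define S where "S = (\<Sum>w\<in>?W. (?s w)\<^sup>2)"
  \<comment> \<open>Expanding the square in \<open>V\<close> bounds it by \<open>U\<close>: the
    squares of \<open>?s w\<close> and of \<open>?s w'\<close> each contribute at most
    \<open>S\<close>. As \<open>U\<close> is linear in the operator, its mean is computable, and it
    is 0 for a fixed vector.\<close>
  define U where "U D = 2 * S - 2 * (\<Sum>w\<in>?W. ?s w * (word_coef w (descent_op D h) / ?m D))" for D
  define V where "V D = (\<Sum>w\<in>?W. (\<Sum>w'\<leftarrow>outcomes D w. (?s w - ?s w')\<^sup>2) / ?m D)" for D
  have W: "set w \<subseteq> positive_basis" "length w = n" "weight w = n" if "w \<in> ?W" for w
    using that level_positive weight_level[of w] by (auto simp: level_words_def)
  have op: "word_coef w (descent_op D h) = (\<Sum>w'\<leftarrow>outcomes D w. ?s w')" if "w \<in> ?W" for w D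
    using word_coef_descent_op[OF W(1)[OF that]] word_coef_long[OF h(1)] W(2)[OF that] by simp
  have V_nonneg: "V D \<ge> 0" for D
    unfolding V_def using multinomial_pos[of "forget_decorations D"]
    by (intro sum_nonneg divide_nonneg_pos sum_list_nonneg) auto
  have VU: "V D \<le> U D" if "D \<in> set_pmf P" for D
  proof -
    have m: "?m D > 0" by (rule multinomial_pos)
    have "(\<Sum>w'\<leftarrow>outcomes D w. (?s w - ?s w')\<^sup>2) / ?m D \<le> (?s w)\<^sup>2
        - 2 * (?s w * (word_coef w (descent_op D h) / ?m D)) + (\<Sum>w'\<leftarrow>outcomes D w. (?s w')\<^sup>2) / ?m D"
      if "w \<in> ?W" for w
    proof -
      have "real (length (outcomes D w)) * (?s w)\<^sup>2 \<le> ?m D * (?s w)\<^sup>2"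
        using length_outcomes_le[OF W(1)[OF that], of D] W(3)[OF that] support[OF \<open>D \<in> set_pmf P\<close>]
        by (intro mult_right_mono) auto
      then show ?thesis
        using m unfolding op[OF that] sum_list_square_diff by (simp add: field_simps)
    qed
    then have "V D \<le> (\<Sum>w\<in>?W. (?s w)\<^sup>2
        - 2 * (?s w * (word_coef w (descent_op D h) / ?m D)) + (\<Sum>w'\<leftarrow>outcomes D w. (?s w')\<^sup>2) / ?m D)"
      unfolding V_def by (intro sum_mono)
    also have "\<dots> = U D"
      using sum_outcomes_level_words[OF support[OF that], of "\<lambda>w. (?s w)\<^sup>2"] m
      by (simp add: sum.distrib sum_subtractf U_def S_def sum_distrib_left[symmetric]
          sum_divide_distrib[symmetric])
    finally show ?thesis .
  qed
  have int: "integrable (measure_pmf P) (\<lambda>D. ?s w * (word_coef w (descent_op D h) / ?m D))" for w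
    by (rule integrable_mult_right[OF integrable_descent_op])
  have int_U: "integrable (measure_pmf P) U"
    unfolding U_def by (intro Bochner_Integration.integrable_diff integrable_mult_right Bochner_Integration.integrable_sum int) simp
  have "measure_pmf.expectation P U = 2 * S - 2 * (\<Sum>w\<in>?W. ?s w * word_coef w (averaged h))"
    unfolding U_def linear_averaged_functional[OF linear_word_coef]
    using int Bochner_Integration.integrable_sum[of ?W, OF int]
    by (simp add: Bochner_Integration.integral_diff Bochner_Integration.integral_sum
        del: times_divide_eq_right)
  then have "measure_pmf.expectation P U = 0"
    by (simp add: h(2) S_def power2_eq_square)
  moreover have "AE D in measure_pmf P. 0 \<le> U D"
    using order_trans[OF V_nonneg VU] by (simp add: AE_measure_pmf_iff)
  ultimately have "AE D in measure_pmf P. U D = 0"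
    using integral_nonneg_eq_0_iff_AE[OF int_U] by simp
  then have "V D = 0"
    using VU[OF D] V_nonneg[of D] D by (simp add: AE_measure_pmf_iff)
  then have "(\<Sum>w'\<leftarrow>outcomes D w. (?s w - ?s w')\<^sup>2) / ?m D = 0"
    unfolding V_def using w(1) multinomial_pos[of "forget_decorations D"]
    by (subst (asm) sum_nonneg_eq_0_iff) (auto intro!: divide_nonneg_pos sum_list_nonneg finite_level_words)
  then have "(\<Sum>w'\<leftarrow>outcomes D w. (?s w - ?s w')\<^sup>2) = 0"
    using multinomial_pos[of "forget_decorations D"] by simp
  then show ?thesis
    using w(2) by (subst (asm) sum_list_nonneg_eq_0_iff) auto
qed

text \<open>Two words that differ by an adjacent exchange share an outcome, and coefficients are
  constant along outcomes. Moving one letter at a time to the front then yields every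
  rearrangement.\<close>

lemma fixed_symmetric:
  assumes h: "h \<in> span (B n)" "averaged h = h"
    and w: "w \<in> level_words n" "mset w' = mset w"
  shows "word_coef w' h = word_coef w h"
proof -
  let ?s = "\<lambda>w. word_coef w h"
  obtain D where D: "D \<in> set_pmf P" "length (filter (\<lambda>e. e \<noteq> 0) (forget_decorations D)) \<ge> 2"
    using two_parts by blast
  have swap: "?s (x @ a # b # y) = ?s (x @ b # a # y)" if xy: "x @ a # b # y \<in> level_words n" for x a b y
  proof -
    have W: "x @ b # a # y \<in> level_words n" using that by (auto simp: level_words_def)
    obtain v where v: "v \<in> set (outcomes D (x @ a # b # y))" "v \<in> set (outcomes D (x @ b # a # y))"
      using common_outcome[OF _ _ D(2), of x a b y] xy support[OF D(1)]
      by (auto simp: level_words_def)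
    show ?thesis
      using fixed_outcome[OF h D(1) that v(1)] fixed_outcome[OF h D(1) W v(2)] by simp
  qed
  have move: "?s (p @ x @ a # y) = ?s (p @ a # x @ y)" if "p @ x @ a # y \<in> level_words n" for p x a y
    using that
  proof (induction x arbitrary: y rule: rev_induct)
    case (snoc b x)
    have "?s (p @ (x @ [b]) @ a # y) = ?s (p @ x @ a # b # y)"
      using swap[of "p @ x" b a y] snoc.prems by simp
    also have "\<dots> = ?s (p @ a # x @ b # y)"
      using snoc.prems by (intro snoc.IH) (auto simp: level_words_def)
    finally show ?case by simp
  qed simp
  have "?s (p @ w') = ?s (p @ w)" if "p @ w \<in> level_words n" "mset w' = mset w" for p w w'
    using that
  proof (induction w arbitrary: p w')
    case (Cons a w)
    then have "a \<in> set w'" by (metis list.set_intros(1) set_mset_mset)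
    then obtain x y where xy: "w' = x @ a # y" by (auto simp: in_set_conv_decomp)
    have W: "p @ x @ a # y \<in> level_words n"
      using Cons.prems(1) mset_eq_length[OF Cons.prems(2)] mset_eq_setD[OF Cons.prems(2)] xy
      by (auto simp: level_words_def)
    have "?s (p @ w') = ?s ((p @ [a]) @ x @ y)"
      using move[OF W] by (simp add: xy)
    also have "\<dots> = ?s ((p @ [a]) @ w)"
      using Cons.prems by (intro Cons.IH) (simp_all add: xy)
    finally show ?case by simp
  qed simp
  from this[of "[]" w w'] w show ?thesis by simp
qed

text \<open>A \<open>D'\<close> of intermediate decorated size allows \<open>\<tau>\<close> to be
  applied to any two letters at once, hence to any even number. A \<open>D\<close> of odd decorated
  size then flips \<open>a\<close> together with an even number of letters, whose flips can be
  undone.\<close>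

lemma fixed_tau_invariant:
  assumes h: "h \<in> span (B n)" "averaged h = h" and mix: "decorations_mix B \<tau> n P"
    and w: "a # r \<in> level_words n"
  shows "word_coef (\<tau> a # r) h = word_coef (a # r) h"
proof (cases "\<forall>b\<in>B 1. \<tau> b = b")
  case True
  then show ?thesis using w by (simp add: level_words_def)
next
  case False
  let ?s = "\<lambda>w. word_coef w h"
  let ?W = "level_words n"
  have W_append: "u @ v \<in> ?W \<longleftrightarrow> set u \<subseteq> B 1 \<and> set v \<subseteq> B 1 \<and> length u + length v = n" for u v
    by (auto simp: level_words_def)
  have sym: "?s w' = ?s w" if "w \<in> ?W" "mset w' = mset w" for w w'
    using fixed_symmetric[OF h that] .
  have tau_set: "set (map \<tau> u) \<subseteq> B 1" if "set u \<subseteq> B 1" for u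
    using that tau_basis(1) by auto
  have flip: "?s (map \<tau> u @ v) = ?s (u @ v)"
    if D: "D \<in> set_pmf P" "length u = decorated_size D" and uv: "u @ v \<in> ?W" for D u v
  proof -
    obtain x x' where x: "mset x = mset (u @ v)" "x' \<in> set (outcomes D x)" "mset x' = mset (map \<tau> u @ v)"
      using flipping_outcome[of u v D] D uv support[OF D(1)] by (auto simp: W_append)
    have xW: "x \<in> ?W" using uv x(1) by (metis (mono_tags, lifting) level_words_def mem_Collect_eq mset_eq_length mset_eq_setD)
    have x'W: "map \<tau> u @ v \<in> ?W" using uv tau_set by (simp add: W_append)
    have "?s (map \<tau> u @ v) = ?s x'" using sym[OF x'W x(3)] by simp
    also have "\<dots> = ?s x" by (rule fixed_outcome[OF h D(1) xW x(2)])
    also have "\<dots> = ?s (u @ v)" by (rule sym[OF uv x(1)])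
    finally show ?thesis .
  qed
  obtain D where D: "D \<in> set_pmf P" "odd (decorated_size D)"
    using mix False by (auto simp: decorations_mix_def)
  obtain D' where D': "D' \<in> set_pmf P" "0 < decorated_size D'" "decorated_size D' < n"
    using mix False by (auto simp: decorations_mix_def)
  have pair: "?s (\<tau> x # \<tau> y # q) = ?s (x # y # q)" if xy: "x # y # q \<in> ?W" for x y q
  proof -
    \<comment> \<open>The number of companions \<open>q1\<close> flipped along with one letter. They
      are flipped once with \<open>x\<close> and once back with \<open>\<tau> y\<close>, which
      leaves just \<open>x\<close> and \<open>y\<close> changed. Positive size makes room for
      \<open>x\<close>, size below \<open>n\<close> leaves \<open>y\<close> outside.\<close>
    define m where "m = decorated_size D' - 1"
    define q1 q2 where "q1 = take m q" "q2 = drop m q"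
    have q: "q = q1 @ q2" by (simp add: q1_q2_def)
    have len: "length q = n - 2" "n \<ge> 2" using xy by (auto simp: level_words_def)
    have m: "decorated_size D' = Suc m" "m \<le> length q" using D' len by (auto simp: m_def)
    then have lq: "length q1 = m" by (simp add: q1_q2_def)
    have sets: "x \<in> B 1" "y \<in> B 1" "set q1 \<subseteq> B 1" "set q2 \<subseteq> B 1" "length q1 + length q2 + 2 = n"
      using xy q by (auto simp: level_words_def)
    have tsets: "\<tau> x \<in> B 1" "\<tau> y \<in> B 1" "\<tau> (\<tau> y) = y" "set (map \<tau> q1) \<subseteq> B 1"
      using sets tau_basis tau_set by auto
    have "?s (x # y # q) = ?s ((x # q1) @ (y # q2))"
      by (rule sym[symmetric, OF xy]) (simp add: q)
    also have "\<dots> = ?s (map \<tau> (x # q1) @ (y # q2))"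
      using sets m lq by (intro flip[symmetric, OF D'(1)]) (auto simp: level_words_def)
    also have "\<dots> = ?s (map \<tau> (\<tau> y # q1) @ (\<tau> x # q2))"
      using sets tsets by (intro sym) (auto simp: level_words_def)
    also have "\<dots> = ?s ((\<tau> y # q1) @ (\<tau> x # q2))"
      using sets tsets m lq by (intro flip[OF D'(1)]) (auto simp: level_words_def)
    also have "\<dots> = ?s (\<tau> x # \<tau> y # q)"
      using sets tsets by (intro sym) (auto simp: q level_words_def)
    finally show ?thesis by simp
  qed
  have even: "?s (map \<tau> u @ q) = ?s (u @ q)" if "even (length u)" "u @ q \<in> ?W" for u q
    using that
  proof (induction u arbitrary: q rule: induct_list012)
    case (3 x y u)
    have W: "u @ x # y # q \<in> ?W" using 3(4) by (auto simp: level_words_def)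
    have W': "x # y # map \<tau> u @ q \<in> ?W" using 3(4) tau_set[of u] by (auto simp: level_words_def)
    have "?s (map \<tau> (x # y # u) @ q) = ?s (x # y # map \<tau> u @ q)"
      using pair[OF W'] by simp
    also have "\<dots> = ?s (map \<tau> u @ x # y # q)"
      by (rule sym[symmetric, OF W']) simp
    also have "\<dots> = ?s (u @ x # y # q)" using 3(1)[of "x # y # q"] 3(3) W by simp
    also have "\<dots> = ?s ((x # y # u) @ q)" by (rule sym[OF 3(4)]) simp
    finally show ?case .
  qed auto
  define m where "m = decorated_size D - 1"
  have m: "decorated_size D = Suc m" "even m" using D(2) by (auto simp: m_def elim: oddE)
  have "decorated_size D \<le> sum_list (forget_decorations D)"
    unfolding decorated_size_def forget_decorations_def by (induction D) auto
  then have mn: "Suc m \<le> n" using m support[OF D(1)] by simp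
  define r1 r2 where "r1 = take m r" "r2 = drop m r"
  have r: "r = r1 @ r2" by (simp add: r1_r2_def)
  have sets: "a \<in> B 1" "set r1 \<subseteq> B 1" "set r2 \<subseteq> B 1" "length r1 + length r2 + 1 = n"
    using w r by (auto simp: level_words_def)
  have lr: "length r1 = m" using w mn by (simp add: r1_r2_def level_words_def)
  have ta: "\<tau> a \<in> B 1" using sets tau_basis by auto
  have "?s (a # r) = ?s (map \<tau> (a # r1) @ r2)"
    using sets m lr r by (subst flip[OF D(1)]) (auto simp: level_words_def)
  also have "\<dots> = ?s (map \<tau> r1 @ \<tau> a # r2)"
    using sets ta tau_set[of r1] by (intro sym) (auto simp: level_words_def)
  also have "\<dots> = ?s (r1 @ \<tau> a # r2)"
    using sets ta m lr by (intro even) (auto simp: level_words_def)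
  also have "\<dots> = ?s (\<tau> a # r)"
    using sets ta by (intro sym) (auto simp: r level_words_def)
  finally show ?thesis by simp
qed

lemma fixed_orbit_invariant:
  assumes h: "h \<in> span (B n)" "averaged h = h" and mix: "decorations_mix B \<tau> n P"
    and w: "w \<in> level_words n" "w' \<in> level_words n"
    and eq: "mset (map orbit_average w) = mset (map orbit_average w')"
  shows "word_coef w h = word_coef w' h"
proof -
  let ?s = "\<lambda>w. word_coef w h"
  have letter: "?s (p @ a' # y) = ?s (p @ a # y)"
    if W: "p @ a # y \<in> level_words n" and a': "a' = a \<or> a' = \<tau> a" for p a a' y
  proof -
    have W1: "a # p @ y \<in> level_words n" and W2: "p @ a' # y \<in> level_words n"
      using W a' tau_basis(1) by (auto simp: level_words_def)
    have "?s (p @ a' # y) = ?s (a' # p @ y)"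
      by (rule fixed_symmetric[symmetric, OF h W2]) simp
    also have "\<dots> = ?s (a # p @ y)" using a' fixed_tau_invariant[OF h mix W1] by auto
    also have "\<dots> = ?s (p @ a # y)" by (rule fixed_symmetric[OF h W]) simp
    finally show ?thesis .
  qed
  have same: "?s (p @ v) = ?s (p @ u)"
    if "p @ u \<in> level_words n" "set v \<subseteq> B 1" "map orbit_average v = map orbit_average u" for p u v
    using that
  proof (induction u arbitrary: p v)
    case (Cons a u)
    then obtain b v' where v: "v = b # v'" "orbit_average b = orbit_average a"
      "map orbit_average v' = map orbit_average u" by (cases v) auto
    have ab: "a \<in> B 1" "b \<in> B 1" using Cons.prems v by (auto simp: level_words_def)
    then have "b = a \<or> b = \<tau> a" using orbit_average_eqD v(2) by metis
    then have "?s (p @ b # u) = ?s (p @ a # u)" using letter Cons.prems(1) by blast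
    moreover have "?s ((p @ [b]) @ v') = ?s ((p @ [b]) @ u)"
      using Cons.prems v ab by (intro Cons.IH) (auto simp: level_words_def)
    ultimately show ?case by (simp add: v(1))
  qed simp
  obtain p where p: "p permutes {..<length (map orbit_average w')}"
    "permute_list p (map orbit_average w') = map orbit_average w"
    using mset_eq_permutation[OF eq] .
  then have p': "p permutes {..<length w'}" by simp
  have "?s (permute_list p w') = ?s w"
    using same[of "[]" w "permute_list p w'"] w p(2) p'
    by (simp add: permute_list_map level_words_def)
  moreover have "?s (permute_list p w') = ?s w'"
    using p' by (intro fixed_symmetric[OF h w(2)]) simp
  ultimately show ?thesis by simp
qed

end

section \<open>Symmetrized products\<close>

lemma power_sum_eq_words:
  fixes f :: "'i \<Rightarrow> 'r::ring_1"
  assumes "finite S"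
  shows "(\<Sum>i\<in>S. f i) ^ k = (\<Sum>ks | set ks \<subseteq> S \<and> length ks = k. prod_list (map f ks))"
proof (induction k)
  case 0
  have "{ks. set ks \<subseteq> S \<and> length ks = 0} = {[]}" by auto
  then show ?case by simp
next
  case (Suc k)
  let ?X = "{ks. set ks \<subseteq> S \<and> length ks = k}"
  have inj: "inj_on (\<lambda>(i, ks). i # ks) (S \<times> ?X)" by (auto simp: inj_on_def)
  have "{ks. set ks \<subseteq> S \<and> length ks = Suc k} = (\<lambda>(i, ks). i # ks) ` (S \<times> ?X)"
    by (auto simp: image_iff length_Suc_conv)
  then have "(\<Sum>ks | set ks \<subseteq> S \<and> length ks = Suc k. prod_list (map f ks))
      = (\<Sum>i\<in>S. \<Sum>ks\<in>?X. f i * prod_list (map f ks))"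
    unfolding sum.cartesian_product by (auto simp: sum.reindex[OF inj] intro!: sum.cong)
  then show ?case
    by (simp add: Suc sum_distrib_left sum_distrib_right) (simp add: sum.swap[of _ S])
qed

text \<open>An index word as long as the list that uses every index uses each exactly once, so it is
  a permutation written out.\<close>

lemma sum_permutations_eq_words:
  "(\<Sum>\<sigma> | \<sigma> permutes {..<length cs}. prod_list (permute_list \<sigma> cs))
    = (\<Sum>ks | set ks = {..<length cs} \<and> length ks = length cs. prod_list (map ((!) cs) ks) :: 'r::ring_1)"
proof -
  let ?n = "length cs"
  let ?f = "\<lambda>\<sigma>. map \<sigma> [0..<?n]"
  have "inj_on ?f {\<sigma>. \<sigma> permutes {..<?n}}"
  proof (rule inj_onI, clarify)
    fix \<sigma> \<rho> assume *: "\<sigma> permutes {..<?n}" "\<rho> permutes {..<?n}" "?f \<sigma> = ?f \<rho>"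
    show "\<sigma> = \<rho>"
    proof
      fix i
      show "\<sigma> i = \<rho> i"
      proof (cases "i < ?n")
        case True
        then show ?thesis using *(3) by (auto simp: map_eq_conv)
      next
        case False
        then show ?thesis using *(1,2) by (auto simp: permutes_def)
      qed
    qed
  qed
  moreover have "?f ` {\<sigma>. \<sigma> permutes {..<?n}} = {ks. set ks = {..<?n} \<and> length ks = ?n}"
  proof (intro equalityI subsetI)
    fix ks assume "ks \<in> ?f ` {\<sigma>. \<sigma> permutes {..<?n}}"
    then show "ks \<in> {ks. set ks = {..<?n} \<and> length ks = ?n}"
      by (auto simp: permutes_image atLeast0LessThan)
  next
    fix ks assume "ks \<in> {ks. set ks = {..<?n} \<and> length ks = ?n}"
    then have ks: "set ks = {..<?n}" "length ks = ?n" by auto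
    then have "distinct ks" by (intro card_distinct) simp
    define \<sigma> where "\<sigma> i = (if i < ?n then ks ! i else i)" for i
    have "bij_betw ((!) ks) {..<?n} {..<?n}"
      by (rule bij_betw_nth[OF \<open>distinct ks\<close>]) (simp_all only: ks)
    then have "bij_betw \<sigma> {..<?n} {..<?n}"
      by (rule bij_betw_cong[THEN iffD1, rotated]) (simp add: \<sigma>_def)
    then have "\<sigma> permutes {..<?n}"
      by (rule bij_imp_permutes) (simp add: \<sigma>_def)
    moreover have "?f \<sigma> = ks" by (rule nth_equalityI) (auto simp: ks \<sigma>_def)
    ultimately show "ks \<in> ?f ` {\<sigma>. \<sigma> permutes {..<?n}}" by blast
  qed
  ultimately have bij: "bij_betw ?f {\<sigma>. \<sigma> permutes {..<?n}} {ks. set ks = {..<?n} \<and> length ks = ?n}"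
    by (simp add: bij_betw_def)
  show ?thesis
    unfolding sum.reindex_bij_betw[OF bij, symmetric] by (simp add: permute_list_def comp_def)
qed

text \<open>Polarization holds without commutativity, by inclusion-exclusion over the set of factors that
  occur.\<close>

lemma polarization:
  fixes cs :: "'r::ring_1 list"
  shows "(\<Sum>\<sigma> | \<sigma> permutes {..<length cs}. prod_list (permute_list \<sigma> cs))
    = (\<Sum>T\<in>Pow {..<length cs}. (- 1) ^ (length cs - card T) * (\<Sum>i\<in>T. cs ! i) ^ length cs)"
proof -
  let ?n = "length cs"
  \<comment> \<open>Collects the words whose set of indices is exactly \<open>S\<close>; summed over
    the subsets of a set it gives a power of a sum, which Moebius inversion turns around.\<close>
  define f where "f S = (\<Sum>ks | set ks = S \<and> length ks = ?n. prod_list (map ((!) cs) ks))" for S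
  have "f {..<?n} = (\<Sum>T\<in>Pow {..<?n}. (- 1) ^ (card {..<?n} - card T) * (\<Sum>i\<in>T. cs ! i) ^ ?n)"
  proof (rule inclusion_exclusion_mobius)
    fix S :: "nat set" assume S: "finite S"
    let ?X = "{ks. set ks \<subseteq> S \<and> length ks = ?n}"
    have "(\<Sum>T\<in>Pow S. \<Sum>ks | ks \<in> ?X \<and> set ks = T. prod_list (map ((!) cs) ks))
        = (\<Sum>ks\<in>?X. prod_list (map ((!) cs) ks))"
      using S by (intro sum.group finite_lists_length_eq) auto
    moreover have "{ks. ks \<in> ?X \<and> set ks = T} = {ks. set ks = T \<and> length ks = ?n}" if "T \<in> Pow S" for T
      using that by auto
    ultimately show "(\<Sum>i\<in>S. cs ! i) ^ ?n = sum f (Pow S)"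
      unfolding f_def power_sum_eq_words[OF S] by simp
  qed simp
  then show ?thesis by (simp add: f_def sum_permutations_eq_words)
qed

section \<open>Coproducts of products and powers of degree one elements\<close>

context graded_connected_hopf_algebra
begin

lemma contract_degree_one:
  assumes "c \<in> span (B 1)" "a \<in> B 1"
  shows "contract a c = coef B c a *\<^sub>R 1"
proof -
  have "contract a c \<in> span (B 0)" using contract_graded(1)[OF assms] by simp
  then obtain r where r: "contract a c = r *\<^sub>R 1" unfolding connected by (auto simp: span_singleton)
  have "coef B c a = \<epsilon> (contract a c)" by (simp add: counit_contract)
  also have "\<dots> = r" by (simp add: r linear_scale[OF linear_counit] counit_one)
  finally show ?thesis by (simp add: r)
qed

text \<open>A product of two elements of positive degree has degree at least 2 and so has no
  component along \<open>a\<close>: the mixed terms of \<open>contract_mult_positive\<close>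
  vanish.\<close>

lemma contract_derivation:
  assumes a: "a \<in> B 1"
  shows "contract a (g * h) = contract a g * h + g * contract a h"
proof -
  let ?X = "{x. contract x g \<noteq> 0} \<inter> positive_basis" and ?Y = "{x. contract x h \<noteq> 0} \<inter> positive_basis"
  have "coef B (x * y) a = 0" if "x \<in> positive_basis" "y \<in> positive_basis" for x y
  proof -
    have "x * y \<in> span (B (deg x + deg y))"
      using that by (intro graded_mult span_base) (auto simp: positive_basis_iff)
    moreover have "a \<notin> B (deg x + deg y)"
      using basis_degree_unique[OF a, of "deg x + deg y"] that by (auto simp: positive_basis_iff)
    ultimately show ?thesis by (rule coef_graded)
  qed
  then have "(\<Sum>x\<in>?X. \<Sum>y\<in>?Y. coef B (x * y) a *\<^sub>R (contract x g * contract y h)) = 0"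
    by (intro sum.neutral ballI) auto
  moreover have "contract a (g * h) = contract a g * h + g * contract a h
      + (\<Sum>x\<in>?X. \<Sum>y\<in>?Y. coef B (x * y) a *\<^sub>R (contract x g * contract y h))"
    using a finite_contract by (intro contract_mult_positive) (auto intro: positive_basisI)
  ultimately show ?thesis by simp
qed

lemma contract_prod_list:
  assumes "a \<in> B 1" "set cs \<subseteq> span (B 1)"
  shows "contract a (prod_list cs)
    = (\<Sum>i<length cs. coef B (cs ! i) a *\<^sub>R prod_list (take i cs @ drop (Suc i) cs))"
  using assms(2)
proof (induction cs)
  case Nil
  then show ?case using assms(1) by (simp add: contract_one positive_basisI)
next
  case (Cons c cs)
  then show ?case
    using assms(1) by (simp add: contract_derivation contract_degree_one sum.lessThan_Suc_shift
        sum_distrib_left mult.assoc del: sum.lessThan_Suc)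
qed

lemma contract_degree_zero:
  assumes "u \<in> B 0"
  shows "contract u h = coef B 1 u *\<^sub>R h"
proof -
  obtain b \<beta> where b: "B 0 = {b}" "b = \<beta> *\<^sub>R 1" "\<beta> \<noteq> 0" "\<epsilon> b = \<beta>"
    by (rule basis_zero)
  have "contract b h = (1 / \<beta>) *\<^sub>R (\<beta> *\<^sub>R contract b h)" using b(3) by simp
  also have "\<beta> *\<^sub>R contract b h = h" using contract_unit[of b h] b by simp
  finally have "contract b h = (1 / \<beta>) *\<^sub>R h" .
  moreover have "coef B 1 b = 1 / \<beta>"
  proof -
    have "(1 :: 'h) = (1 / \<beta>) *\<^sub>R b" using b(2,3) by simp
    then have "coef B 1 b = 1 / \<beta> * coef B b b" by (metis coef_scale real_scaleR_def)
    moreover have "b \<in> basis" using b(1) by blast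
    ultimately show ?thesis by (simp only: coef_basis) simp
  qed
  ultimately show ?thesis using assms b(1) by simp
qed

text \<open>Degree one elements are primitive. The factor \<open>c\<close> goes either to the second
  tensor factor, giving the first term, or to the first one, where it must combine with some
  \<open>y\<close> to yield \<open>u\<close>.\<close>

lemma contract_degree_one_mult:
  assumes c: "c \<in> span (B 1)" and u: "u \<in> B d"
  shows "contract u (c * h)
    = c * contract u h + (if d = 0 then 0 else (\<Sum>y\<in>B (d - 1). coef B (c * y) u *\<^sub>R contract y h))"
proof -
  obtain b \<beta> where b: "B 0 = {b}" "b = \<beta> *\<^sub>R 1" "\<beta> \<noteq> 0" "\<epsilon> b = \<beta>"
    by (rule basis_zero)
  define Y where "Y = {y. contract y h \<noteq> 0} \<union> B d \<union> B (d - 1)"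
  have finY: "finite Y" unfolding Y_def using finite_contract finite_basis by auto
  have bB: "b \<notin> B 1" using b(1) basis_degree_unique[of b 0 1] by auto
  have c_zero: "contract x c = 0" if "x \<notin> insert b (B 1)" for x
  proof (cases "x \<in> basis")
    case True
    then obtain k where "x \<in> B k" by auto
    moreover have "k > 1"
      using \<open>x \<in> B k\<close> that b(1) by (cases "k = 0"; cases "k = 1") auto
    ultimately show ?thesis using contract_graded(2)[OF c] by blast
  qed (rule contract_outside)
  have "contract u (c * h) = (\<Sum>x\<in>insert b (B 1). \<Sum>y\<in>Y. coef B (x * y) u *\<^sub>R (contract x c * contract y h))"
    using finY finite_basis c_zero by (intro contract_mult) (auto simp: Y_def)
  also have "\<dots> = (\<Sum>y\<in>Y. coef B (b * y) u *\<^sub>R (contract b c * contract y h))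
      + (\<Sum>x\<in>B 1. \<Sum>y\<in>Y. coef B (x * y) u *\<^sub>R (contract x c * contract y h))"
    using bB finite_basis by simp
  also have "(\<Sum>y\<in>Y. coef B (b * y) u *\<^sub>R (contract b c * contract y h)) = c * contract u h"
  proof -
    have bc: "\<beta> *\<^sub>R contract b c = c" using contract_unit[of b c] b by simp
    have "(\<Sum>y\<in>Y. coef B (b * y) u *\<^sub>R (contract b c * contract y h))
        = (\<Sum>y\<in>Y. if y = u then c * contract y h else 0)"
    proof (rule sum.cong[OF refl])
      fix y assume "y \<in> Y"
      then have "y \<in> basis" unfolding Y_def using contract_outside by blast
      have "coef B (b * y) u *\<^sub>R (contract b c * contract y h)
          = coef B y u *\<^sub>R ((\<beta> *\<^sub>R contract b c) * contract y h)"
        by (simp add: b(2) coef_scale mult.commute)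
      then show "coef B (b * y) u *\<^sub>R (contract b c * contract y h) = (if y = u then c * contract y h else 0)"
        unfolding bc coef_basis[OF \<open>y \<in> basis\<close>] by simp
    qed
    then show ?thesis using finY u by (simp add: Y_def sum.delta)
  qed
  also have "(\<Sum>x\<in>B 1. \<Sum>y\<in>Y. coef B (x * y) u *\<^sub>R (contract x c * contract y h))
      = (\<Sum>y\<in>Y. coef B (c * y) u *\<^sub>R contract y h)"
  proof (subst sum.swap, rule sum.cong[OF refl])
    fix y
    have "coef B (c * y) u = coef B ((\<Sum>x\<in>B 1. coef B c x *\<^sub>R x) * y) u"
      using graded_expansion[OF c] by simp
    also have "\<dots> = (\<Sum>x\<in>B 1. coef B c x * coef B (x * y) u)"
      by (simp add: sum_distrib_right coef_sum coef_scale)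
    finally have "coef B (c * y) u *\<^sub>R contract y h
        = (\<Sum>x\<in>B 1. (coef B c x * coef B (x * y) u) *\<^sub>R contract y h)"
      by (simp add: scaleR_sum_left)
    also have "\<dots> = (\<Sum>x\<in>B 1. coef B (x * y) u *\<^sub>R (contract x c * contract y h))"
      using contract_degree_one[OF c] by (intro sum.cong) (auto simp: mult.commute)
    finally show "(\<Sum>x\<in>B 1. coef B (x * y) u *\<^sub>R (contract x c * contract y h))
        = coef B (c * y) u *\<^sub>R contract y h" ..
  qed
  also have "(\<Sum>y\<in>Y. coef B (c * y) u *\<^sub>R contract y h)
      = (if d = 0 then 0 else (\<Sum>y\<in>B (d - 1). coef B (c * y) u *\<^sub>R contract y h))"
  proof -
    have zero: "coef B (c * y) u = 0" if "y \<in> B k" "Suc k \<noteq> d" for y k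
    proof -
      have "c * y \<in> span (B (1 + k))" by (rule graded_mult[OF c span_base[OF that(1)]])
      moreover have "u \<notin> B (1 + k)" using u that(2) basis_degree_unique[of u d "1 + k"] by auto
      ultimately show ?thesis by (rule coef_graded)
    qed
    have basis: "\<exists>k. y \<in> B k" if "y \<in> Y" for y
      using that contract_outside[of y h] unfolding Y_def by auto
    show ?thesis
    proof (cases "d = 0")
      case True
      then show ?thesis using zero basis by (intro sum.neutral[THEN trans]) fastforce+
    next
      case False
      have "(\<Sum>y\<in>Y. coef B (c * y) u *\<^sub>R contract y h) = (\<Sum>y\<in>B (d - 1). coef B (c * y) u *\<^sub>R contract y h)"
      proof (rule sum.mono_neutral_right[OF finY])
        show "B (d - 1) \<subseteq> Y" by (auto simp: Y_def)
        show "\<forall>y\<in>Y - B (d - 1). coef B (c * y) u *\<^sub>R contract y h = 0"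
        proof
          fix y assume y: "y \<in> Y - B (d - 1)"
          then obtain k where k: "y \<in> B k" using basis by blast
          then have "Suc k \<noteq> d" using y by auto
          then show "coef B (c * y) u *\<^sub>R contract y h = 0" using zero[OF k] by simp
        qed
      qed
      then show ?thesis using False by simp
    qed
  qed
  finally show ?thesis .
qed

lemma power_graded: "c \<in> span (B 1) \<Longrightarrow> c ^ k \<in> span (B k)"
  using graded_mult[of c 1] one_graded by (induction k) auto

text \<open>The binomial theorem for the coproduct of \<open>c\<close>, whose two summands commute
  in the tensor square: the part of bidegree \<open>d\<close> and \<open>k - d\<close> is the
  binomial multiple of \<open>c ^ d\<close> tensored with \<open>c ^ (k - d)\<close>. For
  \<open>d > k\<close> both sides vanish.\<close>

lemma contract_power:
  assumes c: "c \<in> span (B 1)" and u: "u \<in> B d"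
  shows "contract u (c ^ k) = (real (k choose d) * coef B (c ^ d) u) *\<^sub>R c ^ (k - d)"
  using u
proof (induction k arbitrary: u d)
  case 0
  then show ?case
    using contract_degree_zero[of u 1] contract_graded(2)[OF one_graded, of u d] by (cases d) auto
next
  case (Suc k)
  show ?case
  proof (cases d)
    case 0
    then show ?thesis using contract_degree_zero Suc.prems by simp
  next
    case (Suc e)
    have mult: "real (k choose d) *\<^sub>R (c * c ^ (k - d)) = real (k choose d) *\<^sub>R c ^ (k - e)"
    proof (cases "d \<le> k")
      case True
      then have "k - e = Suc (k - d)" using Suc by simp
      then show ?thesis by simp
    qed (simp add: binomial_eq_0)
    have "contract u (c ^ Suc k) = c * contract u (c ^ k)
        + (\<Sum>y\<in>B e. coef B (c * y) u *\<^sub>R contract y (c ^ k))"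
      using contract_degree_one_mult[OF c Suc.prems, of "c ^ k"] Suc by simp
    also have "c * contract u (c ^ k) = coef B (c ^ d) u *\<^sub>R real (k choose d) *\<^sub>R (c * c ^ (k - d))"
      by (simp add: Suc.IH[OF Suc.prems] mult.commute)
    also have "\<dots> = (real (k choose d) * coef B (c ^ d) u) *\<^sub>R c ^ (k - e)"
      unfolding mult by (simp add: mult.commute)
    also have "(\<Sum>y\<in>B e. coef B (c * y) u *\<^sub>R contract y (c ^ k))
        = (\<Sum>y\<in>B e. (coef B (c ^ e) y * coef B (c * y) u) *\<^sub>R real (k choose e) *\<^sub>R c ^ (k - e))"
      by (intro sum.cong refl) (simp add: Suc.IH mult.commute mult.left_commute)
    also have "\<dots> = coef B (c * (\<Sum>y\<in>B e. coef B (c ^ e) y *\<^sub>R y)) u *\<^sub>R real (k choose e) *\<^sub>R c ^ (k - e)"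
      unfolding scaleR_sum_left[symmetric] by (simp add: sum_distrib_left coef_sum coef_scale)
    also have "\<dots> = (real (k choose e) * coef B (c ^ d) u) *\<^sub>R c ^ (k - e)"
      unfolding graded_expansion[OF power_graded[OF c]] using Suc by (simp add: mult.commute)
    finally show ?thesis
      by (simp add: Suc scaleR_left_distrib distrib_right add.commute)
  qed
qed

end

section \<open>Powers as eigenvectors, and word coefficients of symmetrized products\<close>

context hopf_involution
begin

lemma tau_power: "\<tau> c = c \<Longrightarrow> \<tau> (c ^ k) = c ^ k"
proof (induction k)
  case (Suc k)
  then show ?case
    using ambimorphism power_commutes[of c k]
    by (auto simp: hopf_ambimorphism_def algebra_morphism_def algebra_antimorphism_def)
qed (simp add: tau_one)

text \<open>Each part cuts off a power of \<open>c\<close>, which a morphism and an antimorphism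
  both fix when \<open>\<tau> c = c\<close>; the remaining binomial factors multiply up to the
  multinomial coefficient.\<close>

lemma descent_op_power:
  assumes c: "c \<in> span (B 1)" "\<tau> c = c" and "sum_list (forget_decorations D) = k"
  shows "descent_op D (c ^ k) = multinomial (forget_decorations D) *\<^sub>R c ^ k"
  using assms(3)
proof (induction D arbitrary: k)
  case Nil
  then show ?case by (simp add: forget_decorations_def counit_one multinomial_Nil)
next
  case (Cons d D)
  let ?e = "fst d" and ?E = "forget_decorations D"
  have k: "k = ?e + sum_list ?E" using Cons.prems by (simp add: forget_decorations_def)
  have "descent_op (d # D) (c ^ k) = (\<Sum>u\<in>B ?e. (if decorated d then \<tau> u else u) *
      ((real (k choose ?e) * coef B (c ^ ?e) u) *\<^sub>R multinomial ?E *\<^sub>R c ^ (k - ?e)))"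
    unfolding descent_op.simps using k
    by (intro sum.cong refl) (simp add: contract_power[OF c(1)] linear_scale[OF linear_descent_op] Cons.IH)
  also have "\<dots> = (\<Sum>u\<in>B ?e. coef B (c ^ ?e) u *\<^sub>R (if decorated d then \<tau> u else u)) *
      ((real (k choose ?e) * multinomial ?E) *\<^sub>R c ^ (k - ?e))"
    unfolding sum_distrib_right by (intro sum.cong refl) (simp add: mult.commute mult.left_commute)
  also have "(\<Sum>u\<in>B ?e. coef B (c ^ ?e) u *\<^sub>R (if decorated d then \<tau> u else u)) = c ^ ?e"
  proof (cases "decorated d")
    case True
    have "(\<Sum>u\<in>B ?e. coef B (c ^ ?e) u *\<^sub>R \<tau> u) = \<tau> (\<Sum>u\<in>B ?e. coef B (c ^ ?e) u *\<^sub>R u)"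
      by (simp add: linear_sum[OF linear_tau] linear_scale[OF linear_tau])
    then show ?thesis
      using True graded_expansion[OF power_graded[OF c(1)]] tau_power[OF c(2)] by simp
  qed (use graded_expansion[OF power_graded[OF c(1)]] in simp)
  also have "c ^ ?e * ((real (k choose ?e) * multinomial ?E) *\<^sub>R c ^ (k - ?e))
      = multinomial (forget_decorations (d # D)) *\<^sub>R c ^ k"
    using k by (simp add: multinomial_Cons forget_decorations_def power_add)
  finally show ?case .
qed

definition symmetrized :: "'h list \<Rightarrow> 'h" where
  "symmetrized cs = (\<Sum>\<sigma> | \<sigma> permutes {..<length cs}. prod_list (permute_list \<sigma> cs))"

lemma prod_list_graded: "set cs \<subseteq> span (B 1) \<Longrightarrow> prod_list cs \<in> span (B (length cs))"
  using graded_mult[of _ 1] one_graded by (induction cs) auto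

lemma symmetrized_graded:
  assumes "set cs \<subseteq> span (B 1)"
  shows "symmetrized cs \<in> span (B (length cs))"
  unfolding symmetrized_def
proof (rule span_sum)
  fix \<sigma> assume "\<sigma> \<in> {\<sigma>. \<sigma> permutes {..<length cs}}"
  then have "\<sigma> permutes {..<length cs}" by simp
  then show "prod_list (permute_list \<sigma> cs) \<in> span (B (length cs))"
    using prod_list_graded[of "permute_list \<sigma> cs"] assms by simp
qed

lemma eta_eq_sum: "eta B \<Delta> \<epsilon> k h = (\<Sum>w\<in>level_words k. word_coef w h)"
proof -
  have "list_all2 (\<lambda>u e. u \<in> B e) w (replicate k 1)" if "length w = k" "set w \<subseteq> B 1" for w
    using that by (auto simp: list_all2_conv_all_nth subset_iff)
  then show ?thesis
    unfolding eta_def level_words_def by (intro sum.cong) (auto simp: refined_coproduct_def iter_coproduct_eq)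
qed

lemma linear_eta: "linear (eta B \<Delta> \<epsilon> k)"
  unfolding eta_eq_sum[abs_def] by (intro linear_compose_sum ballI linear_word_coef)

lemma eta_Suc: "eta B \<Delta> \<epsilon> (Suc k) h = (\<Sum>a\<in>B 1. eta B \<Delta> \<epsilon> k (contract a h))"
  unfolding eta_eq_sum sum_level_words_Suc word_coef_Cons ..

text \<open>Contracting with a degree one letter deletes one factor in all possible ways. Summed
  over the letters each deletion has weight 1, since the coordinates of an orbit average sum to 1,
  so only the orders of deletion are counted.\<close>

lemma eta_prod_list:
  "set cs \<subseteq> orbit_average ` B 1 \<Longrightarrow> eta B \<Delta> \<epsilon> (length cs) (prod_list cs) = fact (length cs)"
proof (induction "length cs" arbitrary: cs)
  case 0
  then show ?case by (simp add: eta_eq_sum level_words_0 word_coef_Nil counit_one)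
next
  case (Suc k)
  have graded: "set cs \<subseteq> span (B 1)" using Suc.prems orbit_average_graded by blast
  let ?del = "\<lambda>i. take i cs @ drop (Suc i) cs"
  have IH: "eta B \<Delta> \<epsilon> k (prod_list (?del i)) = fact k" if "i < length cs" for i
  proof -
    have "length (?del i) = k" using that Suc(2) by simp
    moreover have "set (?del i) \<subseteq> orbit_average ` B 1"
      using Suc.prems set_take_subset set_drop_subset by fastforce
    ultimately show ?thesis using Suc(1)[of "?del i"] by simp
  qed
  have "eta B \<Delta> \<epsilon> (Suc k) (prod_list cs) = (\<Sum>a\<in>B 1. \<Sum>i<length cs. coef B (cs ! i) a * fact k)"
    unfolding eta_Suc
    by (intro sum.cong refl) (simp add: contract_prod_list[OF _ graded] linear_sum[OF linear_eta]
        linear_scale[OF linear_eta] IH del: prod_list.append)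
  also have "\<dots> = (\<Sum>i<length cs. (\<Sum>a\<in>B 1. coef B (cs ! i) a) * fact k)"
    by (subst sum.swap) (simp add: sum_distrib_right)
  also have "\<dots> = (\<Sum>i<length cs. fact k)"
  proof (rule sum.cong[OF refl])
    fix i assume "i \<in> {..<length cs}"
    then have "cs ! i \<in> orbit_average ` B 1" using Suc.prems nth_mem[of i cs] by auto
    then obtain b where "b \<in> B 1" "cs ! i = orbit_average b" by blast
    then show "(\<Sum>a\<in>B 1. coef B (cs ! i) a) * fact k = fact k" using sum_coef_orbit_average by simp
  qed
  finally show ?case using Suc(2)[symmetric] by simp
qed

text \<open>The coefficient is a sum over matchings of letters with factors, each weighted by a
  product of nonnegative coordinates. A weight is positive exactly when every letter is matched with
  its own orbit average.\<close>

lemma word_coef_prod_list: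
  assumes "set cs \<subseteq> orbit_average ` B 1" "length w = length cs" "set w \<subseteq> B 1"
  shows "word_coef w (prod_list cs) \<ge> 0"
    and "word_coef w (prod_list cs) > 0 \<longleftrightarrow> mset (map orbit_average w) = mset cs"
proof -
  have "word_coef w (prod_list cs) \<ge> 0 \<and>
      (word_coef w (prod_list cs) > 0 \<longleftrightarrow> mset (map orbit_average w) = mset cs)"
    using assms
  proof (induction w arbitrary: cs)
    case Nil
    then show ?case by (simp add: word_coef_Nil counit_one)
  next
    case (Cons a w)
    let ?del = "\<lambda>i. take i cs @ drop (Suc i) cs"
    have graded: "set cs \<subseteq> span (B 1)" using Cons.prems orbit_average_graded by blast
    have a: "a \<in> B 1" and w: "set w \<subseteq> B 1" using Cons.prems by auto
    have eq: "word_coef (a # w) (prod_list cs)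
        = (\<Sum>i<length cs. coef B (cs ! i) a * word_coef w (prod_list (?del i)))"
      by (simp add: word_coef_Cons contract_prod_list[OF a graded] word_coef_sum word_coef_scale)
    have del: "word_coef w (prod_list (?del i)) \<ge> 0 \<and>
        (word_coef w (prod_list (?del i)) > 0 \<longleftrightarrow> mset (map orbit_average w) = mset (?del i))"
      if "i < length cs" for i
    proof (rule Cons.IH)
      show "set (?del i) \<subseteq> orbit_average ` B 1"
        using Cons.prems(1) set_take_subset set_drop_subset by fastforce
    qed (use that Cons.prems(2) w in auto)
    have mset_del: "mset cs = add_mset (cs ! i) (mset (?del i))" if "i < length cs" for i
      using id_take_nth_drop[OF that] by (metis mset_append mset.simps(2) union_mset_add_mset_right)
    have c: "coef B (cs ! i) a \<ge> 0" "coef B (cs ! i) a > 0 \<longleftrightarrow> orbit_average a = cs ! i"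
      if i: "i < length cs" for i
    proof -
      obtain b where "b \<in> B 1" "cs ! i = orbit_average b"
        using Cons.prems(1) nth_mem[OF i] by fastforce
      then show "coef B (cs ! i) a \<ge> 0" "coef B (cs ! i) a > 0 \<longleftrightarrow> orbit_average a = cs ! i"
        using coef_orbit_average_nonneg[OF a] coef_orbit_average_pos_iff[OF a] by simp_all
    qed
    have nonneg: "coef B (cs ! i) a * word_coef w (prod_list (?del i)) \<ge> 0" if "i < length cs" for i
      using c(1)[OF that] del[OF that] by simp
    have pos: "coef B (cs ! i) a * word_coef w (prod_list (?del i)) > 0
        \<longleftrightarrow> orbit_average a = cs ! i \<and> mset (map orbit_average (a # w)) = mset cs"
      if "i < length cs" for i
      using c[OF that] del[OF that] mset_del[OF that] by (auto simp: zero_less_mult_iff)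
    have "word_coef (a # w) (prod_list cs) \<ge> 0"
      unfolding eq using nonneg by (intro sum_nonneg) auto
    moreover have "word_coef (a # w) (prod_list cs) > 0 \<longleftrightarrow> mset (map orbit_average (a # w)) = mset cs"
    proof
      assume "word_coef (a # w) (prod_list cs) > 0"
      then obtain i where "i < length cs" "coef B (cs ! i) a * word_coef w (prod_list (?del i)) \<noteq> 0"
        unfolding eq by (metis (no_types, lifting) lessThan_iff less_irrefl sum.neutral)
      then show "mset (map orbit_average (a # w)) = mset cs"
        using nonneg[of i] pos[of i] by (metis less_le)
    next
      assume m: "mset (map orbit_average (a # w)) = mset cs"
      then have "orbit_average a \<in> set cs" by (metis list.set_intros(1) list.simps(9) mset_eq_setD)
      then obtain i where i: "i < length cs" "orbit_average a = cs ! i" by (auto simp: in_set_conv_nth)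
      then show "word_coef (a # w) (prod_list cs) > 0"
        unfolding eq using nonneg pos[OF i(1)] m by (intro sum_pos2[of _ i]) auto
    qed
    ultimately show ?case ..
  qed
  then show "word_coef w (prod_list cs) \<ge> 0"
    "word_coef w (prod_list cs) > 0 \<longleftrightarrow> mset (map orbit_average w) = mset cs" by auto
qed

text \<open>Different multisets give disjoint supports among words of degree one letters. This
  yields linear independence and allows each coefficient of a combination to be read off at a single
  word.\<close>

lemma word_coef_symmetrized:
  assumes "set cs \<subseteq> orbit_average ` B 1" "length w = length cs" "set w \<subseteq> B 1"
  shows "mset (map orbit_average w) = mset cs \<Longrightarrow> word_coef w (symmetrized cs) > 0"
    and "mset (map orbit_average w) \<noteq> mset cs \<Longrightarrow> word_coef w (symmetrized cs) = 0"
proof -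
  let ?p = "\<lambda>\<sigma>. word_coef w (prod_list (permute_list \<sigma> cs))"
  have eq: "word_coef w (symmetrized cs) = (\<Sum>\<sigma> | \<sigma> permutes {..<length cs}. ?p \<sigma>)"
    by (simp add: symmetrized_def word_coef_sum)
  have p: "?p \<sigma> \<ge> 0" "?p \<sigma> > 0 \<longleftrightarrow> mset (map orbit_average w) = mset cs"
    if "\<sigma> permutes {..<length cs}" for \<sigma>
    using word_coef_prod_list[of "permute_list \<sigma> cs" w] assms that by simp_all
  show "word_coef w (symmetrized cs) > 0" if "mset (map orbit_average w) = mset cs"
    unfolding eq using p that permutes_id[of "{..<length cs}"] finite_permutations[of "{..<length cs}"]
    by (intro sum_pos2[of _ id]) (auto simp del: permute_list_id)
  show "word_coef w (symmetrized cs) = 0" if "mset (map orbit_average w) \<noteq> mset cs"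
    unfolding eq
  proof (rule sum.neutral, safe)
    fix \<sigma> assume "\<sigma> permutes {..<length cs}"
    from p[OF this] that show "?p \<sigma> = 0" by linarith
  qed
qed

text \<open>The origin of the squared factorial in \<open>pi_list\<close>: one factorial counts the
  permutations, the other is the value of \<open>eta\<close> on each product.\<close>

lemma eta_symmetrized:
  assumes "set cs \<subseteq> orbit_average ` B 1"
  shows "eta B \<Delta> \<epsilon> (length cs) (symmetrized cs) = (fact (length cs))\<^sup>2"
proof -
  have "eta B \<Delta> \<epsilon> (length cs) (prod_list (permute_list \<sigma> cs)) = fact (length cs)"
    if "\<sigma> permutes {..<length cs}" for \<sigma>
    using eta_prod_list[of "permute_list \<sigma> cs"] that assms by simp
  then show ?thesis
    by (simp add: symmetrized_def linear_sum[OF linear_eta] card_permutations[of _ "length cs"] power2_eq_square)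
qed

end

context hopf_chain
begin

lemma averaged_power:
  assumes "c \<in> span (B 1)" "\<tau> c = c"
  shows "averaged (c ^ n) = c ^ n"
proof (rule coef_eqI)
  fix b
  have "coef B (averaged (c ^ n)) b = measure_pmf.expectation P (\<lambda>D. coef B (c ^ n) b)"
    unfolding linear_averaged_functional[OF linear_coef]
  proof (rule integral_cong_AE)
    have "coef B (descent_op D (c ^ n)) b / multinomial (forget_decorations D) = coef B (c ^ n) b"
      if "D \<in> set_pmf P" for D
      using descent_op_power[OF assms support[OF that]] multinomial_pos[of "forget_decorations D"]
      by (simp add: coef_scale)
    then show "AE D in measure_pmf P.
        coef B (descent_op D (c ^ n)) b / multinomial (forget_decorations D) = coef B (c ^ n) b"
      by (simp add: AE_measure_pmf_iff)
  qed auto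
  then show "coef B (averaged (c ^ n)) b = coef B (c ^ n) b" by simp
qed

text \<open>Polarization reduces the claim to powers of partial sums of \<open>cs\<close>, which are
  again \<open>\<tau>\<close>-invariant elements of degree 1.\<close>

lemma averaged_symmetrized:
  assumes "set cs \<subseteq> orbit_average ` B 1" "length cs = n"
  shows "averaged (symmetrized cs) = symmetrized cs"
proof -
  have scale: "(- 1) ^ k * x = (- 1) ^ k *\<^sub>R x" for k and x :: 'h
    by (cases "even k") auto
  have "averaged ((\<Sum>i\<in>T. cs ! i) ^ n) = (\<Sum>i\<in>T. cs ! i) ^ n" if "T \<in> Pow {..<n}" for T
  proof -
    have "cs ! i \<in> span (B 1)" "\<tau> (cs ! i) = cs ! i" if i: "i \<in> T" for i
    proof -
      have "cs ! i \<in> orbit_average ` B 1"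
        using assms \<open>T \<in> Pow {..<n}\<close> i nth_mem[of i cs] by (meson PowD lessThan_iff subset_iff)
      then obtain b where "b \<in> B 1" "cs ! i = orbit_average b" by blast
      then show "cs ! i \<in> span (B 1)" "\<tau> (cs ! i) = cs ! i"
        using orbit_average_graded tau_orbit_average by simp_all
    qed
    then show ?thesis
      by (intro averaged_power) (auto intro: span_sum simp: linear_sum[OF linear_tau])
  qed
  then show ?thesis
    unfolding symmetrized_def polarization scale
    by (simp add: linear_sum[OF linear_averaged] linear_scale[OF linear_averaged] assms(2))
qed

end

section \<open>Stationary distributions\<close>

lemma sum_eq_imp_eq:
  fixes f g :: "'a \<Rightarrow> real"
  assumes "finite X" "\<And>x. x \<in> X \<Longrightarrow> f x \<le> g x" "sum f X = sum g X" "x \<in> X"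
  shows "f x = g x"
proof -
  have "(\<Sum>x\<in>X. g x - f x) = 0" using assms(3) by (simp add: sum_subtractf)
  then show ?thesis using assms by (subst (asm) sum_nonneg_eq_0_iff) auto
qed

text \<open>The triangle inequality bounds the absolute value by its image under the chain; rows of
  sum 1 give both the same total mass, so the inequality is an equality everywhere.\<close>

lemma stationary_abs:
  assumes "finite S" and nonneg: "\<And>x y. \<lbrakk>x \<in> S; y \<in> S\<rbrakk> \<Longrightarrow> K x y \<ge> 0"
    and rows: "\<And>x. x \<in> S \<Longrightarrow> (\<Sum>y\<in>S. K x y) = 1"
    and "stationary S K \<pi>"
  shows "stationary S K (\<lambda>x. \<bar>\<pi> x\<bar>)"
  unfolding stationary_def
proof
  fix y assume y: "y \<in> S"
  have "\<bar>\<pi> y\<bar> = (\<Sum>x\<in>S. \<bar>\<pi> x\<bar> * K x y)"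
  proof (rule sum_eq_imp_eq[of S, OF assms(1) _ _ y])
    fix y assume y: "y \<in> S"
    have "\<bar>\<pi> y\<bar> = \<bar>\<Sum>x\<in>S. \<pi> x * K x y\<bar>" using assms(4) y by (simp add: stationary_def)
    also have "\<dots> \<le> (\<Sum>x\<in>S. \<bar>\<pi> x * K x y\<bar>)" by (rule sum_abs)
    also have "\<dots> = (\<Sum>x\<in>S. \<bar>\<pi> x\<bar> * K x y)"
      using nonneg y by (intro sum.cong) (auto simp: abs_mult)
    finally show "\<bar>\<pi> y\<bar> \<le> (\<Sum>x\<in>S. \<bar>\<pi> x\<bar> * K x y)" .
  next
    show "(\<Sum>y\<in>S. \<bar>\<pi> y\<bar>) = (\<Sum>y\<in>S. \<Sum>x\<in>S. \<bar>\<pi> x\<bar> * K x y)"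
      by (subst sum.swap) (simp add: sum_distrib_left[symmetric] rows)
  qed
  then show "(\<Sum>x\<in>S. \<bar>\<pi> x\<bar> * K x y) = \<bar>\<pi> y\<bar>" ..
qed

context hopf_involution
begin

lemma index_multisets_word:
  assumes "C \<in> index_multisets B \<tau> k"
  shows "\<exists>w\<in>level_words k. mset (map orbit_average w) = C"
proof -
  obtain cs where cs: "mset cs = C" using ex_mset by blast
  then have "set cs \<subseteq> orbit_average ` B 1" "length cs = k"
    using assms unfolding index_multisets_def index_set_eq by auto
  then have "\<forall>c\<in>set cs. \<exists>b\<in>B 1. c = orbit_average b" by auto
  then obtain f where f: "\<And>c. c \<in> set cs \<Longrightarrow> f c \<in> B 1 \<and> c = orbit_average (f c)" by metis
  define w where "w = map f cs"
  have "cs = map orbit_average w" unfolding w_def map_map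
    using f by (intro map_idI[symmetric]) (metis comp_apply)
  moreover have "set w \<subseteq> B 1" using f by (auto simp: w_def)
  ultimately show ?thesis using cs \<open>length cs = k\<close> by (auto simp: level_words_def)
qed

lemma level_word_index:
  "w \<in> level_words k \<Longrightarrow> mset (map orbit_average w) \<in> index_multisets B \<tau> k"
  unfolding index_multisets_def index_set_eq by (auto simp: level_words_def)

lemma finite_index_multisets: "finite (index_multisets B \<tau> k)"
proof (rule finite_subset)
  show "index_multisets B \<tau> k \<subseteq> (\<lambda>w. mset (map orbit_average w)) ` level_words k"
    using index_multisets_word by blast
qed (simp add: finite_level_words)

lemma symmetrized_orbit_averages_graded:
  "set cs \<subseteq> orbit_average ` B 1 \<Longrightarrow> symmetrized cs \<in> span (B (length cs))"
  using orbit_average_graded by (intro symmetrized_graded) blast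

lemma pi_fun_eq:
  "pi_fun B \<Delta> \<epsilon> (mset cs) x
    = eta B \<Delta> \<epsilon> (length cs) x / (fact (length cs))\<^sup>2 * coef B (symmetrized cs) x"
  by (simp add: pi_fun_mset pi_list_def symmetrized_def coef_sum)

lemma sum_pi_fun:
  assumes "C \<in> index_multisets B \<tau> k"
  shows "(\<Sum>x\<in>B k. pi_fun B \<Delta> \<epsilon> C x) = 1"
proof -
  obtain w where w: "w \<in> level_words k" "mset (map orbit_average w) = C"
    using index_multisets_word[OF assms] by blast
  let ?cs = "map orbit_average w"
  have cs: "set ?cs \<subseteq> orbit_average ` B 1" "length ?cs = k" using w(1) by (auto simp: level_words_def)
  have graded: "symmetrized ?cs \<in> span (B k)"
    using symmetrized_orbit_averages_graded[OF cs(1)] cs(2) by simp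
  have "(\<Sum>x\<in>B k. pi_fun B \<Delta> \<epsilon> C x)
      = (\<Sum>x\<in>B k. coef B (symmetrized ?cs) x * eta B \<Delta> \<epsilon> k x) / (fact k)\<^sup>2"
    unfolding w(2)[symmetric] pi_fun_eq cs(2) by (simp add: sum_divide_distrib mult.commute)
  also have "(\<Sum>x\<in>B k. coef B (symmetrized ?cs) x * eta B \<Delta> \<epsilon> k x)
      = eta B \<Delta> \<epsilon> k (\<Sum>x\<in>B k. coef B (symmetrized ?cs) x *\<^sub>R x)"
    by (simp add: linear_sum[OF linear_eta] linear_scale[OF linear_eta])
  also have "\<dots> = (fact k)\<^sup>2"
    using graded_expansion[OF graded] eta_symmetrized[OF cs(1)] cs(2) by simp
  finally show ?thesis by simp
qed

end

section \<open>Stationary functions as fixed vectors\<close>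

locale positive_hopf_chain = hopf_chain B \<Delta> \<epsilon> \<tau> n P
  for B :: "nat \<Rightarrow> 'h::real_algebra_1 set" and \<Delta> \<epsilon> \<tau> n P +
  assumes eta_pos: "x \<in> B n \<Longrightarrow> eta B \<Delta> \<epsilon> n x > 0"
begin

abbreviation "\<eta> \<equiv> eta B \<Delta> \<epsilon> n"

abbreviation "K \<equiv> transition B \<Delta> \<epsilon> \<tau> n P"

text \<open>Undoes the Doob transform: \<open>K\<close> is the matrix of the averaged operator
  conjugated by \<open>\<eta>\<close>, so dividing by \<open>\<eta>\<close> turns the action of
  \<open>K\<close> on row vectors into the operator itself.\<close>

definition density :: "('h \<Rightarrow> real) \<Rightarrow> 'h" where
  "density \<pi> = (\<Sum>x\<in>B n. (\<pi> x / \<eta> x) *\<^sub>R x)"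

lemma density_graded: "density \<pi> \<in> span (B n)"
  unfolding density_def by (intro span_sum span_scale span_base)

lemma coef_density: "coef B (density \<pi>) x = (if x \<in> B n then \<pi> x / \<eta> x else 0)"
  unfolding density_def by (rule coef_combination) (auto simp: finite_basis)

lemma density_eq_iff:
  assumes "h \<in> span (B n)"
  shows "density \<pi> = h \<longleftrightarrow> (\<forall>x\<in>B n. \<pi> x = \<eta> x * coef B h x)"
proof
  assume "density \<pi> = h"
  then show "\<forall>x\<in>B n. \<pi> x = \<eta> x * coef B h x"
    using coef_density[of \<pi>] eta_pos by force
next
  assume *: "\<forall>x\<in>B n. \<pi> x = \<eta> x * coef B h x"
  show "density \<pi> = h"
  proof (rule coef_eqI)
    fix x
    show "coef B (density \<pi>) x = coef B h x"
      using * eta_pos[of x] coef_graded[OF assms, of x] by (auto simp: coef_density)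
  qed
qed

lemma stationary_iff: "stationary (B n) K \<pi> \<longleftrightarrow> averaged (density \<pi>) = density \<pi>"
proof -
  have "(\<Sum>x\<in>B n. \<pi> x * K x y) = \<eta> y * coef B (averaged (density \<pi>)) y" for y
    unfolding density_def linear_sum[OF linear_averaged] linear_scale[OF linear_averaged]
    by (simp add: coef_sum coef_scale transition_def sum_distrib_left algebra_simps)
  then have "stationary (B n) K \<pi> \<longleftrightarrow> (\<forall>y\<in>B n. \<pi> y = \<eta> y * coef B (averaged (density \<pi>)) y)"
    unfolding stationary_def by auto
  also have "\<dots> \<longleftrightarrow> density \<pi> = averaged (density \<pi>)"
    by (rule density_eq_iff[OF averaged_graded, symmetric])
  finally show ?thesis by auto
qed

lemma sum_density: "(\<Sum>x\<in>B n. \<pi> x) = \<eta> (density \<pi>)"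
  unfolding density_def linear_sum[OF linear_eta] linear_scale[OF linear_eta]
  using eta_pos by (intro sum.cong) force+

lemma stationary_representation:
  assumes mix: "decorations_mix B \<tau> n P" and stat: "stationary (B n) K \<pi>"
  shows "\<exists>!a. a \<in> extensional (index_multisets B \<tau> n) \<and>
    (\<forall>x\<in>B n. \<pi> x = (\<Sum>C\<in>index_multisets B \<tau> n. a C * pi_fun B \<Delta> \<epsilon> C x))"
proof -
  let ?I = "index_multisets B \<tau> n"
  obtain W where W: "\<And>C. C \<in> ?I \<Longrightarrow> W C \<in> level_words n \<and> mset (map orbit_average (W C)) = C"
    using bchoice[of ?I "\<lambda>C w. w \<in> level_words n \<and> mset (map orbit_average w) = C"]
      index_multisets_word by blast
  define s where "s C = symmetrized (map orbit_average (W C))" for C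
  have cs: "set (map orbit_average (W C)) \<subseteq> orbit_average ` B 1" "length (map orbit_average (W C)) = n"
    if "C \<in> ?I" for C
    using W[OF that] by (auto simp: level_words_def)
  have s_graded: "s C \<in> span (B n)" if "C \<in> ?I" for C
    using symmetrized_orbit_averages_graded[OF cs(1)[OF that]] cs(2)[OF that] by (simp add: s_def)
  have s_fixed: "averaged (s C) = s C" if "C \<in> ?I" for C
    unfolding s_def by (rule averaged_symmetrized[OF cs[OF that]])
  have s_coef: "mset (map orbit_average w) = C \<Longrightarrow> word_coef w (s C) > 0"
    "mset (map orbit_average w) \<noteq> C \<Longrightarrow> word_coef w (s C) = 0"
    if "C \<in> ?I" "w \<in> level_words n" for C w
    using word_coef_symmetrized[OF cs(1)[OF that(1)], of w] cs(2)[OF that(1)] that(2) W[OF that(1)]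
    unfolding s_def by (auto simp: level_words_def)
  define h where "h = density \<pi>"
  have h: "h \<in> span (B n)" "averaged h = h"
    using density_graded stat by (simp_all add: h_def stationary_iff)
  have combination: "(\<forall>x\<in>B n. \<pi> x = (\<Sum>C\<in>?I. a C * pi_fun B \<Delta> \<epsilon> C x))
      \<longleftrightarrow> h = (\<Sum>C\<in>?I. (a C / (fact n)\<^sup>2) *\<^sub>R s C)" for a
  proof -
    have pi: "pi_fun B \<Delta> \<epsilon> C x = \<eta> x / (fact n)\<^sup>2 * coef B (s C) x" if "C \<in> ?I" for C x
      using pi_fun_eq[of "map orbit_average (W C)" x] W[OF that] cs(2)[OF that] by (simp add: s_def)
    have "(\<Sum>C\<in>?I. a C * pi_fun B \<Delta> \<epsilon> C x) = \<eta> x * coef B (\<Sum>C\<in>?I. (a C / (fact n)\<^sup>2) *\<^sub>R s C) x" for x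
      by (simp add: coef_sum coef_scale sum_distrib_left pi algebra_simps)
    then show ?thesis
      unfolding h_def
      using density_eq_iff[of "\<Sum>C\<in>?I. (a C / (fact n)\<^sup>2) *\<^sub>R s C" \<pi>] s_graded
      by (simp add: span_sum span_scale)
  qed
  have single: "word_coef w (\<Sum>C\<in>?I. b C *\<^sub>R s C) = b C * word_coef w (s C)"
    if "w \<in> level_words n" "mset (map orbit_average w) = C" for w b C
  proof -
    have "word_coef w (\<Sum>C\<in>?I. b C *\<^sub>R s C) = (\<Sum>C'\<in>?I. if C' = C then b C * word_coef w (s C) else 0)"
      unfolding word_coef_sum word_coef_scale using s_coef(2) that by (intro sum.cong) auto
    then show ?thesis using level_word_index[OF that(1)] that(2) finite_index_multisets by auto
  qed
  \<comment> \<open>Forced by comparing coefficients at the representative word \<open>W C\<close>,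
    where \<open>s C\<close> is the only nonvanishing summand; the squared factorial cancels the
    normalization of \<open>pi_fun\<close>.\<close>
  define c where "c C = (fact n)\<^sup>2 * (word_coef (W C) h / word_coef (W C) (s C))" for C
  have coeff: "a C = c C" if "h = (\<Sum>C\<in>?I. (a C / (fact n)\<^sup>2) *\<^sub>R s C)" "C \<in> ?I" for a C
    using single[of "W C" C "\<lambda>C. a C / (fact n)\<^sup>2"] W[OF that(2)] s_coef(1)[of C "W C"] that
    by (simp add: c_def)
  have "h - (\<Sum>C\<in>?I. (c C / (fact n)\<^sup>2) *\<^sub>R s C) = 0"
  proof (rule fixed_eq_zero)
    show "h - (\<Sum>C\<in>?I. (c C / (fact n)\<^sup>2) *\<^sub>R s C) \<in> span (B n)"
      using h(1) s_graded by (intro span_diff span_sum span_scale)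
    show "averaged (h - (\<Sum>C\<in>?I. (c C / (fact n)\<^sup>2) *\<^sub>R s C)) = h - (\<Sum>C\<in>?I. (c C / (fact n)\<^sup>2) *\<^sub>R s C)"
      using h(2) s_fixed by (simp add: linear_diff[OF linear_averaged] linear_sum[OF linear_averaged]
        linear_scale[OF linear_averaged])
    fix w assume w: "w \<in> level_words n"
    let ?C = "mset (map orbit_average w)"
    have C: "?C \<in> ?I" by (rule level_word_index[OF w])
    \<comment> \<open>The difference vanishes at representative words by the choice of
      \<open>c\<close>; orbit invariance of fixed vectors carries this over to all words of degree
      one letters.\<close>
    have same: "word_coef w g = word_coef (W ?C) g" if "g \<in> span (B n)" "averaged g = g" for g
      using fixed_orbit_invariant[OF that mix w] W[OF C] by simp
    show "word_coef w (h - (\<Sum>C\<in>?I. (c C / (fact n)\<^sup>2) *\<^sub>R s C)) = 0"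
      unfolding word_coef_diff single[OF w refl]
      using s_coef(1)[OF C, of "W ?C"] W[OF C] same[OF h] same[OF s_graded[OF C] s_fixed[OF C]]
      by (simp add: c_def)
  qed
  then have "h = (\<Sum>C\<in>?I. (c C / (fact n)\<^sup>2) *\<^sub>R s C)" by simp
  then have ex: "h = (\<Sum>C\<in>?I. (restrict c ?I C / (fact n)\<^sup>2) *\<^sub>R s C)" by simp
  show ?thesis
  proof (rule ex1I[of _ "restrict c ?I"])
    show "restrict c ?I \<in> extensional ?I \<and>
        (\<forall>x\<in>B n. \<pi> x = (\<Sum>C\<in>?I. restrict c ?I C * pi_fun B \<Delta> \<epsilon> C x))"
      using ex combination by blast
  next
    fix a assume a: "a \<in> extensional ?I \<and> (\<forall>x\<in>B n. \<pi> x = (\<Sum>C\<in>?I. a C * pi_fun B \<Delta> \<epsilon> C x))"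
    then have "h = (\<Sum>C\<in>?I. (a C / (fact n)\<^sup>2) *\<^sub>R s C)" using combination by blast
    then show "a = restrict c ?I"
      using a coeff by (intro extensionalityI[of a ?I]) auto
  qed
qed

text \<open>\<open>\<eta>\<close> sums the coefficients of all words of degree one letters, and by
  \<open>sum_outcomes_level_words\<close> each normalized operator leaves that sum
  unchanged.\<close>

lemma transition_row_sum:
  assumes x: "x \<in> B n"
  shows "(\<Sum>y\<in>B n. K x y) = 1"
proof -
  let ?m = "\<lambda>D. multinomial (forget_decorations D)"
  have "\<eta> (descent_op D x) / ?m D = \<eta> x" if "D \<in> set_pmf P" for D
  proof -
    have "\<eta> (descent_op D x) = (\<Sum>w\<in>level_words n. \<Sum>w'\<leftarrow>outcomes D w. word_coef w' x)"
      unfolding eta_eq_sum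
    proof (rule sum.cong[OF refl])
      fix w assume w: "w \<in> level_words n"
      have "set w \<subseteq> positive_basis" using w level_positive by (auto simp: level_words_def)
      then show "word_coef w (descent_op D x) = (\<Sum>w'\<leftarrow>outcomes D w. word_coef w' x)"
        using w word_coef_long[OF span_base[OF x]]
        by (intro word_coef_descent_op) (auto simp: level_words_def)
    qed
    then show ?thesis
      unfolding sum_outcomes_level_words[OF support[OF that]] eta_eq_sum
      using multinomial_pos[of "forget_decorations D"] by simp
  qed
  then have "\<eta> (averaged x) = measure_pmf.expectation P (\<lambda>D. \<eta> x)"
    unfolding linear_averaged_functional[OF linear_eta]
    by (intro integral_cong_AE) (auto simp: AE_measure_pmf_iff)
  then have eta: "\<eta> (averaged x) = \<eta> x" by simp
  have "(\<Sum>y\<in>B n. K x y) = \<eta> (\<Sum>y\<in>B n. coef B (averaged x) y *\<^sub>R y) / \<eta> x"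
    unfolding transition_def linear_sum[OF linear_eta] linear_scale[OF linear_eta]
    by (simp add: sum_divide_distrib mult.commute)
  then show ?thesis
    unfolding graded_expansion[OF averaged_graded] eta using eta_pos[OF x] by simp
qed

text \<open>There is only one word of \<open>n\<close> degree one letters. Subtracting the multiple
  of \<open>b ^ n\<close> with the same coefficient there leaves a fixed vector to which
  \<open>fixed_eq_zero\<close> applies.\<close>

lemma stationary_singleton:
  assumes b: "B 1 = {b}" and "stationary (B n) K \<rho>"
  shows "\<exists>r. density \<rho> = r *\<^sub>R b ^ n"
proof -
  have bB: "b \<in> B 1" using b by simp
  then have tau: "\<tau> b = b" using tau_basis(1)[OF bB] b by simp
  then have avg: "orbit_average b = b" by (simp add: orbit_average_def scaleR_2[symmetric])
  then have bO: "b \<in> orbit_average ` B 1" using bB by (metis imageI)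
  define w where "w = replicate n b"
  have W: "level_words n = {w}"
    unfolding level_words_def b w_def by (auto intro!: replicate_eqI)
  have "word_coef w (b ^ n) > 0"
    using word_coef_prod_list(2)[of "replicate n b" w] bB bO avg
    by (simp add: w_def set_replicate_conv_if)
  then have pos: "word_coef w (b ^ n) \<noteq> 0" by simp
  define r where "r = word_coef w (density \<rho>) / word_coef w (b ^ n)"
  have "density \<rho> - r *\<^sub>R b ^ n = 0"
  proof (rule fixed_eq_zero)
    show "density \<rho> - r *\<^sub>R b ^ n \<in> span (B n)"
      by (intro span_diff span_scale density_graded power_graded span_base bB)
    show "averaged (density \<rho> - r *\<^sub>R b ^ n) = density \<rho> - r *\<^sub>R b ^ n"
      using assms(2) averaged_power[OF span_base[OF bB] tau]
      by (simp add: linear_diff[OF linear_averaged] linear_scale[OF linear_averaged] stationary_iff)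
  qed (use pos in \<open>simp add: W word_coef_diff word_coef_scale r_def\<close>)
  then show ?thesis by auto
qed

lemma density_singleton:
  assumes b: "B 1 = {b}"
  shows "density (\<lambda>x. \<eta> x / fact n * coef B (b ^ n) x) = (1 / fact n) *\<^sub>R b ^ n"
    and "\<eta> (b ^ n) = fact n"
    and "stationary (B n) K (\<lambda>x. \<eta> x / fact n * coef B (b ^ n) x)"
proof -
  have bB: "b \<in> B 1" using b by simp
  then have tau: "\<tau> b = b" using tau_basis(1)[OF bB] b by simp
  then have avg: "orbit_average b = b" by (simp add: orbit_average_def scaleR_2[symmetric])
  show *: "density (\<lambda>x. \<eta> x / fact n * coef B (b ^ n) x) = (1 / fact n) *\<^sub>R b ^ n"
    by (subst density_eq_iff[OF span_scale[OF power_graded[OF span_base[OF bB]]]])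
       (simp add: coef_scale)
  show "\<eta> (b ^ n) = fact n"
    using eta_prod_list[of "replicate n b"] image_eqI[of b orbit_average b "B 1"] avg bB
    by (simp add: set_replicate_conv_if)
  show "stationary (B n) K (\<lambda>x. \<eta> x / fact n * coef B (b ^ n) x)"
    unfolding stationary_iff * linear_scale[OF linear_averaged]
    using averaged_power[OF span_base[OF bB] tau] by simp
qed

end

text \<open>Membership of \<open>a\<close> in \<open>extensional\<close> pins down its values off
  the index set, which do not affect the sum, so that unique existence speaks of the coefficients
  alone. In the singleton case uniqueness is among stationary functions of total mass 1.\<close>

theorem theorem4p3:
  fixes B :: "nat \<Rightarrow> 'h::real_algebra_1 set"
    and \<Delta> :: "'h \<Rightarrow> 'h \<times> 'h \<Rightarrow> real"
    and \<epsilon> :: "'h \<Rightarrow> real"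
    and \<tau> :: "'h \<Rightarrow> 'h"
    and n :: nat
    and P :: "decorated_composition pmf"
  assumes hopf: "graded_connected_hopf_algebra B \<Delta> \<epsilon>"
    and involution: "graded_basis_involution B \<tau>"
    and ambimorphism: "hopf_ambimorphism B \<Delta> \<epsilon> \<tau>"
    and P_support:
      "set_pmf P \<subseteq> signed_weak_compositions n \<or> set_pmf P \<subseteq> tilde_signed_weak_compositions n"
    and product_nonneg:
      "\<And>D zs y. \<lbrakk>pmf P D > 0; list_all2 (\<lambda>z e. z \<in> B e) zs (forget_decorations D); y \<in> B n\<rbrakk>
         \<Longrightarrow> coef B (prod_list zs) y \<ge> 0"
    and coproduct_nonneg:
      "\<And>D x w. \<lbrakk>pmf P D > 0; x \<in> B n; list_all2 (\<lambda>u e. u \<in> B e) w (forget_decorations D)\<rbrakk>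
         \<Longrightarrow> refined_coproduct B \<Delta> \<epsilon> (forget_decorations D) x w \<ge> 0"
    and eta_pos: "\<And>x. x \<in> B n \<Longrightarrow> eta B \<Delta> \<epsilon> n x > 0"
    and two_parts: "\<exists>D. pmf P D > 0 \<and> length (filter (\<lambda>e. e \<noteq> 0) (forget_decorations D)) \<ge> 2"
    and some_decorated: "\<exists>D. pmf P D > 0 \<and> (\<exists>d\<in>set D. decorated d)"
  shows "(decorations_mix B \<tau> n P \<longrightarrow>
           (\<forall>\<pi>. stationary (B n) (transition B \<Delta> \<epsilon> \<tau> n P) \<pi> \<longrightarrow>
             (\<exists>!a. a \<in> extensional (index_multisets B \<tau> n) \<and>
                (\<forall>x\<in>B n. \<pi> x = (\<Sum>C\<in>index_multisets B \<tau> n. a C * pi_fun B \<Delta> \<epsilon> C x)))))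
       \<and> (\<forall>C\<in>index_multisets B \<tau> n. (\<Sum>x\<in>B n. pi_fun B \<Delta> \<epsilon> C x) = 1)
       \<and> (\<forall>b. B 1 = {b} \<longrightarrow>
           (let \<pi> = (\<lambda>x. eta B \<Delta> \<epsilon> n x / fact n * coef B (b ^ n) x) in
              (\<forall>x\<in>B n. \<pi> x \<ge> 0) \<and> (\<Sum>x\<in>B n. \<pi> x) = 1 \<and>
              stationary (B n) (transition B \<Delta> \<epsilon> \<tau> n P) \<pi> \<and>
              (\<forall>\<rho>. stationary (B n) (transition B \<Delta> \<epsilon> \<tau> n P) \<rho> \<and> (\<Sum>x\<in>B n. \<rho> x) = 1
                 \<longrightarrow> (\<forall>x\<in>B n. \<rho> x = \<pi> x))))"
proof -
  interpret graded_connected_hopf_algebra B \<Delta> \<epsilon> by (rule hopf)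
  interpret positive_hopf_chain B \<Delta> \<epsilon> \<tau> n P
  proof unfold_locales
    show "sum_list (forget_decorations D) = n" if "D \<in> set_pmf P" for D
      using P_support that
      by (auto simp: signed_weak_compositions_def tilde_signed_weak_compositions_def)
    show "\<exists>D\<in>set_pmf P. length (filter (\<lambda>e. e \<noteq> 0) (forget_decorations D)) \<ge> 2"
      using two_parts by (auto simp: pmf_positive_iff)
  qed (fact involution ambimorphism eta_pos)+
  \<comment> \<open>\<open>\<tau>\<close> permutes each \<open>B e\<close>, so after the flips the
    factors are still basis elements of the right degrees and the two nonnegativity hypotheses
    combine termwise.\<close>
  have K_nonneg: "K x y \<ge> 0" if x: "x \<in> B n" and y: "y \<in> B n" for x y
  proof -
    have "coef B (descent_op D x) y \<ge> 0" if D: "D \<in> set_pmf P" for D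
    proof -
      let ?f = "\<lambda>d u. if decorated d then \<tau> u else u"
      have D': "pmf P D > 0" using D by (simp add: pmf_positive_iff)
      have "word_coef w x * coef B (prod_list (map2 ?f D w)) y \<ge> 0"
        if "w \<in> words (forget_decorations D)" for w
      proof -
        have w: "list_all2 (\<lambda>u e. u \<in> B e) w (forget_decorations D)" using that by (simp add: words_def)
        then have "word_coef w x \<ge> 0"
          using coproduct_nonneg[OF D' x w] by (simp add: refined_coproduct_def iter_coproduct_eq)
        moreover have "list_all2 (\<lambda>z e. z \<in> B e) (map2 ?f D w) (forget_decorations D)"
          using w tau_basis(1) by (auto simp: list_all2_conv_all_nth forget_decorations_def)
        ultimately show ?thesis using product_nonneg[OF D' _ y] by simp
      qed
      then show ?thesis
        unfolding signed_descent_op_eq[symmetric] signed_descent_op_eq_sum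
        by (simp add: coef_sum coef_scale sum_nonneg)
    qed
    then have "coef B (averaged x) y \<ge> 0"
      unfolding linear_averaged_functional[OF linear_coef]
      by (intro integral_nonneg_AE) (simp add: AE_measure_pmf_iff multinomial_pos less_imp_le)
    then show ?thesis using eta_pos[OF x] eta_pos[OF y] by (simp add: transition_def)
  qed
  have singleton: "(\<forall>x\<in>B n. \<pi> x \<ge> 0) \<and> (\<Sum>x\<in>B n. \<pi> x) = 1 \<and> stationary (B n) K \<pi> \<and>
      (\<forall>\<rho>. stationary (B n) K \<rho> \<and> (\<Sum>x\<in>B n. \<rho> x) = 1 \<longrightarrow> (\<forall>x\<in>B n. \<rho> x = \<pi> x))"
    if b: "B 1 = {b}" and \<pi>: "\<pi> = (\<lambda>x. \<eta> x / fact n * coef B (b ^ n) x)" for b \<pi>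
  proof -
    note d = density_singleton[OF b, folded \<pi>]
    have one: "(\<Sum>x\<in>B n. \<pi> x) = 1"
      unfolding sum_density d(1) linear_scale[OF linear_eta] d(2) by simp
    have multiple: "\<rho> x = (\<Sum>x\<in>B n. \<rho> x) * \<pi> x" if stat: "stationary (B n) K \<rho>" and x: "x \<in> B n" for \<rho> x
    proof -
      obtain r where r: "density \<rho> = r *\<^sub>R b ^ n" using stationary_singleton[OF b stat] by blast
      then have "(\<Sum>x\<in>B n. \<rho> x) = r * fact n"
        unfolding sum_density r linear_scale[OF linear_eta] d(2) by simp
      moreover have "\<rho> x = \<eta> x * coef B (r *\<^sub>R b ^ n) x"
        using density_eq_iff[of "r *\<^sub>R b ^ n" \<rho>] r density_graded[of \<rho>] x by simp
      ultimately show ?thesis by (simp add: \<pi> coef_scale)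
    qed
    \<comment> \<open>The absolute value of \<open>\<pi>\<close> is stationary too, hence a multiple
      of \<open>\<pi>\<close>; the factor is its total mass, which is at least 1.\<close>
    have "\<pi> x \<ge> 0" if x: "x \<in> B n" for x
    proof -
      have "stationary (B n) K (\<lambda>x. \<bar>\<pi> x\<bar>)"
        by (rule stationary_abs[OF finite_basis K_nonneg transition_row_sum d(3)])
      from multiple[OF this x] have "\<bar>\<pi> x\<bar> = (\<Sum>x\<in>B n. \<bar>\<pi> x\<bar>) * \<pi> x" .
      moreover have "(\<Sum>x\<in>B n. \<bar>\<pi> x\<bar>) \<ge> 1" using sum_abs[of \<pi> "B n"] one by simp
      ultimately show ?thesis by (smt (verit) mult_pos_neg)
    qed
    moreover have "\<rho> x = \<pi> x"
      if "stationary (B n) K \<rho>" "(\<Sum>x\<in>B n. \<rho> x) = 1" "x \<in> B n" for \<rho> x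
      using multiple[OF that(1,3)] that(2) by simp
    ultimately show ?thesis using one d(3) by blast
  qed
  show ?thesis
    using stationary_representation sum_pi_fun singleton by (simp add: Let_def)
qed

end
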